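(* Assume that $n>2$ ($n$ an integer), $m=m_*=\frac{n-4}{n-2}$ and $D>0$, and let $V_D(x)=(D+|x|^2)^{-\frac{1}{1-m}}=(D+|x|^2)^{-\frac{n-2}{2}}$ for $x\in\mathbb{R}^n$. Let $v$ be the solution of $$v_t=\nabla\cdot(v^{m-1}\nabla v)+\mu\,\nabla\cdot(x\,v),\qquad x\in\mathbb{R}^n,\ t>0,\qquad \mu=\frac{2}{1-m}=n-2,$$ with the initial condition $$v(x,0)=v_0(x):=\Big(|x|^2+D+\psi_0(x)\Big)^{-\frac{n-2}{2}},\qquad x\in\mathbb{R}^n,$$ where $\psi_0$ is continuous and nonnegative on $\mathbb{R}^n$, $\psi_0\not\equiv 0$. (i) If there are $B>0$ and $\gamma\in(0,1)$ such that $$\psi_0(x)\le B\,(\ln|x|)^{-\gamma},\qquad |x|>2,$$ then there exists $C>0$ such that $$V_D(x)\Big(1-C\,V_D(x)^{\frac{2}{n-2}}(t+1)^{-\frac{\gamma}{2}}\Big)\le v(x,t)\le V_D(x),\qquad x\in\mathbb{R}^n,\ t\ge 0.$$ (ii) If there are $b>0$ and $\gamma\in(0,1)$ such that $$\psi_0(x)\ge b\,(\ln|x|)^{-\gamma},\qquad |x|>2,$$ then there exists $c>0$ such that $$v(0,t)\le V_D(0)-c\,(t+1)^{-\frac{\gamma}{2}},\qquad t>0.$$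
   Context: The equation is the rescaled (non-linear Fokker--Planck) form of the fast diffusion equation $u_\tau=\nabla\cdot(u^{m-1}\nabla u)$ with critical exponent $m=m_*$; positive solutions of the Cauchy problem are considered. With $m=m_*$ one has $\frac{1}{1-m}=\frac{n-2}{2}$, and $V_D$ (the Barenblatt profile) is a stationary solution of the equation.
   Formalization: In (ii) the bound for all t>0 is stated only if ψ_0(0)>0 (it fails as t→0+ if ψ_0(0)=0); in general it holds for t≥t_0, any t_0>0, c depending on t_0. "The solution": positive, classical; if v_0 is at least a multiple of V_1, v keeps such a bound on bounded time intervals. *)

theory Defs
  imports "HOL-Analysis.Analysis"
begin

definition gradient :: "(real ^ 'n \<Rightarrow> real) \<Rightarrow> real ^ 'n \<Rightarrow> real ^ 'n" where
  "gradient f x = (THE d. GDERIV f x :> d)"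

definition divergence :: "(real ^ 'n \<Rightarrow> real ^ 'n) \<Rightarrow> real ^ 'n \<Rightarrow> real" where
  "divergence F x = (\<Sum>i\<in>UNIV. frechet_derivative F (at x) (axis i 1) $ i)"

definition barenblatt :: "real \<Rightarrow> real \<Rightarrow> real ^ 'n \<Rightarrow> real" where
  "barenblatt m D x = (D + (norm x)\<^sup>2) powr (- (1 / (1 - m)))"

text \<open>
  Positive classical solutions of
  \<open>v\<^sub>t = div (v\<^bsup>m-1\<^esup> grad v) + \<mu> div (x v)\<close> for \<open>t > 0\<close>, \<open>v(x,0) = v\<^sub>0(x)\<close>:
  of class \<open>C\<close> on \<open>t \<ge> 0\<close> and of class \<open>C\<^bsup>2,1\<^esup>\<close> on \<open>t > 0\<close>.
  The differentiability requirements are stated separately because \<open>deriv\<close>,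
  \<open>gradient\<close> and \<open>frechet_derivative\<close> are total functions.
\<close>
definition positive_classical_solution ::
    "real \<Rightarrow> real \<Rightarrow> (real ^ 'n \<Rightarrow> real) \<Rightarrow> (real ^ 'n \<Rightarrow> real \<Rightarrow> real) \<Rightarrow> bool" where
  "positive_classical_solution m \<mu> v0 v \<longleftrightarrow>
     (\<forall>x. \<forall>t\<ge>0. v x t > 0) \<and>
     continuous_on (UNIV \<times> {0..}) (\<lambda>(x, t). v x t) \<and>
     (\<forall>x. \<forall>t>0. v x differentiable (at t)) \<and>
     (\<forall>x. \<forall>t>0. (\<lambda>y. v y t) differentiable (at x)) \<and>
     (\<forall>x. \<forall>t>0. gradient (\<lambda>y. v y t) differentiable (at x)) \<and>
     continuous_on (UNIV \<times> {0<..}) (\<lambda>(x, t). deriv (v x) t) \<and>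
     continuous_on (UNIV \<times> {0<..}) (\<lambda>(x, t). gradient (\<lambda>y. v y t) x) \<and>
     (\<forall>i. continuous_on (UNIV \<times> {0<..})
            (\<lambda>(x, t). frechet_derivative (gradient (\<lambda>y. v y t)) (at x) (axis i 1))) \<and>
     (\<forall>x. \<forall>t>0. deriv (v x) t =
        divergence (\<lambda>y. (v y t powr (m - 1)) *\<^sub>R gradient (\<lambda>z. v z t) y) x
        + \<mu> * divergence (\<lambda>y. v y t *\<^sub>R y) x) \<and>
     (\<forall>x. v x 0 = v0 x)"

text \<open>
  For \<open>m \<le> 0\<close> the Cauchy problem needs a uniqueness class, since mass may be lost
  through spatial infinity.  The solution belonging to data bounded below by a multiple of
  a Barenblatt profile is the one that keeps such a bound, with some constant, on every bounded
  time interval; this determines it uniquely.  For \<open>0 < m < 1\<close> the clause is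
  automatic, by uniqueness of the solution.  Which \<open>D > 0\<close> is used is
  irrelevant, as all these profiles are comparable; \<open>D = 1\<close> is taken.
  For all other data the clause is void.
\<close>
definition cauchy_solution ::
    "real \<Rightarrow> real \<Rightarrow> (real ^ 'n \<Rightarrow> real) \<Rightarrow> (real ^ 'n \<Rightarrow> real \<Rightarrow> real) \<Rightarrow> bool" where
  "cauchy_solution m \<mu> v0 v \<longleftrightarrow>
     positive_classical_solution m \<mu> v0 v \<and>
     ((\<exists>c>0. \<forall>x. c * barenblatt m 1 x \<le> v0 x) \<longrightarrow>
      (\<forall>T\<ge>0. \<exists>c>0. \<forall>x. \<forall>t\<in>{0..T}. c * barenblatt m 1 x \<le> v x t))"

end

theory Submission
  imports Defs
begin

text \<open>
  In terms of the pressure \<open>v\<^bsup>-1/p\<^esup> = |x|\<^sup>2 + D + u\<close>, \<open>p = (n-2)/2\<close>, the equation becomes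
  \<open>u\<^sub>t = (|x|\<^sup>2 + D + u) \<Delta>u - (n-2) x \<cdot> \<nabla>u - p |\<nabla>u|\<^sup>2\<close>. For radial \<open>u\<close> and large \<open>|x|\<close>
  this is, at the critical exponent, the one-dimensional heat equation in the variable \<open>ln |x|\<close>,
  which turns initial decay \<open>(ln |x|)\<^bsup>-\<gamma>\<^esup>\<close> into temporal decay \<open>t\<^bsup>-\<gamma>/2\<^esup>\<close>.
  Both bounds follow by comparison with explicit functions of \<open>ln (|x|\<^sup>2 + A)\<close> and \<open>t\<close>. For the
  lower bound on \<open>u\<close>, the initial bound holds only for \<open>|x| > 2\<close>; subsolutions carried by moving
  balls first spread it to all of space within an arbitrarily short time.
\<close>

section \<open>The pressure equation and comparison\<close>

text \<open>For radial \<open>u = F(L)\<close>, \<open>L = ln |x|^2\<close>, one has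
  \<open>|x|^2 \<Delta>u = 4 F'' + 2 (n - 2) F'\<close>, and the drift contributes exactly
  \<open>- 2 (n - 2) F'\<close>. This cancellation leaves \<open>F_t = 4 F''\<close>. Because
  \<open>\<gamma> < 1\<close>, the rate \<open>t^(- \<gamma> / 2)\<close> is slower than the decay
  \<open>t^(- 1 / 2)\<close> of the heat kernel, so the tail of the data governs it. The two
  barriers differ in difficulty. From below, a power of \<open>L^2 + k t\<close> works once
  \<open>k\<close> is large. No \<open>k > 0\<close> makes it a supersolution, since at large
  \<open>L\<close> it is convex in \<open>L\<close> but decreasing in time. From above the profile
  must therefore respect the diffusion constant 4. Moreover, in the variable \<open>L\<close> the
  diffusion degenerates at the origin, where the drift left over by the cancellation has to take its
  place. Comparison from above also needs the pressure to grow at most quadratically. This comes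
  from the lower bound on \<open>v\<close> in \<open>cauchy_solution\<close>.\<close>

text \<open>
  \<open>a\<close>, \<open>g\<close>, \<open>h\<close> are the time derivative, the gradient and the diagonal of the Hessian; only
  derivatives along the coordinate axes are used.
\<close>

definition has_jet ::
    "(real ^ 'n \<Rightarrow> real \<Rightarrow> real) \<Rightarrow> real ^ 'n \<Rightarrow> real \<Rightarrow> real \<Rightarrow> real ^ 'n \<Rightarrow> real ^ 'n \<Rightarrow> bool" where
  "has_jet u x t a g h \<longleftrightarrow>
     (u x has_real_derivative a) (at t) \<and>
     (\<forall>i. \<exists>d. (\<forall>s. ((\<lambda>s. u (x + s *\<^sub>R axis i 1) t) has_real_derivative d s) (at s)) \<and>
        d 0 = g $ i \<and> (d has_real_derivative h $ i) (at 0))"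

definition pressure_operator ::
    "real \<Rightarrow> real ^ 'n \<Rightarrow> real \<Rightarrow> real ^ 'n \<Rightarrow> real ^ 'n \<Rightarrow> real" where
  "pressure_operator D x u g h =
     (x \<bullet> x + D + u) * (\<Sum>i\<in>UNIV. h $ i) - (real CARD('n) - 2) * (x \<bullet> g)
     - (real CARD('n) - 2) / 2 * (g \<bullet> g)"

text \<open>Derivatives are asked for pointwise, without continuity, because the maximum principle
  evaluates them at a single point. The positivity clause expresses ellipticity of the
  equation.\<close>

definition pressure_solution :: "real \<Rightarrow> (real ^ 'n \<Rightarrow> real \<Rightarrow> real) \<Rightarrow> bool" where
  "pressure_solution D u \<longleftrightarrow>
     continuous_on (UNIV \<times> {0..}) (\<lambda>(x, t). u x t) \<and>
     (\<forall>x. \<forall>t\<ge>0. x \<bullet> x + D + u x t > 0) \<and>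
     (\<forall>x. \<forall>t>0. \<exists>a g h. has_jet u x t a g h \<and> a = pressure_operator D x (u x t) g h)"

section \<open>Calculus at a maximum and radial test functions\<close>

lemma second_derivative_nonpos_at_max:
  fixes G d :: "real \<Rightarrow> real"
  assumes der: "\<And>s. (G has_real_derivative d s) (at s)"
    and der2: "(d has_real_derivative h) (at 0)"
    and max: "\<And>s. G s \<le> G 0"
  shows "d 0 = 0" "h \<le> 0"
proof -
  show d0: "d 0 = 0"
    using DERIV_local_max[OF der[of 0], of 1] max by auto
  show "h \<le> 0"
  proof (rule ccontr)
    assume "\<not> h \<le> 0"
    then obtain \<delta> where \<delta>: "\<delta> > 0" "\<And>s. s > 0 \<Longrightarrow> s < \<delta> \<Longrightarrow> d 0 < d (0 + s)"
      using DERIV_pos_inc_right[OF der2] by force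
    have "G 0 < G (\<delta> / 2)"
    proof (rule DERIV_pos_imp_increasing_open[where f = G])
      show "0 < \<delta> / 2" using \<delta> by simp
      show "\<exists>y. (G has_real_derivative y) (at s) \<and> y > 0" if "0 < s" "s < \<delta> / 2" for s
        using der[of s] \<delta>(2)[of s] that d0 by auto
      show "continuous_on {0..\<delta> / 2} G"
        using der by (meson DERIV_continuous continuous_at_imp_continuous_on)
    qed
    then show False using max[of "\<delta> / 2"] by simp
  qed
qed

text \<open>One-sided, because the maximum over a space-time cylinder may lie on its final time
  slice, where only earlier times are available.\<close>

lemma derivative_nonneg_at_left_max:
  fixes G :: "real \<Rightarrow> real"
  assumes der: "(G has_real_derivative a) (at t)" and "t1 < t"
    and max: "\<And>s. t1 \<le> s \<Longrightarrow> s \<le> t \<Longrightarrow> G s \<le> G t"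
  shows "a \<ge> 0"
proof (rule ccontr)
  assume "\<not> a \<ge> 0"
  then obtain \<delta> where \<delta>: "\<delta> > 0" "\<And>s. s > 0 \<Longrightarrow> s < \<delta> \<Longrightarrow> G t < G (t - s)"
    using DERIV_neg_dec_left[OF der] by force
  define s where "s = min (\<delta> / 2) (t - t1)"
  have "s > 0" "s < \<delta>" "t - s \<ge> t1" using \<delta>(1) \<open>t1 < t\<close> by (auto simp: s_def)
  then show False using \<delta>(2)[of s] max[of "t - s"] by force
qed

lemma inner_axis_step:
  fixes x :: "real ^ 'n"
  shows "(x + s *\<^sub>R axis i 1) \<bullet> (x + s *\<^sub>R axis i 1) = x \<bullet> x + 2 * s * x $ i + s\<^sup>2"
  by (simp add: inner_add_left inner_add_right inner_axis inner_commute[of "axis i 1" x]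
      inner_axis_axis power2_eq_square algebra_simps)

text \<open>Writing radial functions through \<open>|z - c|^2\<close> instead of
  \<open>|z - c|\<close> keeps them differentiable at the centre. The time derivative is a separate
  assumption because the centre may itself move with time, while the spatial jet only sees the slice
  at \<open>t\<close>.\<close>

lemma has_jet_radial:
  fixes f :: "real ^ 'n \<Rightarrow> real \<Rightarrow> real"
  assumes time: "(f x has_real_derivative a) (at t)"
    and f: "\<And>z. f z t = G ((z - c) \<bullet> (z - c))"
    and G1: "\<And>\<rho>. \<rho> \<ge> 0 \<Longrightarrow> (G has_real_derivative G1 \<rho>) (at \<rho>)"
    and G2: "(G1 has_real_derivative G2) (at ((x - c) \<bullet> (x - c)))"
  shows "has_jet f x t a ((2 * G1 ((x - c) \<bullet> (x - c))) *\<^sub>R (x - c))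
           (\<chi> i. 4 * G2 * ((x - c) $ i)\<^sup>2 + 2 * G1 ((x - c) \<bullet> (x - c)))"
  unfolding has_jet_def
proof (intro conjI time allI)
  fix i
  define \<rho> where "\<rho> s = (x - c) \<bullet> (x - c) + 2 * s * (x - c) $ i + s\<^sup>2" for s
  have fs: "f (x + s *\<^sub>R axis i 1) t = G (\<rho> s)" for s
  proof -
    have "x + s *\<^sub>R axis i 1 - c = (x - c) + s *\<^sub>R axis i 1" by simp
    then show ?thesis using inner_axis_step[of "x - c" s i] by (simp only: f \<rho>_def)
  qed
  have \<rho>_nonneg: "\<rho> s \<ge> 0" for s
    unfolding \<rho>_def inner_axis_step[symmetric] by simp
  have \<rho>0: "\<rho> 0 = (x - c) \<bullet> (x - c)" by (simp add: \<rho>_def)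
  have d\<rho>: "(\<rho> has_real_derivative 2 * (x - c) $ i + 2 * s) (at s)" for s
    unfolding \<rho>_def by (auto intro!: derivative_eq_intros)
  have 1: "((\<lambda>s. f (x + s *\<^sub>R axis i 1) t) has_real_derivative
        G1 (\<rho> s) * (2 * (x - c) $ i + 2 * s)) (at s)" for s
    unfolding fs using DERIV_chain2[OF G1[OF \<rho>_nonneg] d\<rho>] .
  have 2: "((\<lambda>s. G1 (\<rho> s)) has_real_derivative G2 * (2 * (x - c) $ i + 2 * 0)) (at 0)"
    by (rule DERIV_chain2[OF _ d\<rho>]) (simp add: \<rho>0 G2)
  have 3: "((\<lambda>s. G1 (\<rho> s) * (2 * (x - c) $ i + 2 * s)) has_real_derivative
        4 * G2 * ((x - c) $ i)\<^sup>2 + 2 * G1 ((x - c) \<bullet> (x - c))) (at 0)"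
    by (rule derivative_eq_intros 2 refl | simp)+
       (simp add: \<rho>0 power2_eq_square algebra_simps)
  show "\<exists>d. (\<forall>s. ((\<lambda>s. f (x + s *\<^sub>R axis i 1) t) has_real_derivative d s) (at s)) \<and>
          d 0 = ((2 * G1 ((x - c) \<bullet> (x - c))) *\<^sub>R (x - c)) $ i \<and>
          (d has_real_derivative
             (\<chi> i. 4 * G2 * ((x - c) $ i)\<^sup>2 + 2 * G1 ((x - c) \<bullet> (x - c))) $ i) (at 0)"
    using 1 3 by (intro exI[of _ "\<lambda>s. G1 (\<rho> s) * (2 * (x - c) $ i + 2 * s)"]) (simp add: \<rho>0)
qed

lemma sum_radial_hessian:
  fixes z :: "real ^ 'n"
  shows "(\<Sum>i\<in>UNIV. (\<chi> i. 4 * G2 * (z $ i)\<^sup>2 + 2 * G1) $ i) = 4 * G2 * (z \<bullet> z) + 2 * real CARD('n) * G1"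
  by (simp add: sum.distrib inner_vec_def power2_eq_square sum_distrib_left)

text \<open>
  The maximum of \<open>e\<^bsup>-Kt\<^esup> \<epsilon>(u - f) - \<delta>(1 + |x|\<^sup>2)\<^sup>2\<close> is examined. Everything is required only where
  the conclusion fails. There, for \<open>\<epsilon> = -1\<close>, the quadratic bounds follow from positivity of the
  pressure, so that no growth condition on the solution is needed in that case.
\<close>

lemma comparison:
  fixes u f :: "real ^ 'n \<Rightarrow> real \<Rightarrow> real"
  assumes sgn: "\<epsilon> = 1 \<or> \<epsilon> = - 1" and n: "CARD('n) \<ge> 2"
    and sol: "pressure_solution D u" and t1: "t1 \<ge> 0"
    and cont: "continuous_on (UNIV \<times> {t1..T}) (\<lambda>(x, t). f x t)"
    and init: "\<And>x. \<epsilon> * (u x t1 - f x t1) \<le> 0"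
    and C: "C \<ge> 0"
    and bound: "\<And>x t. t1 \<le> t \<Longrightarrow> t \<le> T \<Longrightarrow> \<epsilon> * (u x t - f x t) > 0 \<Longrightarrow>
        x \<bullet> x + D + u x t \<le> C * (1 + x \<bullet> x) \<and> \<epsilon> * (u x t - f x t) \<le> C * (1 + x \<bullet> x)"
    and barrier: "\<And>x t. t1 < t \<Longrightarrow> t \<le> T \<Longrightarrow> \<epsilon> * (u x t - f x t) > 0 \<Longrightarrow>
        \<exists>a g h. has_jet f x t a g h \<and> \<epsilon> * (a - pressure_operator D x (f x t) g h) \<ge> 0 \<and>
          (\<Sum>i\<in>UNIV. h $ i) \<le> C \<and> - (x \<bullet> g) \<le> C * (1 + x \<bullet> x)"
    and t: "t1 \<le> t" "t \<le> T"
  shows "\<epsilon> * (u x t - f x t) \<le> 0"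
proof (rule ccontr)
  define n where "n = real CARD('n)"
  have n2: "n \<ge> 2" using n by (simp add: n_def)
  define d where "d x t = \<epsilon> * (u x t - f x t)" for x t
  assume "\<not> \<epsilon> * (u x t - f x t) \<le> 0"
  then have pos: "d x t > 0" by (simp add: d_def)
  \<comment> \<open>The summands absorb, in this order, the difference of the Laplacians, the excess
    multiplying the Laplacian of \<open>f\<close>, and the mixed and the quadratic part of the
    gradient term. The final 1 makes the contradiction strict.\<close>
  define K where "K = C * (8 + 4 * n) + C + 8 * ((n - 2) / 2) * C + 16 * ((n - 2) / 2) * C + 1"
  \<comment> \<open>Chosen so that the penalty at the given point is half of the scaled excess,
    which leaves \<open>P x t > 0\<close>.\<close>
  define \<delta> where "\<delta> = exp (- K * t) * d x t / (2 * (1 + x \<bullet> x)\<^sup>2)"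
  have Y1: "1 + z \<bullet> z \<ge> 1" for z :: "real ^ 'n" by simp
  have \<delta>: "\<delta> > 0"
    unfolding \<delta>_def using pos Y1[of x]
    by (intro divide_pos_pos mult_pos_pos zero_less_power) (simp, simp, simp, linarith)
  define P where "P z s = exp (- K * s) * d z s - \<delta> * (1 + z \<bullet> z)\<^sup>2" for z s
  have Px: "P x t > 0"
  proof -
    have "A / (2 * B\<^sup>2) * B\<^sup>2 = A / 2" if "B > 0" for A B :: real using that by simp
    then have "\<delta> * (1 + x \<bullet> x)\<^sup>2 = exp (- K * t) * d x t / 2"
      unfolding \<delta>_def by this (use Y1[of x] in linarith)
    moreover have "exp (- K * t) * d x t > 0" using pos by simp
    ultimately show ?thesis unfolding P_def by linarith
  qed
  have ucont: "continuous_on (UNIV \<times> {0..}) (\<lambda>(x, t). u x t)"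
    using sol by (simp add: pressure_solution_def)
  have dcont: "continuous_on (UNIV \<times> {t1..T}) (\<lambda>(x, t). d x t)"
    unfolding d_def case_prod_beta
    using continuous_on_subset[OF ucont, of "UNIV \<times> {t1..T}"] cont t1
    by (intro continuous_intros) (auto simp: case_prod_beta subset_eq)
  have Pcont: "continuous_on (UNIV \<times> {t1..T}) (\<lambda>(x, t). P x t)"
    unfolding P_def case_prod_beta
    using dcont by (intro continuous_intros) (auto simp: case_prod_beta)
  \<comment> \<open>The penalty grows like \<open>|z|^4\<close>, the excess at most like
    \<open>|z|^2\<close>. Beyond the squared radius \<open>S\<close> the penalty wins, so the
    maximum over a compact cylinder is a maximum over all of space.\<close>
  define S where "S = C * exp (\<bar>K\<bar> * T) / \<delta>"
  have outside: "P z s \<le> 0" if s: "t1 \<le> s" "s \<le> T" and z: "z \<bullet> z \<ge> S" for z s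
  proof (cases "d z s > 0")
    case False
    then have "exp (- K * s) * d z s \<le> 0" by (simp add: mult_nonneg_nonpos)
    moreover have "\<delta> * (1 + z \<bullet> z)\<^sup>2 \<ge> 0" using \<delta> by simp
    ultimately show ?thesis by (simp add: P_def)
  next
    case True
    have "s \<ge> 0" using s t1 by simp
    have "- K * s \<le> \<bar>K\<bar> * T"
    proof -
      have "- K * s \<le> \<bar>K\<bar> * s" using \<open>s \<ge> 0\<close> by (intro mult_right_mono) auto
      also have "\<dots> \<le> \<bar>K\<bar> * T" using s by (intro mult_left_mono) auto
      finally show ?thesis .
    qed
    moreover have "d z s \<le> C * (1 + z \<bullet> z)" using bound[of s z] s True by (auto simp: d_def)
    ultimately have "exp (- K * s) * d z s \<le> exp (\<bar>K\<bar> * T) * (C * (1 + z \<bullet> z))"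
      using True by (intro mult_mono) auto
    also have "\<dots> = \<delta> * S * (1 + z \<bullet> z)" using \<delta> by (simp add: S_def)
    also have "\<dots> \<le> \<delta> * (1 + z \<bullet> z) * (1 + z \<bullet> z)"
      using \<delta> z Y1[of z] by (intro mult_right_mono mult_left_mono) auto
    finally show ?thesis by (simp add: P_def power2_eq_square)
  qed
  define R where "R = max (norm x) (1 + \<bar>S\<bar>)"
  have outsideR: "P z s \<le> 0" if "t1 \<le> s" "s \<le> T" "norm z \<ge> R" for z s
  proof (rule outside[OF that(1,2)])
    have "1 + \<bar>S\<bar> \<le> norm z" using that by (simp add: R_def)
    then have "(1 + \<bar>S\<bar>) * 1 \<le> norm z * norm z" by (intro mult_mono) auto
    then show "S \<le> z \<bullet> z" by (simp add: power2_norm_eq_inner[symmetric] power2_eq_square)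
  qed
  have "compact (cball 0 R \<times> {t1..T} :: ((real ^ 'n) \<times> real) set)"
    by (intro compact_Times compact_cball compact_Icc)
  moreover have "(x, t) \<in> cball 0 R \<times> {t1..T}" using t by (simp add: R_def)
  ultimately obtain q where q: "q \<in> cball 0 R \<times> {t1..T}"
      and qmax: "\<And>q'. q' \<in> cball 0 R \<times> {t1..T} \<Longrightarrow> (\<lambda>(x, t). P x t) q' \<le> (\<lambda>(x, t). P x t) q"
    using continuous_attains_sup[of "cball 0 R \<times> {t1..T}" "\<lambda>(x, t). P x t"]
      continuous_on_subset[OF Pcont, of "cball 0 R \<times> {t1..T}"] by blast
  obtain y s where qy: "q = (y, s)" by (cases q)
  have s: "t1 \<le> s" "s \<le> T" using q qy by auto
  have Pys: "P y s > 0"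
    using qmax[of "(x, t)"] Px t by (simp add: R_def qy)
  have max: "P z r \<le> P y s" if "t1 \<le> r" "r \<le> T" for z r
  proof (cases "norm z \<le> R")
    case True
    then show ?thesis using qmax[of "(z, r)"] that by (simp add: qy)
  next
    case False
    then show ?thesis using outsideR[of r z] that Pys by simp
  qed
  define Y where "Y = 1 + y \<bullet> y"
  define E where "E = \<delta> * exp (K * s)"
  have Y: "Y \<ge> 1" and E: "E > 0" using \<delta> by (auto simp: Y_def E_def)
  have dlow: "E * Y\<^sup>2 < d y s"
  proof -
    have "\<delta> * Y\<^sup>2 < exp (- K * s) * d y s" using Pys by (simp add: P_def Y_def)
    then have "exp (K * s) * (\<delta> * Y\<^sup>2) < exp (K * s) * (exp (- K * s) * d y s)"
      by (intro mult_strict_left_mono) auto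
    also have "\<dots> = d y s" by (simp add: mult.assoc[symmetric] exp_add[symmetric])
    finally show ?thesis by (simp add: E_def mult_ac)
  qed
  have dpos: "d y s > 0"
  proof -
    have "0 \<le> E * Y\<^sup>2" using E by simp
    then show ?thesis using dlow by simp
  qed
  have "s \<noteq> t1"
    using dpos init[of y] by (auto simp: d_def)
  then have s1: "t1 < s" "s > 0" using s t1 by auto
  obtain a g h where jet_f: "has_jet f y s a g h"
      and sup: "\<epsilon> * (a - pressure_operator D y (f y s) g h) \<ge> 0"
      and lap: "(\<Sum>i\<in>UNIV. h $ i) \<le> C" and gr: "- (y \<bullet> g) \<le> C * (1 + y \<bullet> y)"
    using barrier[of s y] s1 s dpos by (auto simp: d_def)
  obtain a' g' h' where jet_u: "has_jet u y s a' g' h'"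
      and eq: "a' = pressure_operator D y (u y s) g' h'"
    using sol s1 unfolding pressure_solution_def by blast
  have w: "y \<bullet> y + D + u y s > 0"
    using sol s1 unfolding pressure_solution_def by auto
  have w_up: "y \<bullet> y + D + u y s \<le> C * Y" and d_up: "d y s \<le> C * Y"
    using bound[of s y] s dpos by (auto simp: d_def Y_def)
  have timed: "\<epsilon> * (a' - a) \<ge> K * d y s"
  proof -
    have "((\<lambda>r. P y r) has_real_derivative
        - K * exp (- K * s) * d y s + exp (- K * s) * (\<epsilon> * (a' - a))) (at s)"
      unfolding P_def d_def using jet_u jet_f unfolding has_jet_def
      by (auto intro!: derivative_eq_intros simp: algebra_simps)
    then have "0 \<le> - K * exp (- K * s) * d y s + exp (- K * s) * (\<epsilon> * (a' - a))"
      by (rule derivative_nonneg_at_left_max[OF _ s1(1)]) (use max s in auto)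
    also have "\<dots> = exp (- K * s) * (\<epsilon> * (a' - a) - K * d y s)" by (simp add: algebra_simps)
    finally show ?thesis by (simp add: zero_le_mult_iff)
  qed
  have axis: "\<epsilon> * (g' $ i - g $ i) = 4 * E * Y * y $ i \<and>
      \<epsilon> * (h' $ i - h $ i) \<le> E * (8 * (y $ i)\<^sup>2 + 4 * Y)" for i
  proof -
    obtain d1 where d1: "\<And>r. ((\<lambda>r. u (y + r *\<^sub>R axis i 1) s) has_real_derivative d1 r) (at r)"
        "d1 0 = g' $ i" "(d1 has_real_derivative h' $ i) (at 0)"
      using jet_u unfolding has_jet_def by blast
    obtain d2 where d2: "\<And>r. ((\<lambda>r. f (y + r *\<^sub>R axis i 1) s) has_real_derivative d2 r) (at r)"
        "d2 0 = g $ i" "(d2 has_real_derivative h $ i) (at 0)"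
      using jet_f unfolding has_jet_def by blast
    define G where "G r = P (y + r *\<^sub>R axis i 1) s" for r
    define \<rho> where "\<rho> r = 1 + (y \<bullet> y + 2 * r * y $ i + r\<^sup>2)" for r
    have G: "G r = exp (- K * s) * (\<epsilon> * (u (y + r *\<^sub>R axis i 1) s - f (y + r *\<^sub>R axis i 1) s))
        - \<delta> * (\<rho> r)\<^sup>2" for r
      by (simp add: G_def P_def d_def \<rho>_def inner_axis_step)
    have d\<rho>: "(\<rho> has_real_derivative 2 * y $ i + 2 * r) (at r)" for r
      unfolding \<rho>_def by (auto intro!: derivative_eq_intros)
    define dG where "dG r = exp (- K * s) * (\<epsilon> * (d1 r - d2 r))
        - \<delta> * (2 * \<rho> r * (2 * y $ i + 2 * r))" for r
    have 1: "(G has_real_derivative dG r) (at r)" for r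
      unfolding G[abs_def] dG_def by (auto intro!: derivative_eq_intros d1(1) d2(1) d\<rho>)
    have 2: "(dG has_real_derivative exp (- K * s) * (\<epsilon> * (h' $ i - h $ i))
        - \<delta> * (8 * (y $ i)\<^sup>2 + 4 * Y)) (at 0)"
      unfolding dG_def[abs_def]
      by (rule derivative_eq_intros d1(3) d2(3) d\<rho> refl)+
         (simp add: \<rho>_def Y_def algebra_simps power2_eq_square)
    have 3: "G r \<le> G 0" for r using max[of s] s by (simp add: G_def)
    note m = second_derivative_nonpos_at_max[OF 1 2 3]
    have ee: "exp (K * s) * (exp (- K * s) * z) = z" for z
      by (simp add: mult.assoc[symmetric] exp_add[symmetric])
    have "exp (- K * s) * (\<epsilon> * (g' $ i - g $ i)) = 4 * \<delta> * Y * y $ i"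
      using m(1) d1(2) d2(2) by (simp add: dG_def \<rho>_def Y_def)
    then have "exp (K * s) * (exp (- K * s) * (\<epsilon> * (g' $ i - g $ i))) = 4 * E * Y * y $ i"
      by (simp add: E_def)
    moreover have "exp (K * s) * (exp (- K * s) * (\<epsilon> * (h' $ i - h $ i)))
        \<le> exp (K * s) * (\<delta> * (8 * (y $ i)\<^sup>2 + 4 * Y))"
      using m(2) by (intro mult_left_mono) auto
    ultimately show ?thesis
      unfolding ee by (simp add: E_def mult.commute[of \<delta>] mult.assoc)
  qed
  have sgn2: "\<epsilon> * \<epsilon> = 1" using sgn by auto
  define l l' where "l = (\<Sum>i\<in>UNIV. h $ i)" and "l' = (\<Sum>i\<in>UNIV. h' $ i)"
  have grad: "g' = g + (\<epsilon> * 4 * E * Y) *\<^sub>R y"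
  proof (rule vec_eq_iff[THEN iffD2], rule allI)
    fix i
    have "\<epsilon> * (\<epsilon> * (g' $ i - g $ i)) = \<epsilon> * (4 * E * Y * y $ i)" using axis[of i] by simp
    then show "g' $ i = (g + (\<epsilon> * 4 * E * Y) *\<^sub>R y) $ i"
      using sgn2 by (simp add: mult.assoc[symmetric])
  qed
  have lapl: "\<epsilon> * (l' - l) \<le> E * (8 * (y \<bullet> y) + 4 * n * Y)"
  proof -
    have "\<epsilon> * (l' - l) = (\<Sum>i\<in>UNIV. \<epsilon> * (h' $ i - h $ i))"
      by (simp add: l_def l'_def sum_subtractf flip: sum_distrib_left)
    also have "\<dots> \<le> (\<Sum>i\<in>UNIV. E * (8 * (y $ i)\<^sup>2 + 4 * Y))"
      using axis by (intro sum_mono) auto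
    also have "\<dots> = E * (8 * (y \<bullet> y) + 4 * n * Y)"
      by (simp add: sum_distrib_left[symmetric] sum.distrib n_def inner_vec_def power2_eq_square)
    finally show ?thesis .
  qed
  have yy: "y \<bullet> y \<ge> 0" "y \<bullet> y \<le> Y" by (auto simp: Y_def)
  define p where "p = (n - 2) / 2"
  have p: "p \<ge> 0" using n2 by (simp add: p_def)
  \<comment> \<open>This tames the nonlinear gradient term. The penalty lies below the excess, which
    grows only quadratically, so the squared gradient of the penalty, quadratic in \<open>E\<close>,
    can be estimated linearly by \<open>d y s\<close> in \<open>T5\<close>.\<close>
  have EY: "E * Y \<le> C"
  proof -
    have "E * Y * Y \<le> C * Y" using dlow d_up by (simp add: power2_eq_square)
    then show ?thesis using Y by simp
  qed
  have u_f: "u y s = f y s + \<epsilon> * d y s"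
    using sgn by (auto simp: d_def)
  \<comment> \<open>The barrier inequality is subtracted from the equation. Since the coefficient of
    the Laplacian contains the unknown, the excess \<open>d y s\<close> multiplies the Laplacian of
    \<open>f\<close>, whence the upper bound required on that Laplacian. The mixed gradient term
    accounts for the bound on \<open>- (x \<bullet> g)\<close>.\<close>
  have main: "\<epsilon> * (a' - a) \<le> (y \<bullet> y + D + u y s) * (\<epsilon> * (l' - l)) + d y s * l
      - (n - 2) * (4 * E * Y) * (y \<bullet> y) - p * (8 * E * Y * (y \<bullet> g))
      - p * \<epsilon> * (16 * (E * Y)\<^sup>2 * (y \<bullet> y))"
  proof -
    have gg: "g' \<bullet> g' = g \<bullet> g + 8 * \<epsilon> * E * Y * (y \<bullet> g) + 16 * (E * Y)\<^sup>2 * (y \<bullet> y)"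
    proof -
      have "g' \<bullet> g' = g \<bullet> g + 8 * \<epsilon> * E * Y * (y \<bullet> g) + (\<epsilon> * \<epsilon>) * (16 * (E * Y)\<^sup>2 * (y \<bullet> y))"
        unfolding grad
        by (simp add: inner_add_left inner_add_right inner_commute[of g y] power2_eq_square algebra_simps)
      then show ?thesis using sgn2 by simp
    qed
    have yg: "y \<bullet> g' = y \<bullet> g + 4 * \<epsilon> * E * Y * (y \<bullet> y)"
      unfolding grad by (simp add: inner_add_right)
    have A': "a' = (y \<bullet> y + D + u y s) * l' - (n - 2) * (y \<bullet> g + 4 * \<epsilon> * E * Y * (y \<bullet> y))
        - p * (g \<bullet> g + 8 * \<epsilon> * E * Y * (y \<bullet> g) + 16 * (E * Y)\<^sup>2 * (y \<bullet> y))"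
      using eq by (simp add: pressure_operator_def l'_def n_def p_def gg yg)
    have A: "\<epsilon> * a \<ge> \<epsilon> * ((y \<bullet> y + D + f y s) * l - (n - 2) * (y \<bullet> g) - p * (g \<bullet> g))"
      using sup by (simp add: pressure_operator_def l_def n_def p_def right_diff_distrib)
    have "r * ((c + (F + r * e)) * l' - (n - 2) * (b + 4 * r * E * Y * q)
          - p * (k + 8 * r * E * Y * b + 16 * (E * Y)\<^sup>2 * q))
        - r * ((c + F) * l - (n - 2) * b - p * k)
      = (c + (F + r * e)) * (r * (l' - l)) + e * l - (n - 2) * (4 * E * Y) * q - p * (8 * E * Y * b)
        - p * r * (16 * (E * Y)\<^sup>2 * q)"
      if "r = 1 \<or> r = - 1" for c F r e b q k :: real
      using that by (elim disjE) (simp_all add: algebra_simps)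
    from this[OF sgn, of "y \<bullet> y + D" "f y s" "d y s" "y \<bullet> g" "y \<bullet> y" "g \<bullet> g"]
    show ?thesis using A unfolding A' u_f right_diff_distrib[of \<epsilon> _ a] by linarith
  qed
  have T1: "(y \<bullet> y + D + u y s) * (\<epsilon> * (l' - l)) \<le> C * (8 + 4 * n) * d y s"
  proof -
    have "(y \<bullet> y + D + u y s) * (\<epsilon> * (l' - l)) \<le> (y \<bullet> y + D + u y s) * (E * ((8 + 4 * n) * Y))"
    proof (rule mult_left_mono)
      have "8 * (y \<bullet> y) + 4 * n * Y \<le> (8 + 4 * n) * Y" using yy by (simp add: algebra_simps)
      then have "E * (8 * (y \<bullet> y) + 4 * n * Y) \<le> E * ((8 + 4 * n) * Y)"
        using E by (intro mult_left_mono) auto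
      then show "\<epsilon> * (l' - l) \<le> E * ((8 + 4 * n) * Y)" using lapl by linarith
    qed (use w in simp)
    also have "\<dots> \<le> (C * Y) * (E * ((8 + 4 * n) * Y))"
      using w_up E Y n2 by (intro mult_right_mono) auto
    also have "\<dots> = C * (8 + 4 * n) * (E * Y\<^sup>2)" by (simp add: power2_eq_square)
    also have "\<dots> \<le> C * (8 + 4 * n) * d y s"
      using dlow C n2 by (intro mult_left_mono) auto
    finally show ?thesis .
  qed
  have T2: "d y s * l \<le> C * d y s"
    using mult_left_mono[OF lap, of "d y s"] dpos by (simp add: l_def mult.commute)
  \<comment> \<open>The confining drift acts on the penalty with a favourable sign, so its
    contribution is discarded.\<close>
  have T3: "(n - 2) * (4 * E * Y) * (y \<bullet> y) \<ge> 0"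
    using n2 E Y yy by (intro mult_nonneg_nonneg) auto
  have T4: "- (p * (8 * E * Y * (y \<bullet> g))) \<le> 8 * p * C * d y s"
  proof -
    have "- (p * (8 * E * Y * (y \<bullet> g))) = (8 * p * E * Y) * (- (y \<bullet> g))" by simp
    also have "\<dots> \<le> (8 * p * E * Y) * (C * Y)"
      using gr E Y p by (intro mult_left_mono) (auto simp: Y_def)
    also have "\<dots> = 8 * p * C * (E * Y\<^sup>2)" by (simp add: power2_eq_square)
    also have "\<dots> \<le> 8 * p * C * d y s"
      using dlow C p by (intro mult_left_mono) auto
    finally show ?thesis .
  qed
  have T5: "- (p * \<epsilon> * (16 * (E * Y)\<^sup>2 * (y \<bullet> y))) \<le> 16 * p * C * d y s"
  proof -
    have nn: "p * (16 * (E * Y)\<^sup>2 * (y \<bullet> y)) \<ge> 0"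
      by (intro mult_nonneg_nonneg p yy) simp_all
    have "- (p * \<epsilon> * z) \<le> p * z" if "p * z \<ge> 0" for z
      using sgn that by (elim disjE) simp_all
    from this[OF nn] have "- (p * \<epsilon> * (16 * (E * Y)\<^sup>2 * (y \<bullet> y))) \<le> p * (16 * (E * Y)\<^sup>2 * (y \<bullet> y))" .
    also have "\<dots> \<le> p * (16 * (E * Y)\<^sup>2 * Y)"
      using yy p by (intro mult_left_mono) auto
    also have "\<dots> = 16 * p * ((E * Y) * (E * Y\<^sup>2))"
      unfolding power2_eq_square by (simp only: mult_ac)
    also have "\<dots> \<le> 16 * p * (C * d y s)"
    proof (rule mult_left_mono)
      show "(E * Y) * (E * Y\<^sup>2) \<le> C * d y s"
        by (rule mult_mono[OF EY less_imp_le[OF dlow] C]) (use E in simp)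
      show "0 \<le> 16 * p" using p by linarith
    qed
    also have "\<dots> = 16 * p * C * d y s" by (simp only: mult.assoc)
    finally show ?thesis .
  qed
  have "K * d y s \<le> C * (8 + 4 * n) * d y s + C * d y s + 8 * p * C * d y s + 16 * p * C * d y s"
    using timed main T1 T2 T3 T4 T5 by linarith
  also have "\<dots> = (K - 1) * d y s" by (simp add: K_def p_def algebra_simps)
  finally show False using dpos by (simp add: algebra_simps)
qed

section \<open>From the density to the pressure\<close>

lemma gderiv_gradient:
  fixes f :: "real ^ 'n \<Rightarrow> real"
  assumes "f differentiable (at x)"
  shows "GDERIV f x :> gradient f x"
proof -
  obtain f' where f': "(f has_derivative f') (at x)" using assms by (auto simp: differentiable_def)
  interpret bounded_linear f' using f' by (rule has_derivative_bounded_linear)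
  define d where "d = (\<chi> i. f' (axis i 1))"
  have "f' h = h \<bullet> d" for h
  proof -
    have "f' h = f' (\<Sum>i\<in>UNIV. h $ i *\<^sub>R axis i 1)"
      using basis_expansion[of h] by (simp add: scalar_mult_eq_scaleR)
    also have "\<dots> = (\<Sum>i\<in>UNIV. h $ i * f' (axis i 1))" by (simp add: sum scaleR)
    finally show ?thesis by (simp add: d_def inner_vec_def)
  qed
  then have "f' = (\<lambda>h. h \<bullet> d)" by blast
  then have d: "GDERIV f x :> d" using f' by (simp only: gderiv_def)
  have "d' = d" if "GDERIV f x :> d'" for d'
  proof -
    have "(\<lambda>h. h \<bullet> d') = (\<lambda>h. h \<bullet> d)"
      using has_derivative_unique that d unfolding gderiv_def by blast
    then have "\<forall>h. d' \<bullet> h = d \<bullet> h" by (simp add: fun_eq_iff inner_commute)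
    then show ?thesis by (rule iffD1[OF vector_eq_rdot])
  qed
  then have "gradient f x = d" unfolding gradient_def using d by (intro the_equality)
  then show ?thesis using d by simp
qed

lemma has_derivative_along_axis:
  fixes F :: "real ^ 'n \<Rightarrow> 'b::real_normed_vector"
  assumes "(F has_derivative F') (at (x + s *\<^sub>R axis i 1))"
  shows "((\<lambda>s. F (x + s *\<^sub>R axis i 1)) has_vector_derivative F' (axis i 1)) (at s)"
proof -
  interpret bounded_linear F' using assms by (rule has_derivative_bounded_linear)
  have "((\<lambda>s. x + s *\<^sub>R axis i 1) has_derivative (\<lambda>h. h *\<^sub>R axis i 1)) (at s)"
    by (auto intro!: derivative_eq_intros)
  from has_derivative_compose[OF this assms]
  show ?thesis by (simp add: has_vector_derivative_def scaleR)
qed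

lemma divergence_powr_gradient:
  fixes u :: "real ^ 'n \<Rightarrow> real"
  assumes u: "GDERIV u x :> G x" and G: "G differentiable (at x)" and pos: "u x > 0"
  shows "divergence (\<lambda>y. (u y powr q) *\<^sub>R G y) x =
    (\<Sum>i\<in>UNIV. u x powr q * frechet_derivative G (at x) (axis i 1) $ i + q * u x powr (q - 1) * (G x $ i)\<^sup>2)"
proof -
  let ?G' = "frechet_derivative G (at x)"
  have G': "(G has_derivative ?G') (at x)" using G by (simp add: frechet_derivative_works[symmetric])
  have "((\<lambda>y. u y powr q) has_derivative (\<lambda>h. (h \<bullet> G x) * (q * u x powr (q - 1)))) (at x)"
    using has_derivative_compose[OF u[unfolded gderiv_def],
        of "\<lambda>w. w powr q" "\<lambda>h. h * (q * u x powr (q - 1))"] pos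
      has_real_derivative_powr[of "u x" q]
    by (simp add: has_field_derivative_def mult.commute[of _ "q * u x powr (q - 1)"] inner_commute)
  from has_derivative_scaleR[OF this G']
  have "((\<lambda>y. (u y powr q) *\<^sub>R G y) has_derivative
      (\<lambda>h. u x powr q *\<^sub>R ?G' h + (h \<bullet> G x * (q * u x powr (q - 1))) *\<^sub>R G x)) (at x)" .
  from frechet_derivative_at[OF this, symmetric]
  show ?thesis
    by (simp add: divergence_def inner_axis' power2_eq_square mult_ac)
qed

lemma divergence_scaleR_id:
  fixes u :: "real ^ 'n \<Rightarrow> real"
  assumes u: "GDERIV u x :> g"
  shows "divergence (\<lambda>y. u y *\<^sub>R y) x = real CARD('n) * u x + x \<bullet> g"
proof -
  have "((\<lambda>y. u y *\<^sub>R y) has_derivative (\<lambda>h. u x *\<^sub>R h + (h \<bullet> g) *\<^sub>R x)) (at x)"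
    using has_derivative_scaleR[OF u[unfolded gderiv_def] has_derivative_ident] by (simp add: inner_commute)
  from frechet_derivative_at[OF this, symmetric]
  show ?thesis
    by (simp add: divergence_def inner_axis' sum.distrib) (simp add: inner_vec_def mult.commute)
qed

text \<open>With exponent \<open>1 - 1 / p\<close> the diffusivity \<open>v powr (- (1 / p))\<close>
  is itself the pressure \<open>|x|^2 + D + u\<close>, which makes the new equation polynomial in
  \<open>u\<close> and its derivatives. The terms free of \<open>u\<close> cancel because
  \<open>|x|^2 + D\<close> is the pressure of a stationary profile.\<close>

lemma pressure_solution_of_classical:
  fixes v :: "real ^ 'n \<Rightarrow> real \<Rightarrow> real"
  assumes n: "CARD('n) > 2" and p: "p = (real CARD('n) - 2) / 2"
    and sol: "positive_classical_solution (1 - 1 / p) (2 * p) v0 v"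
  shows "pressure_solution D (\<lambda>x t. v x t powr (- (1 / p)) - x \<bullet> x - D)"
  unfolding pressure_solution_def
proof (intro conjI allI impI)
  let ?w = "\<lambda>x t. v x t powr (- (1 / p)) - x \<bullet> x - D"
  have pp: "p > 0" using n p by simp
  have cont: "continuous_on (UNIV \<times> {0..}) (\<lambda>(x, t). v x t)"
    and pos: "\<And>x t. t \<ge> 0 \<Longrightarrow> v x t > 0"
    using sol by (auto simp: positive_classical_solution_def)
  show "continuous_on (UNIV \<times> {0..}) (\<lambda>(x, t). ?w x t)"
    using cont unfolding case_prod_beta
    by (intro continuous_intros) (auto simp: pos less_imp_neq[THEN not_sym])
  show "x \<bullet> x + D + ?w x t > 0" if "t \<ge> 0" for x t
    using pos[OF that, of x] by simp
  fix x t assume t: "(t::real) > 0"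
  define G where "G = gradient (\<lambda>y. v y t)"
  define H where "H = frechet_derivative G (at x)"
  have vG: "GDERIV (\<lambda>y. v y t) y :> G y" for y
    unfolding G_def using sol t by (intro gderiv_gradient) (auto simp: positive_classical_solution_def)
  have Gd: "G differentiable (at x)"
    unfolding G_def using sol t by (auto simp: positive_classical_solution_def)
  have GH: "(G has_derivative H) (at x)"
    unfolding H_def using Gd by (simp add: frechet_derivative_works[symmetric])
  define vt where "vt = deriv (v x) t"
  have vt: "(v x has_real_derivative vt) (at t)"
    unfolding vt_def DERIV_deriv_iff_real_differentiable
    using sol t by (simp add: positive_classical_solution_def)
  define V where "V = v x t"
  have V: "V > 0" using pos t by (simp add: V_def)
  define Q where "Q = V powr (- (1 / p))"
  have eq: "vt = (\<Sum>i\<in>UNIV. Q * H (axis i 1) $ i - 1 / p * (Q / V) * (G x $ i)\<^sup>2)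
      + 2 * p * (real CARD('n) * V + x \<bullet> G x)"
  proof -
    have "vt = divergence (\<lambda>y. (v y t powr (- (1 / p))) *\<^sub>R G y) x + 2 * p * divergence (\<lambda>y. v y t *\<^sub>R y) x"
      using sol t by (simp add: positive_classical_solution_def vt_def G_def)
    also have "divergence (\<lambda>y. v y t *\<^sub>R y) x = real CARD('n) * V + x \<bullet> G x"
      using divergence_scaleR_id[OF vG] by (simp add: V_def)
    also have "divergence (\<lambda>y. (v y t powr (- (1 / p))) *\<^sub>R G y) x =
        (\<Sum>i\<in>UNIV. Q * H (axis i 1) $ i - 1 / p * (Q / V) * (G x $ i)\<^sup>2)"
      using divergence_powr_gradient[of "\<lambda>y. v y t" x G "- (1 / p)", OF vG Gd] V
      by (simp add: H_def V_def[symmetric] Q_def powr_diff)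
    finally show ?thesis .
  qed
  \<comment> \<open>\<open>w1\<close> and \<open>w2\<close> are the first and second derivatives of
    \<open>V powr (- (1 / p))\<close> with respect to \<open>V\<close>.\<close>
  define w1 where "w1 = - (1 / p) * (Q / V)"
  define w2 where "w2 = (1 / p) * (1 / p + 1) * (Q / V\<^sup>2)"
  define h where "h = (\<chi> i. w2 * (G x $ i)\<^sup>2 + w1 * H (axis i 1) $ i - 2)"
  define g where "g = w1 *\<^sub>R G x - 2 *\<^sub>R x"
  have jet: "has_jet ?w x t (w1 * vt) g h"
    unfolding has_jet_def
  proof (intro conjI allI)
    show "((\<lambda>t. v x t powr (- (1 / p)) - x \<bullet> x - D) has_real_derivative w1 * vt) (at t)"
      using V by (auto intro!: derivative_eq_intros vt simp: w1_def Q_def V_def[symmetric] powr_diff)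
    fix i
    let ?e = "axis i 1 :: real ^ 'n"
    have v1: "((\<lambda>s. v (x + s *\<^sub>R ?e) t) has_real_derivative G (x + s *\<^sub>R ?e) $ i) (at s)" for s
      using has_derivative_along_axis[OF vG[of "x + s *\<^sub>R ?e", unfolded gderiv_def]]
      by (simp add: has_real_derivative_iff_has_vector_derivative inner_axis')
    have G1: "((\<lambda>s. G (x + s *\<^sub>R ?e) $ i) has_real_derivative H ?e $ i) (at 0)"
    proof -
      have "((\<lambda>s. G (x + s *\<^sub>R ?e)) has_vector_derivative H ?e) (at 0)"
        using GH by (intro has_derivative_along_axis) simp
      from bounded_linear.has_vector_derivative[OF bounded_linear_vec_nth this]
      show ?thesis by (simp add: has_real_derivative_iff_has_vector_derivative)
    qed
    have pw: "((\<lambda>s. v (x + s *\<^sub>R ?e) t powr q) has_real_derivative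
        q * v (x + s *\<^sub>R ?e) t powr (q - 1) * G (x + s *\<^sub>R ?e) $ i) (at s)" for s q
      using DERIV_chain2[OF has_real_derivative_powr[OF pos[OF less_imp_le[OF t]]] v1] .
    let ?d = "\<lambda>s. - (1 / p) * v (x + s *\<^sub>R ?e) t powr (- (1 / p) - 1) * G (x + s *\<^sub>R ?e) $ i
        - (2 * x $ i + 2 * s)"
    have d1: "((\<lambda>s. v (x + s *\<^sub>R ?e) t powr (- (1 / p)) - (x \<bullet> x + 2 * s * x $ i + s\<^sup>2) - D)
        has_real_derivative ?d s) (at s)" for s
      by (rule derivative_eq_intros pw refl)+ simp
    have d2: "(?d has_real_derivative h $ i) (at 0)"
    proof -
      have *: "V powr (- (1 / p) - 1) = Q / V" "V powr (- (1 / p) - 1 - 1) = Q / V\<^sup>2"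
          "V powr (- (1 / p) - 2) = Q / V\<^sup>2"
        using V powr_diff[of V "- (1 / p)" 1] powr_diff[of V "- (1 / p) - 1" 1] powr_diff[of V "- (1 / p)" 2]
        by (simp_all add: Q_def power2_eq_square)
      show ?thesis
        by (rule pw G1 derivative_eq_intros refl)+
          (simp add: h_def w1_def w2_def V_def[symmetric] *[simplified] power2_eq_square algebra_simps)
    qed
    show "\<exists>d. (\<forall>s. ((\<lambda>s. ?w (x + s *\<^sub>R ?e) t) has_real_derivative d s) (at s)) \<and>
          d 0 = g $ i \<and> (d has_real_derivative h $ i) (at 0)"
      using d1 d2 V
      by (intro exI[of _ ?d] conjI)
         (simp_all add: inner_axis_step g_def w1_def Q_def V_def[symmetric] powr_diff)
  qed
  have "w1 * vt = pressure_operator D x (?w x t) g h"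
  proof -
    define l where "l = (\<Sum>i\<in>UNIV. H (axis i 1) $ i)"
    define n where "n = real CARD('n)"
    have np: "n = 2 * p + 2" using p by (simp add: n_def)
    have GG: "(\<Sum>i\<in>UNIV. (G x $ i)\<^sup>2) = G x \<bullet> G x" by (simp add: inner_vec_def power2_eq_square)
    have vt': "vt = Q * l - 1 / p * (Q / V) * (G x \<bullet> G x) + 2 * p * (n * V + x \<bullet> G x)"
      unfolding eq l_def n_def by (simp add: sum_subtractf sum_distrib_left GG[symmetric])
    have hs: "(\<Sum>i\<in>UNIV. h $ i) = w2 * (G x \<bullet> G x) + w1 * l - 2 * n"
      by (simp add: h_def sum.distrib sum_subtractf l_def n_def GG[symmetric] sum_distrib_left)
    have xg: "x \<bullet> g = w1 * (x \<bullet> G x) - 2 * (x \<bullet> x)" by (simp add: g_def inner_diff_right)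
    have gg: "g \<bullet> g = w1\<^sup>2 * (G x \<bullet> G x) - 4 * w1 * (x \<bullet> G x) + 4 * (x \<bullet> x)"
      by (simp add: g_def inner_diff_right inner_diff_left inner_commute[of "G x" x] power2_eq_square algebra_simps)
    have po: "pressure_operator D x (?w x t) g h = Q * (w2 * (G x \<bullet> G x) + w1 * l - 2 * n)
        - (n - 2) * (w1 * (x \<bullet> G x) - 2 * (x \<bullet> x))
        - (n - 2) / 2 * (w1\<^sup>2 * (G x \<bullet> G x) - 4 * w1 * (x \<bullet> G x) + 4 * (x \<bullet> x))"
      unfolding pressure_operator_def hs xg gg n_def[symmetric] by (simp add: Q_def V_def)
    show ?thesis
    proof -
      define r q where "r = 1 / p" and "q = Q / V"
      have rp: "r * p = 1" using pp by (simp add: r_def)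
      have Q: "Q = q * V" using V by (simp add: q_def)
      have w1: "w1 = - r * q" by (simp add: w1_def r_def q_def)
      have Qw2: "Q * w2 = r * (r + 1) * q\<^sup>2"
        using V by (simp add: w2_def r_def q_def power2_eq_square)
      have vt'': "vt = q * V * l - r * q * (G x \<bullet> G x) + 2 * p * ((2 * p + 2) * V + x \<bullet> G x)"
        unfolding vt' np[symmetric] using V by (simp add: r_def q_def)
      \<comment> \<open>With all powers expressed through \<open>q\<close> and \<open>V\<close>, and
        with \<open>n = 2 * p + 2\<close>, the equation is a polynomial identity modulo
        \<open>r * p = 1\<close>.\<close>
      have "(- r * q) * (q * V * l - r * q * a + 2 * p * ((2 * p + 2) * V + b)) =
          r * (r + 1) * q\<^sup>2 * a + q * V * ((- r * q) * l - 2 * (2 * p + 2))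
          - (2 * p + 2 - 2) * ((- r * q) * b - 2 * c)
          - p * ((- r * q)\<^sup>2 * a - 4 * (- r * q) * b + 4 * c)" for a b c :: real
        using rp by algebra
      from this[of "G x \<bullet> G x" "x \<bullet> G x" "x \<bullet> x"] show ?thesis
        unfolding po np vt'' Qw2[symmetric] Q[symmetric] w1[symmetric]
        by (simp add: distrib_left right_diff_distrib mult.assoc)
    qed
  qed
  with jet show "\<exists>a g h. has_jet ?w x t a g h \<and> a = pressure_operator D x (?w x t) g h" by blast
qed

text \<open>Since \<open>u = 0\<close> corresponds to the Barenblatt profile, this is the upper
  bound of \<open>v\<close> by that profile, obtained by comparison with the stationary
  solution.\<close>

lemma pressure_nonneg:
  fixes u :: "real ^ 'n \<Rightarrow> real \<Rightarrow> real"
  assumes n: "CARD('n) \<ge> 2" and sol: "pressure_solution D u"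
    and init: "\<And>x. u x 0 \<ge> 0" and t: "t \<ge> 0" and D: "D > 0"
  shows "u x t \<ge> 0"
proof -
  have "- 1 * (u x t - (\<lambda>_ _. 0) x t) \<le> 0"
  proof (rule comparison[where T = t and C = "1 + D" and ?t1.0 = 0, OF _ n sol])
    fix y :: "real ^ 'n" and s :: real
    assume *: "0 \<le> s" "0 < - 1 * (u y s - 0)"
    have "y \<bullet> y + D + u y s > 0" using sol * by (auto simp: pressure_solution_def)
    moreover have "y \<bullet> y + D \<le> (1 + D) * (1 + y \<bullet> y)" using D by (simp add: algebra_simps)
    ultimately show "y \<bullet> y + D + u y s \<le> (1 + D) * (1 + y \<bullet> y) \<and> - 1 * (u y s - 0) \<le> (1 + D) * (1 + y \<bullet> y)"
      using * by auto
  next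
    fix y :: "real ^ 'n" and s :: real
    show "\<exists>a g h. has_jet (\<lambda>(_::real ^ 'n) _. 0) y s a g h \<and>
        - 1 * (a - pressure_operator D y 0 g h) \<ge> 0 \<and>
        (\<Sum>i\<in>UNIV. h $ i) \<le> 1 + D \<and> - (y \<bullet> g) \<le> (1 + D) * (1 + y \<bullet> y)"
      using D by (intro exI[of _ 0])
        (auto simp: has_jet_def pressure_operator_def intro!: exI[of _ "\<lambda>_. 0"] mult_nonneg_nonneg)
  qed (use t D init in auto)
  then show ?thesis by simp
qed

section \<open>Barriers in the logarithmic variable\<close>

text \<open>The shift \<open>A > 0\<close> makes the logarithm smooth at the origin. In the
  coefficient of \<open>F1\<close> the terms of order \<open>y\<^sup>2\<close> have cancelled: the
  Laplacian contributes \<open>4 * p * y * (\<rho> + D + F L t)\<close>, the drift removes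
  \<open>4 * p * y * \<rho>\<close>. For bounded \<open>F\<close> the coefficient of
  \<open>F1\<close> is thus of size \<open>1 / y\<close> after division, and that of
  \<open>F2\<close> tends to 4.\<close>

lemma log_radial_jet:
  fixes F :: "real \<Rightarrow> real \<Rightarrow> real"
  assumes A: "A > 0" and p: "p = (real CARD('n) - 2) / 2"
    and F1: "\<And>L. ((\<lambda>L. F L t) has_real_derivative F1 L) (at L)"
    and F2: "\<And>L. (F1 has_real_derivative F2 L) (at L)"
    and Ft: "\<And>L. (F L has_real_derivative Ft L) (at t)"
  fixes x :: "real ^ 'n"
  defines "\<rho> \<equiv> x \<bullet> x"
  defines "y \<equiv> \<rho> + A"
  defines "L \<equiv> ln y"
  shows "\<exists>g h. has_jet (\<lambda>x t. F (ln (x \<bullet> x + A)) t) x t (Ft L) g h \<and>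
    pressure_operator D x (F L t) g h =
      (4 * \<rho> * (\<rho> + D + F L t) * F2 L
       + (4 * A * \<rho> + 4 * p * (D + F L t) * y + 4 * A * (D + F L t)) * F1 L
       - 4 * p * \<rho> * (F1 L)\<^sup>2) / y\<^sup>2 \<and>
    (\<Sum>i\<in>UNIV. h $ i) = 4 * \<rho> / y\<^sup>2 * F2 L + (4 * p * y + 4 * A) / y\<^sup>2 * F1 L \<and>
    x \<bullet> g = 2 * \<rho> / y * F1 L"
proof -
  define G1 where "G1 r = F1 (ln (r + A)) / (r + A)" for r
  define G2 where "G2 = (F2 L - F1 L) / y\<^sup>2"
  have \<rho>: "\<rho> \<ge> 0" by (simp add: \<rho>_def)
  have y: "y > 0" using A \<rho> by (simp add: y_def)
  have dln: "((\<lambda>r. ln (r + A)) has_real_derivative 1 / (r + A)) (at r)" if "r \<ge> 0" for r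
    using that A by (auto intro!: derivative_eq_intros)
  have "((\<lambda>r. F (ln (r + A)) t) has_real_derivative G1 r) (at r)" if "r \<ge> 0" for r
    using DERIV_chain2[OF F1 dln[OF that]] by (simp add: G1_def)
  moreover have "(G1 has_real_derivative G2) (at \<rho>)"
  proof -
    have "((\<lambda>r. F1 (ln (r + A))) has_real_derivative F2 L * (1 / y)) (at \<rho>)"
      using DERIV_chain2[OF F2 dln[OF \<rho>]] by (simp add: L_def y_def)
    moreover have "((\<lambda>r. r + A) has_real_derivative 1) (at \<rho>)" by (auto intro!: derivative_eq_intros)
    ultimately have "((\<lambda>r. F1 (ln (r + A)) / (r + A)) has_real_derivative
        (F2 L * (1 / y) * (\<rho> + A) - F1 (ln (\<rho> + A)) * 1) / ((\<rho> + A) * (\<rho> + A))) (at \<rho>)"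
      using y by (intro DERIV_divide) (auto simp: y_def)
    then show ?thesis
      using y by (simp add: G1_def[abs_def] G2_def y_def[symmetric] L_def[symmetric] power2_eq_square)
  qed
  ultimately have jet: "has_jet (\<lambda>x t. F (ln (x \<bullet> x + A)) t) x t (Ft L)
      ((2 * G1 \<rho>) *\<^sub>R x) (\<chi> i. 4 * G2 * (x $ i)\<^sup>2 + 2 * G1 \<rho>)"
    using has_jet_radial[of "\<lambda>x t. F (ln (x \<bullet> x + A)) t" x "Ft L" t "\<lambda>r. F (ln (r + A)) t" 0 G1 G2]
      Ft by (simp add: \<rho>_def L_def y_def)
  define h :: "real ^ 'n" where "h = (\<chi> i. 4 * G2 * (x $ i)\<^sup>2 + 2 * G1 \<rho>)"
  have n: "real CARD('n) = 2 * p + 2" using p by simp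
  have G1\<rho>: "G1 \<rho> = F1 L / y" by (simp add: G1_def L_def y_def)
  have A_eq: "A = y - \<rho>" by (simp add: y_def)
  have hs: "(\<Sum>i\<in>UNIV. h $ i) = 4 * G2 * \<rho> + 2 * (2 * p + 2) * G1 \<rho>"
    unfolding h_def sum_radial_hessian n[symmetric] \<rho>_def by simp
  have 1: "(\<Sum>i\<in>UNIV. h $ i) = 4 * \<rho> / y\<^sup>2 * F2 L + (4 * p * y + 4 * A) / y\<^sup>2 * F1 L"
    unfolding hs G1\<rho> G2_def A_eq using y by (simp add: field_simps power2_eq_square)
  have 2: "x \<bullet> ((2 * G1 \<rho>) *\<^sub>R x) = 2 * \<rho> / y * F1 L"
    unfolding G1\<rho> by (simp add: \<rho>_def)
  have 3: "((2 * G1 \<rho>) *\<^sub>R x) \<bullet> ((2 * G1 \<rho>) *\<^sub>R x) = 4 * \<rho> * (F1 L)\<^sup>2 / y\<^sup>2"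
    unfolding G1\<rho> by (simp add: \<rho>_def power2_eq_square)
  have "pressure_operator D x (F L t) ((2 * G1 \<rho>) *\<^sub>R x) h =
      (\<rho> + D + F L t) * (4 * \<rho> / y\<^sup>2 * F2 L + (4 * p * y + 4 * A) / y\<^sup>2 * F1 L)
      - 2 * p * (2 * \<rho> / y * F1 L) - p * (4 * \<rho> * (F1 L)\<^sup>2 / y\<^sup>2)"
    unfolding pressure_operator_def 1 2 3 n by (simp add: \<rho>_def)
  also have "\<dots> = (4 * \<rho> * (\<rho> + D + F L t) * F2 L
       + (4 * A * \<rho> + 4 * p * (D + F L t) * y + 4 * A * (D + F L t)) * F1 L
       - 4 * p * \<rho> * (F1 L)\<^sup>2) / y\<^sup>2"
    unfolding A_eq using y by (simp add: field_simps power2_eq_square)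
  finally show ?thesis using jet 1 2 unfolding h_def by blast
qed

text \<open>The time derivative of the barrier is \<open>- \<beta> * k * \<kappa> * z\<close> with
  \<open>z = q L s powr (- \<beta> - 1)\<close>, and every term of the pressure operator is at least
  a constant multiple of \<open>- \<beta> * \<kappa> * z\<close>. A large \<open>k\<close> therefore
  gives a subsolution, without changing the exponent of the decay.\<close>

lemma lower_log_barrier:
  fixes u :: "real ^ 'n \<Rightarrow> real \<Rightarrow> real"
  assumes n: "CARD('n) \<ge> 2" and D: "D > 0" and sol: "pressure_solution D u" and t1: "t1 \<ge> 0"
    and nonneg: "\<And>x t. t \<ge> 0 \<Longrightarrow> u x t \<ge> 0"
    and \<kappa>: "\<kappa> > 0" and \<gamma>: "\<gamma> > 0"
    and init: "\<And>x. \<kappa> * ln (x \<bullet> x + exp 1) powr (- \<gamma>) \<le> u x t1"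
  shows "\<exists>k>0. \<forall>x. \<forall>t\<ge>t1. \<kappa> * ((ln (x \<bullet> x + exp 1))\<^sup>2 + k * (t - t1 + 1)) powr (- (\<gamma> / 2)) \<le> u x t"
proof -
  define \<beta> where "\<beta> = \<gamma> / 2"
  have \<beta>: "\<beta> > 0" using \<gamma> by (simp add: \<beta>_def)
  define p where "p = (real CARD('n) - 2) / 2"
  have p: "p \<ge> 0" using n by (simp add: p_def)
  \<comment> \<open>This shift matches the logarithm in the initial bound and ensures
    \<open>L \<ge> 1\<close>.\<close>
  define A :: real where "A = exp 1"
  have A: "A \<ge> 1" by (simp add: A_def)
  define c1 where "c1 = 4 * A + 4 * p * (D + \<kappa>) + 4 * A * (D + \<kappa>)"
  have c1: "c1 \<ge> 0" unfolding c1_def using A p D \<kappa> by simp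
  \<comment> \<open>After the 1 that keeps \<open>q L t \<ge> 1\<close>, the summands pay for the
    second-order term, the first-order term and the squared gradient, estimated in
    \<open>a1\<close>, \<open>a2\<close> and \<open>a3\<close>.\<close>
  define k where "k = 1 + 8 * (1 + D + \<kappa>) + 2 * c1 + 16 * p * \<beta> * \<kappa>"
  have k1: "k \<ge> 1" unfolding k_def using c1 p D \<kappa> \<beta> by simp
  define q where "q L t = L\<^sup>2 + k * (t - t1 + 1)" for L t :: real
  define F where "F L t = \<kappa> * q L t powr (- \<beta>)" for L t
  define C where "C = 1 + D + \<kappa> + 16 * \<beta> * (\<beta> + 1) * \<kappa> + 4 * \<beta> * \<kappa>"
  have C: "C \<ge> 1 + D + \<kappa>" "C \<ge> 16 * \<beta> * (\<beta> + 1) * \<kappa>" "C \<ge> 4 * \<beta> * \<kappa>" "C \<ge> 0"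
    unfolding C_def using D \<kappa> \<beta> by simp_all
  have q1: "q L t \<ge> 1" "L\<^sup>2 \<le> q L t" if "t \<ge> t1" for L t
  proof -
    have "k * (t - t1 + 1) \<ge> 1 * 1" using k1 that by (intro mult_mono) auto
    then show "q L t \<ge> 1" "L\<^sup>2 \<le> q L t" using zero_le_power2[of L] unfolding q_def by linarith+
  qed
  have F_bounds: "F L t \<ge> 0" "F L t \<le> \<kappa>" if "t \<ge> t1" for L t
  proof -
    show "F L t \<ge> 0" using \<kappa> by (simp add: F_def)
    have "q L t powr (- \<beta>) \<le> 1 powr (- \<beta>)"
      using q1[OF that] \<beta> by (intro powr_mono2') auto
    then show "F L t \<le> \<kappa>" using \<kappa> by (simp add: F_def)
  qed
  have main: "- 1 * (u x t - F (ln (x \<bullet> x + A)) t) \<le> 0" if t: "t1 \<le> t" for x t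
  proof (rule comparison[where T = t and C = C and ?t1.0 = t1 and f = "\<lambda>x t. F (ln (x \<bullet> x + A)) t",
        OF _ n sol t1])
    show "continuous_on (UNIV \<times> {t1..t}) (\<lambda>(x :: real ^ 'n, t). F (ln (x \<bullet> x + A)) t)"
    proof -
      have ne: "x \<bullet> x + A \<noteq> 0" for x :: "real ^ 'n"
        using A inner_ge_zero[of x] by linarith
      have "L\<^sup>2 + k * (s - t1 + 1) \<noteq> 0" if "s \<in> {t1..t}" for L s
        using q1[of s L] that by (auto simp: q_def)
      then show ?thesis
        unfolding F_def q_def case_prod_beta
        by (intro continuous_intros ballI ne) auto
    qed
    show "- 1 * (u x t1 - F (ln (x \<bullet> x + A)) t1) \<le> 0" for x
    proof -
      let ?L = "ln (x \<bullet> x + A)"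
      have "?L \<ge> ln A" using A by (intro ln_mono) auto
      then have L: "?L \<ge> 1" by (simp add: A_def)
      have "q ?L t1 powr (- \<beta>) \<le> (?L\<^sup>2) powr (- \<beta>)"
        using L \<beta> k1 by (intro powr_mono2') (auto simp: q_def)
      also have "\<dots> = ?L powr (- \<gamma>)"
        using L by (simp add: \<beta>_def powr_powr flip: powr_numeral)
      finally have "F ?L t1 \<le> \<kappa> * ?L powr (- \<gamma>)"
        using \<kappa> by (simp add: F_def)
      then show ?thesis using init[of x] by (simp add: A_def)
    qed
    fix x :: "real ^ 'n" and s
    assume s: "t1 \<le> s" "s \<le> t" and d: "0 < - 1 * (u x s - F (ln (x \<bullet> x + A)) s)"
    have u0: "u x s \<ge> 0" using nonneg s t1 by simp
    have "x \<bullet> x + D + \<kappa> \<le> (1 + D + \<kappa>) * (1 + x \<bullet> x)"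
      using D \<kappa> by (simp add: algebra_simps)
    also have "\<dots> \<le> C * (1 + x \<bullet> x)" using C by (intro mult_right_mono) auto
    finally have "x \<bullet> x + D + \<kappa> \<le> C * (1 + x \<bullet> x)" .
    moreover have "u x s < F (ln (x \<bullet> x + A)) s" using d by simp
    ultimately have "x \<bullet> x + D + u x s \<le> C * (1 + x \<bullet> x)"
        "F (ln (x \<bullet> x + A)) s - u x s \<le> C * (1 + x \<bullet> x)"
      using u0 F_bounds[OF s(1), of "ln (x \<bullet> x + A)"] D inner_ge_zero[of x] by linarith+
    then show "x \<bullet> x + D + u x s \<le> C * (1 + x \<bullet> x) \<and>
        - 1 * (u x s - F (ln (x \<bullet> x + A)) s) \<le> C * (1 + x \<bullet> x)" by simp
  next
    fix x :: "real ^ 'n" and s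
    assume s: "t1 < s" "s \<le> t" and d: "0 < - 1 * (u x s - F (ln (x \<bullet> x + A)) s)"
    define F1 where "F1 L = - 2 * \<beta> * \<kappa> * L * q L s powr (- \<beta> - 1)" for L
    define F2 where "F2 L = - 2 * \<beta> * \<kappa> * (q L s powr (- \<beta> - 1)
        + L * (2 * L * ((- \<beta> - 1) * q L s powr (- \<beta> - 2))))" for L
    define Ft where "Ft L = - \<beta> * k * \<kappa> * q L s powr (- \<beta> - 1)" for L
    have qpos: "q L s > 0" for L using q1[of s L] s by simp
    have dq: "((\<lambda>L. q L s) has_real_derivative 2 * L) (at L)" for L
      unfolding q_def by (auto intro!: derivative_eq_intros)
    have dqt: "(q L has_real_derivative k) (at s)" for L
      unfolding q_def by (auto intro!: derivative_eq_intros)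
    have dp: "((\<lambda>L. q L s powr r) has_real_derivative r * q L s powr (r - 1) * (2 * L)) (at L)" for r L
      using DERIV_chain2[OF has_real_derivative_powr[OF qpos] dq] .
    have dF1: "((\<lambda>L. F L s) has_real_derivative F1 L) (at L)" for L
      unfolding F_def F1_def by (rule dp derivative_eq_intros refl)+ simp
    have dF2: "(F1 has_real_derivative F2 L) (at L)" for L
      unfolding F1_def[abs_def] F2_def by (rule dp derivative_eq_intros refl)+ (simp add: algebra_simps)
    have dFt: "(F L has_real_derivative Ft L) (at s)" for L
      unfolding F_def Ft_def
      by (rule DERIV_chain2[OF has_real_derivative_powr[OF qpos] dqt] derivative_eq_intros refl)+ simp
    define \<rho> where "\<rho> = x \<bullet> x"
    define y where "y = \<rho> + A"
    define L where "L = ln y"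
    obtain g h where jet: "has_jet (\<lambda>x t. F (ln (x \<bullet> x + A)) t) x s (Ft L) g h"
      and po: "pressure_operator D x (F L s) g h =
        (4 * \<rho> * (\<rho> + D + F L s) * F2 L
         + (4 * A * \<rho> + 4 * p * (D + F L s) * y + 4 * A * (D + F L s)) * F1 L
         - 4 * p * \<rho> * (F1 L)\<^sup>2) / y\<^sup>2"
      and lap: "(\<Sum>i\<in>UNIV. h $ i) = 4 * \<rho> / y\<^sup>2 * F2 L + (4 * p * y + 4 * A) / y\<^sup>2 * F1 L"
      and xg: "x \<bullet> g = 2 * \<rho> / y * F1 L"
      using log_radial_jet[where F = F and D = D and t = s and x = x, OF _ p_def dF1 dF2 dFt, of A] A
      unfolding L_def y_def \<rho>_def by auto
    have \<rho>: "\<rho> \<ge> 0" "\<rho> \<le> y" and y: "y \<ge> 1"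
      using A inner_ge_zero[of x] unfolding y_def \<rho>_def by linarith+
    have "L \<ge> ln A" unfolding L_def using A \<rho> by (intro ln_mono) (auto simp: y_def)
    then have L: "L \<ge> 1" by (simp add: A_def)
    \<comment> \<open>The coefficient of \<open>F1\<close> is of order \<open>y\<close> while
      \<open>y\<^sup>2\<close> is available; the spare power of \<open>y\<close> absorbs the factor
      \<open>L\<close> in \<open>F1\<close>.\<close>
    have Ly: "L \<le> y" unfolding L_def using y ln_le_minus_one[of y] by simp
    define z where "z = q L s powr (- \<beta> - 1)"
    have z: "z > 0" "z \<le> 1"
    proof -
      show "z > 0" using qpos[of L] by (simp add: z_def)
      have "q L s powr (- \<beta> - 1) \<le> 1 powr (- \<beta> - 1)"
        using q1[of s L] s \<beta> by (intro powr_mono2') auto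
      then show "z \<le> 1" by (simp add: z_def)
    qed
    have zq: "q L s powr (- \<beta> - 2) = z / q L s" "F L s = \<kappa> * (z * q L s)"
    proof -
      have "- \<beta> - 2 = (- \<beta> - 1) - 1" "- \<beta> = (- \<beta> - 1) + 1" by auto
      then show "q L s powr (- \<beta> - 2) = z / q L s" "F L s = \<kappa> * (z * q L s)"
        using qpos[of L] powr_diff[of "q L s" "- \<beta> - 1" 1] powr_add[of "q L s" "- \<beta> - 1" 1]
        unfolding z_def F_def by (metis powr_one less_imp_le)+
    qed
    have L2q: "L\<^sup>2 / q L s \<le> 1" using q1[of s L] s qpos[of L] by simp
    have zL2: "z * L\<^sup>2 \<le> z * q L s" using q1[of s L] s z by simp
    have f0: "F L s \<ge> 0" "F L s \<le> \<kappa>" using F_bounds s by auto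
    have F1: "F1 L = - (2 * \<beta> * \<kappa> * L * z)" by (simp add: F1_def z_def)
    have F2: "F2 L = 2 * \<beta> * \<kappa> * z * (2 * (\<beta> + 1) * (L\<^sup>2 / q L s) - 1)"
      unfolding F2_def zq z_def[symmetric]
      by (simp add: algebra_simps power2_eq_square add_divide_distrib)
    have F2_low: "F2 L \<ge> - (2 * \<beta> * \<kappa> * z)"
    proof -
      have "2 * (\<beta> + 1) * (L\<^sup>2 / q L s) - 1 \<ge> - 1" using \<beta> qpos[of L] by simp
      from mult_left_mono[OF this, of "2 * \<beta> * \<kappa> * z"] show ?thesis using F2 \<beta> \<kappa> z by simp
    qed
    have F2_up: "F2 L \<le> 4 * \<beta> * (\<beta> + 1) * \<kappa>"
    proof -
      have "2 * (\<beta> + 1) * (L\<^sup>2 / q L s) - 1 \<le> 2 * (\<beta> + 1)"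
        using mult_left_mono[OF L2q, of "2 * (\<beta> + 1)"] \<beta> by simp
      moreover have "2 * \<beta> * \<kappa> * z \<le> 2 * \<beta> * \<kappa>" using z \<beta> \<kappa> by simp
      ultimately have "F2 L \<le> 2 * \<beta> * \<kappa> * z * (2 * (\<beta> + 1))"
        unfolding F2 using \<beta> \<kappa> z by (intro mult_left_mono) auto
      also have "\<dots> \<le> 2 * \<beta> * \<kappa> * (2 * (\<beta> + 1))"
        using \<open>2 * \<beta> * \<kappa> * z \<le> 2 * \<beta> * \<kappa>\<close> \<beta> by (intro mult_right_mono) auto
      also have "\<dots> = 4 * \<beta> * (\<beta> + 1) * \<kappa>" by (simp add: algebra_simps)
      finally show ?thesis .
    qed
    have F1_low: "F1 L \<ge> - (2 * \<beta> * \<kappa>)" and F1_neg: "F1 L \<le> 0"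
    proof -
      have "L * z \<le> L\<^sup>2 * z" using L z by (simp add: power2_eq_square)
      also have "\<dots> \<le> z * q L s" using zL2 by (simp add: mult.commute)
      also have "\<dots> \<le> 1" using f0(2) \<kappa> unfolding zq by simp
      finally have "L * z \<le> 1" .
      from mult_left_mono[OF this, of "2 * \<beta> * \<kappa>"] \<beta> \<kappa>
      show "F1 L \<ge> - (2 * \<beta> * \<kappa>)" unfolding F1 by (simp add: mult.assoc)
      show "F1 L \<le> 0" unfolding F1 using \<beta> \<kappa> L z by simp
    qed
    have ineq: "Ft L \<le> pressure_operator D x (F L s) g h"
    proof -
      have a1: "4 * \<rho> * (\<rho> + D + F L s) * F2 L \<ge> - (8 * (1 + D + \<kappa>) * \<beta> * \<kappa> * z * y\<^sup>2)"
      proof -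
        have "D + F L s \<le> (D + \<kappa>) * y"
        proof -
          have "D + F L s \<le> (D + \<kappa>) * 1" using f0 by simp
          also have "\<dots> \<le> (D + \<kappa>) * y" using y D \<kappa> by (intro mult_left_mono) auto
          finally show ?thesis .
        qed
        then have "\<rho> + D + F L s \<le> (1 + D + \<kappa>) * y" using \<rho> by (simp add: algebra_simps)
        then have "\<rho> * (\<rho> + D + F L s) \<le> y * ((1 + D + \<kappa>) * y)"
          using \<rho> f0 D y by (intro mult_mono) auto
        then have "4 * \<rho> * (\<rho> + D + F L s) * (2 * \<beta> * \<kappa> * z) \<le> 4 * (y * ((1 + D + \<kappa>) * y)) * (2 * \<beta> * \<kappa> * z)"
          using \<beta> \<kappa> z by (intro mult_right_mono) auto
        moreover have "4 * \<rho> * (\<rho> + D + F L s) * (- (2 * \<beta> * \<kappa> * z)) \<le> 4 * \<rho> * (\<rho> + D + F L s) * F2 L"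
          using F2_low \<rho> f0 D by (intro mult_left_mono) auto
        ultimately show ?thesis by (simp add: power2_eq_square mult_ac)
      qed
      have a2: "(4 * A * \<rho> + 4 * p * (D + F L s) * y + 4 * A * (D + F L s)) * F1 L
          \<ge> - (2 * c1 * \<beta> * \<kappa> * z * y\<^sup>2)"
      proof -
        have "4 * A * \<rho> \<le> 4 * A * y" using \<rho> A by simp
        moreover have "4 * p * (D + F L s) * y \<le> 4 * p * (D + \<kappa>) * y"
          using f0 p y by (intro mult_right_mono mult_left_mono) auto
        moreover have "4 * A * (D + F L s) \<le> 4 * A * (D + \<kappa>) * y"
        proof -
          have "4 * A * (D + F L s) \<le> 4 * A * (D + \<kappa>) * 1" using f0 A by simp
          also have "\<dots> \<le> 4 * A * (D + \<kappa>) * y" using y D \<kappa> A by (intro mult_left_mono) auto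
          finally show ?thesis .
        qed
        ultimately have b: "4 * A * \<rho> + 4 * p * (D + F L s) * y + 4 * A * (D + F L s) \<le> c1 * y"
          unfolding c1_def by (simp add: algebra_simps)
        have "(4 * A * \<rho> + 4 * p * (D + F L s) * y + 4 * A * (D + F L s)) * L \<le> c1 * y * y"
          using b Ly L c1 y by (intro mult_mono) auto
        from mult_right_mono[OF this, of "2 * \<beta> * \<kappa> * z"] \<beta> \<kappa> z
        show ?thesis unfolding F1 by (simp add: power2_eq_square mult_ac)
      qed
      have a3: "4 * p * \<rho> * (F1 L)\<^sup>2 \<le> 16 * p * \<beta> * \<kappa> * \<beta> * \<kappa> * z * y\<^sup>2"
      proof -
        have "(F1 L)\<^sup>2 = 4 * \<beta>\<^sup>2 * \<kappa>\<^sup>2 * (z * (z * L\<^sup>2))"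
          unfolding F1 by (simp add: power2_eq_square)
        also have "\<dots> \<le> 4 * \<beta>\<^sup>2 * \<kappa>\<^sup>2 * (z * 1)"
        proof -
          have "z * L\<^sup>2 \<le> 1" using zL2 f0(2) \<kappa> unfolding zq by simp
          then show ?thesis using z \<beta> \<kappa> by (intro mult_left_mono) auto
        qed
        finally have "4 * p * \<rho> * (F1 L)\<^sup>2 \<le> 4 * p * y\<^sup>2 * (4 * \<beta>\<^sup>2 * \<kappa>\<^sup>2 * (z * 1))"
        proof (rule mult_mono[rotated])
          have "\<rho> \<le> y\<^sup>2" using \<rho> y self_le_power[of y 2] by simp
          then show "4 * p * \<rho> \<le> 4 * p * y\<^sup>2" using p by (intro mult_left_mono) auto
        qed (use p in auto)
        then show ?thesis by (simp add: power2_eq_square mult_ac)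
      qed
      have "- \<beta> * k * \<kappa> * z * y\<^sup>2 \<le> - (8 * (1 + D + \<kappa>) * \<beta> * \<kappa> * z * y\<^sup>2) - 2 * c1 * \<beta> * \<kappa> * z * y\<^sup>2
          - 16 * p * \<beta> * \<kappa> * \<beta> * \<kappa> * z * y\<^sup>2"
      proof -
        have "0 \<le> \<beta> * \<kappa> * z * y\<^sup>2" using \<beta> \<kappa> z by simp
        then show ?thesis unfolding k_def by (simp add: algebra_simps)
      qed
      then have "- \<beta> * k * \<kappa> * z * y\<^sup>2 \<le> 4 * \<rho> * (\<rho> + D + F L s) * F2 L
         + (4 * A * \<rho> + 4 * p * (D + F L s) * y + 4 * A * (D + F L s)) * F1 L
         - 4 * p * \<rho> * (F1 L)\<^sup>2" using a1 a2 a3 by linarith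
      then show ?thesis
        unfolding po Ft_def z_def[symmetric] using y by (simp add: le_divide_eq)
    qed
    have lapC: "(\<Sum>i\<in>UNIV. h $ i) \<le> C"
    proof -
      have "4 * \<rho> / y\<^sup>2 * F2 L \<le> 4 * (4 * \<beta> * (\<beta> + 1) * \<kappa>)"
      proof -
        have "\<rho> \<le> y\<^sup>2" using \<rho> y self_le_power[of y 2] by simp
        then have "4 * \<rho> / y\<^sup>2 \<le> 4" "4 * \<rho> / y\<^sup>2 \<ge> 0" using y \<rho> by (auto simp: divide_le_eq)
        then have "4 * \<rho> / y\<^sup>2 * F2 L \<le> 4 * \<rho> / y\<^sup>2 * (4 * \<beta> * (\<beta> + 1) * \<kappa>)"
          using F2_up by (intro mult_left_mono)
        also have "\<dots> \<le> 4 * (4 * \<beta> * (\<beta> + 1) * \<kappa>)"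
          using \<open>4 * \<rho> / y\<^sup>2 \<le> 4\<close> \<beta> \<kappa> by (intro mult_right_mono) auto
        finally show ?thesis .
      qed
      moreover have "(4 * p * y + 4 * A) / y\<^sup>2 * F1 L \<le> 0"
        using F1_neg p y A by (intro mult_nonneg_nonpos) auto
      ultimately show ?thesis unfolding lap using C(2) by simp
    qed
    have grC: "- (x \<bullet> g) \<le> C * (1 + x \<bullet> x)"
    proof -
      have "\<rho> / y \<le> 1" "\<rho> / y \<ge> 0" using \<rho> y by auto
      then have "\<rho> / y * (- F1 L) \<le> 1 * (2 * \<beta> * \<kappa>)"
        using F1_low F1_neg \<beta> \<kappa> by (intro mult_mono) auto
      then have "- (x \<bullet> g) \<le> C * 1" unfolding xg using C(3) by simp
      also have "\<dots> \<le> C * (1 + x \<bullet> x)" using C(4) by (intro mult_left_mono) auto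
      finally show ?thesis .
    qed
    show "\<exists>a g h. has_jet (\<lambda>x t. F (ln (x \<bullet> x + A)) t) x s a g h \<and>
        - 1 * (a - pressure_operator D x (F (ln (x \<bullet> x + A)) s) g h) \<ge> 0 \<and>
        (\<Sum>i\<in>UNIV. h $ i) \<le> C \<and> - (x \<bullet> g) \<le> C * (1 + x \<bullet> x)"
      using jet ineq lapC grC unfolding L_def y_def \<rho>_def by (intro exI conjI) auto
  qed (use t C in auto)
  show ?thesis
  proof (intro exI[of _ k] conjI allI impI)
    fix x :: "real ^ 'n" and t assume "t1 \<le> t"
    from main[OF this, of x]
    show "\<kappa> * ((ln (x \<bullet> x + exp 1))\<^sup>2 + k * (t - t1 + 1)) powr (- (\<gamma> / 2)) \<le> u x t"
      by (simp add: F_def q_def A_def \<beta>_def)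
  qed (use k1 in simp)
qed

text \<open>For a pure power the time derivative leaves
  \<open>(\<alpha> - \<beta>) * X - \<beta>\<close>, the drift helps because the function decreases,
  and the diffusion costs at most a constant, all relative to
  \<open>(1 + X) powr (- \<alpha> - 1)\<close>. So \<open>\<alpha> = \<beta>\<close> is neutral at
  first order in \<open>X\<close>, while \<open>\<alpha> = \<beta> + 1\<close> gains
  \<open>X\<close>.\<close>

lemma profile_power_bound:
  fixes X \<alpha> \<beta> \<theta> \<eta> :: real
  assumes X: "X \<ge> 0" and \<alpha>: "\<alpha> > 0" and \<theta>: "0 \<le> \<theta>" "\<theta> \<le> 1" and \<eta>: "\<eta> \<ge> 0"
  shows "- \<beta> * (1 + X) powr (- \<alpha>) - X * (- \<alpha> * (1 + X) powr (- \<alpha> - 1))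
      - 4 * \<theta> * (2 * (- \<alpha> * (1 + X) powr (- \<alpha> - 1)) + 4 * X * (\<alpha> * (\<alpha> + 1) * (1 + X) powr (- \<alpha> - 2)))
      - \<eta> * (- \<alpha> * (1 + X) powr (- \<alpha> - 1))
    \<ge> (1 + X) powr (- \<alpha> - 1) * (- \<beta> * (1 + X) + \<alpha> * X - 16 * \<alpha> * (\<alpha> + 1))"
proof -
  define z where "z = (1 + X) powr (- \<alpha> - 1)"
  have z: "z \<ge> 0" by (simp add: z_def)
  have e: "(1 + X) powr (- \<alpha>) = z * (1 + X)" "(1 + X) powr (- \<alpha> - 2) = z / (1 + X)"
  proof -
    have "- \<alpha> = (- \<alpha> - 1) + 1" "- \<alpha> - 2 = (- \<alpha> - 1) - 1" by auto
    then show "(1 + X) powr (- \<alpha>) = z * (1 + X)" "(1 + X) powr (- \<alpha> - 2) = z / (1 + X)"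
      using X powr_add[of "1 + X" "- \<alpha> - 1" 1] powr_diff[of "1 + X" "- \<alpha> - 1" 1]
      unfolding z_def by (metis powr_one add_nonneg_nonneg zero_le_one)+
  qed
  have a: "\<theta> * (X / (1 + X)) \<le> 1 * 1"
    using X \<theta> by (intro mult_mono) auto
  have "z * (16 * \<alpha> * (\<alpha> + 1) * (\<theta> * (X / (1 + X)))) \<le> z * (16 * \<alpha> * (\<alpha> + 1))"
    using mult_left_mono[OF a, of "16 * \<alpha> * (\<alpha> + 1)"] \<alpha> z by (intro mult_left_mono) auto
  moreover have "z * (8 * \<theta> * \<alpha> + \<eta> * \<alpha>) \<ge> 0" using z \<theta> \<alpha> \<eta> by simp
  ultimately show ?thesis
    unfolding e z_def[symmetric] by (simp add: algebra_simps add_divide_distrib)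
qed

text \<open>
  For self-similar \<open>\<tau>\<^bsup>-\<beta>\<^esup> H(s\<^sup>2/\<tau>)\<close> the equation reduces to the inequality below, where \<open>\<theta>\<close> is the
  diffusion coefficient relative to its limit at infinity and \<open>\<eta>\<close> the drift. The terms
  \<open>(1+X)\<^bsup>-\<beta>\<^esup> + 14 (1+X)\<^bsup>-\<beta>-1\<^esup>\<close> have the required decay and are a supersolution for large \<open>X\<close>;
  the Gaussian, which has slack because \<open>\<gamma> < 1\<close>, compensates on the remaining bounded range.
\<close>

lemma profile_supersolution:
  fixes \<gamma> X \<theta> \<eta> :: real
  assumes \<gamma>: "0 < \<gamma>" "\<gamma> < 1" and X: "X \<ge> 0" and \<theta>: "0 \<le> \<theta>" "\<theta> \<le> 1" and \<eta>: "\<eta> \<ge> 0"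
    and large: "\<theta> / 2 + \<eta> / 16 \<ge> (1 + \<gamma>) / 4"
    and \<beta>: "\<beta> = \<gamma> / 2" and K: "K = 4 * 868 * exp (868 / 16) / (1 - \<gamma>)"
    and H: "H = K * exp (- X / 16) + (1 + X) powr (- \<beta>) + 14 * (1 + X) powr (- \<beta> - 1)"
    and H1: "H1 = - (K / 16) * exp (- X / 16) - \<beta> * (1 + X) powr (- \<beta> - 1) - 14 * (\<beta> + 1) * (1 + X) powr (- \<beta> - 2)"
    and H2: "H2 = K / 256 * exp (- X / 16) + \<beta> * (\<beta> + 1) * (1 + X) powr (- \<beta> - 2)
               + 14 * (\<beta> + 1) * (\<beta> + 2) * (1 + X) powr (- \<beta> - 3)"
  shows "- \<beta> * H - X * H1 - 4 * \<theta> * (2 * H1 + 4 * X * H2) - \<eta> * H1 \<ge> 0"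
proof -
  define q where "q G G1 G2 = - \<beta> * G - X * G1 - 4 * \<theta> * (2 * G1 + 4 * X * G2) - \<eta> * G1" for G G1 G2 :: real
  define e where "e = exp (- X / 16)"
  have \<beta>2: "\<beta> > 0" "\<beta> < 1 / 2" using \<gamma> \<beta> by auto
  have Kpos: "K > 0" using \<gamma> K by simp
  define z where "z = (1 + X) powr (- \<beta> - 2)"
  have z: "z \<ge> 0" "z \<le> 1"
  proof -
    have "(1 + X) powr (- \<beta> - 2) \<le> 1 powr (- \<beta> - 2)" using X \<beta>2 by (intro powr_mono2') auto
    then show "z \<le> 1" by (simp add: z_def)
  qed (simp add: z_def)
  have z1: "(1 + X) powr (- \<beta> - 1) = z * (1 + X)"
  proof -
    have "- \<beta> - 1 = (- \<beta> - 2) + 1" by simp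
    then show ?thesis
      using X powr_add[of "1 + X" "- \<beta> - 2" 1] unfolding z_def
      by (metis powr_one add_nonneg_nonneg zero_le_one)
  qed
  \<comment> \<open>The exponential is the heat kernel profile of \<open>F_t = 4 F''\<close>, whose
    natural decay is \<open>\<tau> powr (- 1 / 2)\<close>. The threshold
    \<open>(1 + \<gamma>) / 4\<close> in \<open>large\<close> is the midpoint of
    \<open>\<beta> = \<gamma> / 2\<close> and \<open>1 / 2\<close>, so half of the slack
    \<open>1 / 2 - \<beta>\<close> remains.\<close>
  have E: "q (K * e) (- (K / 16) * e) (K / 256 * e) \<ge> K * (1 - \<gamma>) / 4 * e"
  proof -
    have "q (K * e) (- (K / 16) * e) (K / 256 * e) = K * e * (\<theta> / 2 + \<eta> / 16 - \<beta> + (1 - \<theta>) * (X / 16))"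
      unfolding q_def by (simp add: field_simps)
    also have "\<dots> \<ge> K * e * ((1 - \<gamma>) / 4)"
    proof (rule mult_left_mono)
      have "(1 - \<theta>) * (X / 16) \<ge> 0" using \<theta> X by simp
      moreover have "(1 + \<gamma>) / 4 - \<beta> = (1 - \<gamma>) / 4" using \<beta> by (simp add: field_simps)
      ultimately show "(1 - \<gamma>) / 4 \<le> \<theta> / 2 + \<eta> / 16 - \<beta> + (1 - \<theta>) * (X / 16)" using large by linarith
    qed (use Kpos in \<open>simp add: e_def\<close>)
    finally show ?thesis by (simp add: mult_ac)
  qed
  \<comment> \<open>The worst case \<open>\<beta> = 1 / 2\<close> loses
    \<open>1 / 2 + 16 * (3 / 4) = 12.5\<close>, rounded up to 13.\<close>
  have P1: "q ((1 + X) powr (- \<beta>)) (- \<beta> * (1 + X) powr (- \<beta> - 1)) (\<beta> * (\<beta> + 1) * (1 + X) powr (- \<beta> - 2))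
      \<ge> z * (1 + X) * (- 13)"
  proof -
    have "\<beta> * (\<beta> + 1) \<le> 1 / 2 * (3 / 2)" using \<beta>2 by (intro mult_mono) auto
    then have "z * (1 + X) * (- 13) \<le> z * (1 + X) * (- \<beta> * (1 + X) + \<beta> * X - 16 * \<beta> * (\<beta> + 1))"
      using z X \<beta>2 by (intro mult_left_mono) (auto simp: algebra_simps)
    then show ?thesis
      using profile_power_bound[OF X \<beta>2(1) \<theta> \<eta>, of \<beta>] unfolding q_def z1 by linarith
  qed
  \<comment> \<open>Here \<open>1 / 2 + 16 * (15 / 4) = 60.5\<close> is rounded up to 61. The weight
    14 in \<open>H\<close> is one more than the 13 of \<open>P1\<close>, so a net \<open>X\<close>
    survives; the constants add up to \<open>13 + 14 * 61 = 867\<close>.\<close>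
  have P2: "q ((1 + X) powr (- \<beta> - 1)) (- (\<beta> + 1) * (1 + X) powr (- \<beta> - 2))
      ((\<beta> + 1) * (\<beta> + 2) * (1 + X) powr (- \<beta> - 3)) \<ge> z * (X - 61)"
  proof -
    have shift: "- (\<beta> + 1) = - \<beta> - 1" "- \<beta> - 1 - 1 = - \<beta> - 2" "- \<beta> - 1 - 2 = - \<beta> - 3" "\<beta> + 1 + 1 = \<beta> + 2"
      by auto
    have "(\<beta> + 1) * (\<beta> + 2) \<le> 3 / 2 * (5 / 2)" using \<beta>2 by (intro mult_mono) auto
    then have "z * (X - 61) \<le> z * (- \<beta> * (1 + X) + (\<beta> + 1) * X - 16 * (\<beta> + 1) * (\<beta> + 2))"
      using z X \<beta>2 by (intro mult_left_mono) (auto simp: algebra_simps)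
    then show ?thesis
      using profile_power_bound[OF X _ \<theta> \<eta>, of "\<beta> + 1" \<beta>] \<beta>2 unfolding q_def z_def shift by linarith
  qed
  have sum: "q H H1 H2 = q (K * e) (- (K / 16) * e) (K / 256 * e)
      + q ((1 + X) powr (- \<beta>)) (- \<beta> * (1 + X) powr (- \<beta> - 1)) (\<beta> * (\<beta> + 1) * (1 + X) powr (- \<beta> - 2))
      + 14 * q ((1 + X) powr (- \<beta> - 1)) (- (\<beta> + 1) * (1 + X) powr (- \<beta> - 2))
      ((\<beta> + 1) * (\<beta> + 2) * (1 + X) powr (- \<beta> - 3))"
    unfolding q_def H H1 H2 e_def by (simp add: algebra_simps)
  have "q H H1 H2 \<ge> K * (1 - \<gamma>) / 4 * e + z * (X - 867)"
  proof -
    have "z * (1 + X) * (- 13) + 14 * (z * (X - 61)) = z * (X - 867)" by (simp add: algebra_simps)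
    then show ?thesis using sum E P1 P2 by linarith
  qed
  moreover have "K * (1 - \<gamma>) / 4 * e + z * (X - 867) \<ge> 0"
  \<comment> \<open>For \<open>X \<ge> 868\<close> the powers suffice by themselves. Below,
    \<open>z \<le> 1\<close> limits their deficit to 867, and \<open>K\<close> is chosen so that the
    Gaussian contributes at least 868 up to the end of the range.\<close>
  proof (cases "X \<ge> 868")
    case True
    then show ?thesis using z Kpos \<gamma> by (simp add: e_def)
  next
    case False
    have "K * (1 - \<gamma>) / 4 * e = 868 * exp (868 / 16) * e"
      using \<gamma> unfolding K by (simp add: field_simps)
    also have "\<dots> = 868 * exp ((868 - X) / 16)"
      by (simp add: e_def mult_exp_exp diff_divide_distrib)
    also have "\<dots> \<ge> 868 * 1" using False by (intro mult_left_mono) auto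
    finally have 1: "K * (1 - \<gamma>) / 4 * e \<ge> 868" by simp
    have "z * (X - 867) \<ge> z * (- 867)" using z X by (intro mult_left_mono) auto
    moreover have "z * (- 867) \<ge> - 867" using z by simp
    ultimately show ?thesis using 1 by linarith
  qed
  ultimately show ?thesis unfolding q_def by linarith
qed

lemma mult_exp_neg_le_one:
  fixes x :: real
  shows "x * exp (- x) \<le> 1"
proof -
  have "x \<le> exp x" using exp_ge_add_one_self[of x] by linarith
  then show ?thesis by (simp add: exp_minus divide_inverse[symmetric] divide_le_eq)
qed

text \<open>The barrier is self-similar in \<open>S = L + M\<close> and
  \<open>\<tau> = t + s0\<^sup>2\<close>. The hypothesis \<open>growth\<close> is the quadratic
  bound that comparison from above demands: where \<open>u\<close> exceeds the barrier, positivity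
  of the pressure gives no upper bound on it.\<close>

lemma log_decay_upper_bound:
  fixes u :: "real ^ 'n \<Rightarrow> real \<Rightarrow> real"
  assumes n: "CARD('n) \<ge> 3" and D: "D > 0" and sol: "pressure_solution D u"
    and nonneg: "\<And>x t. t \<ge> 0 \<Longrightarrow> u x t \<ge> 0"
    and B: "B > 0" and \<gamma>: "0 < \<gamma>" "\<gamma> < 1"
    and init: "\<And>x. u x 0 \<le> B * ln (x \<bullet> x + exp 1) powr (- \<gamma>)"
    and growth: "\<And>T. T \<ge> 0 \<Longrightarrow> \<exists>C. \<forall>x. \<forall>t\<in>{0..T}. x \<bullet> x + D + u x t \<le> C * (1 + x \<bullet> x)"
  shows "\<exists>C>0. \<forall>x. \<forall>t\<ge>0. u x t \<le> C * (t + 1) powr (- (\<gamma> / 2))"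
proof -
  define \<beta> where "\<beta> = \<gamma> / 2"
  have \<beta>: "\<beta> > 0" "\<beta> < 1 / 2" using \<gamma> by (simp_all add: \<beta>_def)
  define p where "p = (real CARD('n) - 2) / 2"
  have p: "p \<ge> 1 / 2" using n by (simp add: p_def)
  define K where "K = 4 * 868 * exp (868 / 16) / (1 - \<gamma>)"
  have K: "K > 0" using \<gamma> by (simp add: K_def)
  define H where "H X = K * exp (- X / 16) + (1 + X) powr (- \<beta>) + 14 * (1 + X) powr (- \<beta> - 1)" for X
  define H1 where "H1 X = - (K / 16) * exp (- X / 16) - \<beta> * (1 + X) powr (- \<beta> - 1)
      - 14 * (\<beta> + 1) * (1 + X) powr (- \<beta> - 2)" for X
  define H2 where "H2 X = K / 256 * exp (- X / 16) + \<beta> * (\<beta> + 1) * (1 + X) powr (- \<beta> - 2)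
      + 14 * (\<beta> + 1) * (\<beta> + 2) * (1 + X) powr (- \<beta> - 3)" for X
  have pw: "(1 + X) powr (- r) \<le> 1" "(1 + X) powr (- r) \<ge> 0" if "X \<ge> 0" "r \<ge> 0" for X r :: real
    using powr_mono2'[of "- r" 1 "1 + X"] that by simp_all
  have Xpw: "X * (1 + X) powr (- r) \<le> 1" if "X \<ge> 0" "r \<ge> 1" for X r :: real
  proof -
    have "X * (1 + X) powr (- r) \<le> (1 + X) * (1 + X) powr (- r)" using that by (intro mult_right_mono) auto
    also have "\<dots> = (1 + X) powr (- (r - 1))" using that powr_add[of "1 + X" 1 "- r"] by simp
    also have "\<dots> \<le> 1" using pw[of X "r - 1"] that by simp
    finally show ?thesis .
  qed
  have Xexp: "X * exp (- X / 16) \<le> 16" for X :: real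
    using mult_exp_neg_le_one[of "X / 16"] by simp
  have powr_shape: "- \<beta> - 1 = - (\<beta> + 1)" "- \<beta> - 2 = - (\<beta> + 2)" "- \<beta> - 3 = - (\<beta> + 3)" by auto
  have H_bounds: "H X \<le> K + 15" "H X \<ge> (1 + X) powr (- \<beta>)" "H X \<ge> 0" if "X \<ge> 0" for X
  proof -
    have "K * exp (- X / 16) \<le> K * 1" using K that by (intro mult_left_mono) auto
    then show "H X \<le> K + 15"
      using pw[of X \<beta>] pw[of X "\<beta> + 1"] that \<beta> unfolding H_def powr_shape by linarith
    show "H X \<ge> (1 + X) powr (- \<beta>)" "H X \<ge> 0"
      using K by (simp_all add: H_def)
  qed
  have H1_bounds: "H1 X \<le> 0" "X * (- H1 X) \<le> K + \<beta> + 14 * (\<beta> + 1)" if "X \<ge> 0" for X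
  proof -
    have "(K / 16) * exp (- X / 16) \<ge> 0" "\<beta> * (1 + X) powr (- \<beta> - 1) \<ge> 0"
      "14 * (\<beta> + 1) * (1 + X) powr (- \<beta> - 2) \<ge> 0" using K \<beta> by simp_all
    then show "H1 X \<le> 0" by (simp add: H1_def)
    have "X * (- H1 X) = K / 16 * (X * exp (- X / 16)) + \<beta> * (X * (1 + X) powr (- (\<beta> + 1)))
        + 14 * (\<beta> + 1) * (X * (1 + X) powr (- (\<beta> + 2)))"
      unfolding H1_def powr_shape by (simp add: algebra_simps)
    also have "\<dots> \<le> K / 16 * 16 + \<beta> * 1 + 14 * (\<beta> + 1) * 1"
      using K \<beta> that Xexp Xpw
      by (intro add_mono mult_left_mono) (auto simp del: minus_add_distrib)
    finally show "X * (- H1 X) \<le> K + \<beta> + 14 * (\<beta> + 1)" by simp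
  qed
  have H2_bound: "X * H2 X \<le> K + \<beta> * (\<beta> + 1) + 14 * (\<beta> + 1) * (\<beta> + 2)" if "X \<ge> 0" for X
  proof -
    have "X * H2 X = K / 256 * (X * exp (- X / 16)) + \<beta> * (\<beta> + 1) * (X * (1 + X) powr (- (\<beta> + 2)))
        + 14 * (\<beta> + 1) * (\<beta> + 2) * (X * (1 + X) powr (- (\<beta> + 3)))"
      unfolding H2_def powr_shape by (simp add: algebra_simps)
    also have "\<dots> \<le> K / 256 * 16 + \<beta> * (\<beta> + 1) * 1 + 14 * (\<beta> + 1) * (\<beta> + 2) * 1"
      using K \<beta> that Xexp Xpw
      by (intro add_mono mult_left_mono) (auto simp del: minus_add_distrib)
    finally show ?thesis using K by simp
  qed
  \<comment> \<open>The choice of constants is not circular. \<open>Fm\<close> bounds the barrier in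
    terms of \<open>B\<close> and \<open>K\<close> alone and fixes \<open>A\<close>, then
    \<open>M\<close>, \<open>s0\<close> and \<open>C0\<close>. The factor
    \<open>s0 powr \<gamma>\<close> in \<open>C0\<close> cancels against
    \<open>\<tau> t \<ge> s0\<^sup>2\<close>, so the bound survives any choice of the
    shifts.\<close>
  define Fm where "Fm = 4 * B * (K + 15)"
  have Fm: "Fm > 0" using B K by (simp add: Fm_def)
  \<comment> \<open>\<open>A \<ge> D + Fm\<close> gives \<open>\<rho> + D + F L s \<le> y\<close>,
    hence \<open>\<theta> \<le> 1\<close> below.\<close>
  define A where "A = exp 1 + D + Fm"
  have A: "A \<ge> exp 1" "A \<ge> D + Fm" using D Fm by (simp_all add: A_def)
  have A1: "A \<ge> 1" using A(1) exp_ge_add_one_self[of "1::real"] by linarith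
  \<comment> \<open>The shift \<open>M\<close> of the logarithmic variable makes the drift strong enough near the origin,
    where the diffusion coefficient degenerates.\<close>
  define M where "M = 8 * A / ((1 - \<gamma>) * D) + 1"
  have M: "M \<ge> 1" "M \<ge> 8 * A / ((1 - \<gamma>) * D)" using A1 D \<gamma> by (simp_all add: M_def)
  \<comment> \<open>The least value of \<open>L + M\<close>, attained at the origin. Starting
    \<open>\<tau>\<close> at its square makes the initial \<open>\<tau>\<close> comparable with the
    smallest \<open>S\<^sup>2\<close>.\<close>
  define s0 where "s0 = ln A + M"
  have s0: "s0 \<ge> 1" using A1 M by (simp add: s0_def add_increasing)
  define C0 where "C0 = 4 * B * s0 powr \<gamma>"
  have C0: "C0 > 0" using B s0 by (simp add: C0_def)
  define \<tau> where "\<tau> t = t + s0\<^sup>2" for t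
  have \<tau>1: "\<tau> t \<ge> 1" "\<tau> t \<ge> t + 1" "\<tau> t \<ge> s0\<^sup>2" if "t \<ge> 0" for t
  proof -
    have "s0\<^sup>2 \<ge> 1" using s0 by simp
    then show "\<tau> t \<ge> 1" "\<tau> t \<ge> t + 1" "\<tau> t \<ge> s0\<^sup>2" using that by (simp_all add: \<tau>_def)
  qed
  have s0pow: "(s0\<^sup>2) powr (- \<beta>) = s0 powr (- \<gamma>)"
    using s0 by (simp add: \<beta>_def powr_powr flip: powr_numeral)
  define F where "F L t = C0 * (\<tau> t powr (- \<beta>) * H ((L + M)\<^sup>2 / \<tau> t))" for L t
  have F_bounds: "F L t \<ge> 0" "F L t \<le> Fm" "F L t \<le> C0 * (K + 15) * (t + 1) powr (- \<beta>)" if t: "t \<ge> 0" for L t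
  proof -
    have X: "(L + M)\<^sup>2 / \<tau> t \<ge> 0" using \<tau>1[OF t] by simp
    have H: "0 \<le> H ((L + M)\<^sup>2 / \<tau> t)" "H ((L + M)\<^sup>2 / \<tau> t) \<le> K + 15" using H_bounds[OF X] by auto
    show "F L t \<ge> 0" unfolding F_def using C0 H by simp
    have "\<tau> t powr (- \<beta>) \<le> (s0\<^sup>2) powr (- \<beta>)"
      using \<tau>1[OF t] s0 \<beta> by (intro powr_mono2') auto
    then have "F L t \<le> C0 * (s0 powr (- \<gamma>) * (K + 15))"
      unfolding F_def s0pow using C0 H by (intro mult_left_mono mult_mono) auto
    also have "\<dots> = 4 * B * (s0 powr \<gamma> * s0 powr (- \<gamma>)) * (K + 15)" by (simp add: C0_def)
    also have "s0 powr \<gamma> * s0 powr (- \<gamma>) = 1" using s0 powr_add[of s0 \<gamma> "- \<gamma>"] by simp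
    finally show "F L t \<le> Fm" by (simp add: Fm_def)
    have "\<tau> t powr (- \<beta>) \<le> (t + 1) powr (- \<beta>)"
      using \<tau>1[OF t] t \<beta> by (intro powr_mono2') auto
    then have "F L t \<le> C0 * ((t + 1) powr (- \<beta>) * (K + 15))"
      unfolding F_def using C0 H by (intro mult_left_mono mult_mono) auto
    then show "F L t \<le> C0 * (K + 15) * (t + 1) powr (- \<beta>)" by (simp add: mult_ac)
  qed
  have F_init: "B * ln (x \<bullet> x + exp 1) powr (- \<gamma>) \<le> F (ln (x \<bullet> x + A)) 0" for x :: "real ^ 'n"
  proof -
    define l where "l = ln (x \<bullet> x + exp 1)"
    define s where "s = ln (x \<bullet> x + A) + M"
    have e1: "exp 1 \<ge> (1::real)" by simp
    have "l \<ge> ln (exp 1)" unfolding l_def by (intro ln_mono) (auto simp: add_nonneg_pos)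
    then have l: "l \<ge> 1" by simp
    have "x \<bullet> x + A \<le> (x \<bullet> x + exp 1) * A"
    proof -
      have "(x \<bullet> x) * 1 \<le> (x \<bullet> x) * A" using A1 by (intro mult_left_mono) auto
      moreover have "1 * A \<le> exp 1 * A" using A1 e1 by (intro mult_right_mono) auto
      ultimately show ?thesis by (simp add: algebra_simps)
    qed
    then have "ln (x \<bullet> x + A) \<le> ln ((x \<bullet> x + exp 1) * A)"
      using A1 by (intro ln_mono) (auto simp: add_nonneg_pos)
    also have "\<dots> = l + ln A" unfolding l_def using A1 by (intro ln_mult_pos) (auto simp: add_nonneg_pos)
    finally have s_up: "s \<le> l + s0" by (simp add: s_def s0_def)
    have "ln (x \<bullet> x + A) \<ge> ln A" using A1 by (intro ln_mono) auto
    then have s_low: "s \<ge> s0" by (simp add: s_def s0_def)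
    have "l + s0 \<le> 2 * (s0 * l)"
    proof -
      have "l * 1 \<le> l * s0" "1 * s0 \<le> l * s0" using l s0 by (intro mult_left_mono mult_right_mono; simp)+
      then show ?thesis by (simp add: mult.commute[of s0])
    qed
    then have "s\<^sup>2 \<le> (2 * (s0 * l))\<^sup>2" using s_up s_low s0 by (intro power_mono) auto
    moreover have "s0\<^sup>2 \<le> s\<^sup>2" using s_low s0 by (intro power_mono) auto
    ultimately have le: "s0\<^sup>2 + s\<^sup>2 \<le> 8 * (s0\<^sup>2 * l\<^sup>2)" by (simp add: power_mult_distrib)
    have pos: "s0\<^sup>2 > 0" using s0 by simp
    \<comment> \<open>Since \<open>\<beta> < 1 / 2\<close>, the power is at least
      \<open>16 powr (- 1 / 2)\<close>. This pays for the 8 in \<open>le\<close> and explains the 4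
      in \<open>C0\<close>.\<close>
    have "1 / 4 \<le> (8::real) powr (- \<beta>)"
    proof -
      have "(8::real) powr (- \<beta>) \<ge> 16 powr (- \<beta>)" using \<beta> by (intro powr_mono2') auto
      moreover have "(16::real) powr (- \<beta>) \<ge> 16 powr (- (1 / 2))" using \<beta> by (intro powr_mono) auto
      moreover have "(16::real) powr (- (1 / 2)) = 1 / 4"
        by (simp add: powr_minus powr_half_sqrt real_sqrt_unique inverse_eq_divide)
      ultimately show ?thesis by linarith
    qed
    then have "1 / 4 * (s0 powr (- \<gamma>) * l powr (- \<gamma>)) \<le> 8 powr (- \<beta>) * (s0 powr (- \<gamma>) * l powr (- \<gamma>))"
      by (intro mult_right_mono) auto
    also have "\<dots> = (8 * (s0\<^sup>2 * l\<^sup>2)) powr (- \<beta>)"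
    proof -
      have "(l\<^sup>2) powr (- \<beta>) = l powr (- \<gamma>)"
        using l by (simp add: \<beta>_def powr_powr flip: powr_numeral)
      then show ?thesis using s0pow s0 l by (simp add: powr_mult)
    qed
    also have "\<dots> \<le> (s0\<^sup>2 + s\<^sup>2) powr (- \<beta>)"
      using le pos \<beta> by (intro powr_mono2') (auto simp: add_pos_nonneg)
    also have "\<dots> = (\<tau> 0) powr (- \<beta>) * (1 + s\<^sup>2 / \<tau> 0) powr (- \<beta>)"
    proof -
      have "s0\<^sup>2 + s\<^sup>2 = \<tau> 0 * (1 + s\<^sup>2 / \<tau> 0)" using pos by (simp add: \<tau>_def field_simps)
      then show ?thesis using pos by (simp add: powr_mult \<tau>_def)
    qed
    also have "\<dots> \<le> (\<tau> 0) powr (- \<beta>) * H (s\<^sup>2 / \<tau> 0)"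
      using H_bounds(2)[of "s\<^sup>2 / \<tau> 0"] pos by (intro mult_left_mono) (auto simp: \<tau>_def)
    finally have "C0 * (1 / 4 * (s0 powr (- \<gamma>) * l powr (- \<gamma>))) \<le> F (ln (x \<bullet> x + A)) 0"
      unfolding F_def s_def[symmetric] using C0 by (intro mult_left_mono) auto
    moreover have "C0 * (1 / 4 * (s0 powr (- \<gamma>) * l powr (- \<gamma>))) = B * l powr (- \<gamma>)"
    proof -
      have one: "s0 powr \<gamma> * s0 powr (- \<gamma>) = 1" using s0 powr_add[of s0 \<gamma> "- \<gamma>"] by simp
      have "C0 * (1 / 4 * (s0 powr (- \<gamma>) * l powr (- \<gamma>))) = B * (s0 powr \<gamma> * s0 powr (- \<gamma>)) * l powr (- \<gamma>)"
        by (simp add: C0_def)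
      then show ?thesis unfolding one by simp
    qed
    ultimately show ?thesis unfolding l_def by linarith
  qed
  have main: "1 * (u x t - F (ln (x \<bullet> x + A)) t) \<le> 0" if t: "0 \<le> t" for x t
  proof -
    obtain CT where CT: "\<And>x s. s \<in> {0..t} \<Longrightarrow> x \<bullet> x + D + u x s \<le> CT * (1 + x \<bullet> x)"
      using growth[OF t] by blast
    define C where "C = max CT 0 + 16 * C0 * (K + \<beta> * (\<beta> + 1) + 14 * (\<beta> + 1) * (\<beta> + 2))
        + 4 * C0 * (K + \<beta> + 14 * (\<beta> + 1))"
    have Cparts: "0 \<le> C0 * (K + \<beta> * (\<beta> + 1) + 14 * (\<beta> + 1) * (\<beta> + 2))" "0 \<le> C0 * (K + \<beta> + 14 * (\<beta> + 1))"
      using C0 K \<beta> by simp_all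
    have C: "C \<ge> CT" "C \<ge> 0" "C \<ge> 16 * C0 * (K + \<beta> * (\<beta> + 1) + 14 * (\<beta> + 1) * (\<beta> + 2))"
        "C \<ge> 4 * C0 * (K + \<beta> + 14 * (\<beta> + 1))"
      unfolding C_def using Cparts by linarith+
    show ?thesis
    proof (rule comparison[where T = t and C = C and ?t1.0 = 0 and f = "\<lambda>x t. F (ln (x \<bullet> x + A)) t",
          OF _ _ sol order_refl])
      show "2 \<le> CARD('n)" using n by simp
      show "continuous_on (UNIV \<times> {0..t}) (\<lambda>(x :: real ^ 'n, t). F (ln (x \<bullet> x + A)) t)"
      proof -
        have ne: "x \<bullet> x + A \<noteq> 0" for x :: "real ^ 'n"
          using A1 inner_ge_zero[of x] by linarith
        have \<tau>ne: "\<tau> s \<noteq> 0" if "s \<ge> 0" for s using \<tau>1[OF that] by auto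
        have Xne: "1 + (L + M)\<^sup>2 / \<tau> s \<noteq> 0" if "s \<ge> 0" for s L
        proof -
          have "(L + M)\<^sup>2 / \<tau> s \<ge> 0" using \<tau>1[OF that] by simp
          then show ?thesis by linarith
        qed
        show ?thesis
          unfolding F_def H_def case_prod_beta
          by (intro continuous_intros ballI ne \<tau>ne Xne) (auto simp: \<tau>_def intro!: continuous_intros)
      qed
      show "1 * (u x 0 - F (ln (x \<bullet> x + A)) 0) \<le> 0" for x
        using init[of x] F_init[of x] by simp
      fix x :: "real ^ 'n" and s
      assume s: "0 \<le> s" "s \<le> t" and d: "0 < 1 * (u x s - F (ln (x \<bullet> x + A)) s)"
      have "x \<bullet> x + D + u x s \<le> CT * (1 + x \<bullet> x)" using CT s by simp
      also have "\<dots> \<le> C * (1 + x \<bullet> x)" using C by (intro mult_right_mono) auto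
      finally have "x \<bullet> x + D + u x s \<le> C * (1 + x \<bullet> x)"
        "u x s - F (ln (x \<bullet> x + A)) s \<le> C * (1 + x \<bullet> x)"
        using F_bounds(1)[OF s(1), of "ln (x \<bullet> x + A)"] D inner_ge_zero[of x] by linarith+
      then show "x \<bullet> x + D + u x s \<le> C * (1 + x \<bullet> x) \<and>
          1 * (u x s - F (ln (x \<bullet> x + A)) s) \<le> C * (1 + x \<bullet> x)" by simp
    next
      fix x :: "real ^ 'n" and s
      assume s: "0 < s" "s \<le> t" and d: "0 < 1 * (u x s - F (ln (x \<bullet> x + A)) s)"
      define X where "X L = (L + M)\<^sup>2 / \<tau> s" for L
      have \<tau>s: "\<tau> s \<ge> 1" using \<tau>1 s by simp
      have X0: "X L \<ge> 0" for L unfolding X_def using \<tau>s by simp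
      define F1 where "F1 L = C0 * (\<tau> s powr (- \<beta>) * (H1 (X L) * (2 * (L + M) / \<tau> s)))" for L
      define F2 where "F2 L = C0 * (\<tau> s powr (- \<beta>) *
          (H2 (X L) * (2 * (L + M) / \<tau> s) * (2 * (L + M) / \<tau> s) + H1 (X L) * (2 / \<tau> s)))" for L
      define Ft where "Ft L = C0 * ((- \<beta>) * \<tau> s powr (- \<beta> - 1) * H (X L)
          + \<tau> s powr (- \<beta>) * (H1 (X L) * (- ((L + M)\<^sup>2 / (\<tau> s)\<^sup>2))))" for L
      have dpw: "((\<lambda>X. (1 + X) powr r) has_real_derivative r * (1 + X) powr (r - 1)) (at X)"
        if "X \<ge> 0" for X r :: real
      proof -
        have "((\<lambda>X. 1 + X) has_real_derivative 1) (at X)" by (auto intro!: derivative_eq_intros)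
        from DERIV_chain2[where f = "\<lambda>z. z powr r" and g = "\<lambda>X. 1 + X", OF has_real_derivative_powr this]
        show ?thesis using that by simp
      qed
      have dexp: "((\<lambda>X. exp (- X / 16)) has_real_derivative (- 1 / 16) * exp (- X / 16)) (at X)" for X :: real
        by (auto intro!: derivative_eq_intros)
      have dH: "(H has_real_derivative H1 X) (at X)" if "X \<ge> 0" for X
        unfolding H_def[abs_def] H1_def
        by (rule dexp dpw[OF that] derivative_eq_intros refl)+ (simp add: diff_diff_eq algebra_simps)
      have dH1: "(H1 has_real_derivative H2 X) (at X)" if "X \<ge> 0" for X
        unfolding H1_def[abs_def] H2_def
        by (rule dexp dpw[OF that] derivative_eq_intros refl)+ (simp add: diff_diff_eq algebra_simps)
      have dX: "(X has_real_derivative 2 * (L + M) / \<tau> s) (at L)" for L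
        unfolding X_def[abs_def] using \<tau>s by (auto intro!: derivative_eq_intros)
      have d\<tau>: "(\<tau> has_real_derivative 1) (at s)"
        unfolding \<tau>_def[abs_def] by (auto intro!: derivative_eq_intros)
      have dXt: "((\<lambda>t. (L + M)\<^sup>2 / \<tau> t) has_real_derivative - ((L + M)\<^sup>2 / (\<tau> s)\<^sup>2)) (at s)" for L
        using \<tau>s by (auto intro!: derivative_eq_intros d\<tau> simp: power2_eq_square)
      note dHX = DERIV_chain2[OF dH[OF X0] dX] and dH1X = DERIV_chain2[OF dH1[OF X0] dX]
      have dF1: "((\<lambda>L. F L s) has_real_derivative F1 L) (at L)" for L
        unfolding F_def F1_def X_def[symmetric]
        by (intro DERIV_cmult dHX)
      have dlin: "((\<lambda>L. 2 * (L + M) / \<tau> s) has_real_derivative 2 / \<tau> s) (at L)" for L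
        using \<tau>s by (auto intro!: derivative_eq_intros)
      have dF2: "(F1 has_real_derivative F2 L) (at L)" for L
        unfolding F1_def[abs_def] F2_def
        by (rule dH1X dlin derivative_eq_intros refl)+ simp
      have dFt: "(F L has_real_derivative Ft L) (at s)" for L
      proof -
        have "((\<lambda>t. \<tau> t powr (- \<beta>)) has_real_derivative (- \<beta>) * \<tau> s powr (- \<beta> - 1) * 1) (at s)"
          using \<tau>s by (intro DERIV_chain2[OF has_real_derivative_powr d\<tau>]) simp
        moreover have "((\<lambda>t. H ((L + M)\<^sup>2 / \<tau> t)) has_real_derivative
            H1 (X L) * (- ((L + M)\<^sup>2 / (\<tau> s)\<^sup>2))) (at s)"
          using DERIV_chain2[OF dH[OF X0[of L, unfolded X_def]] dXt] by (simp add: X_def)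
        ultimately have "((\<lambda>t. \<tau> t powr (- \<beta>) * H ((L + M)\<^sup>2 / \<tau> t)) has_real_derivative
            (- \<beta>) * \<tau> s powr (- \<beta> - 1) * 1 * H ((L + M)\<^sup>2 / \<tau> s)
            + H1 (X L) * (- ((L + M)\<^sup>2 / (\<tau> s)\<^sup>2)) * \<tau> s powr (- \<beta>)) (at s)"
          by (rule DERIV_mult)
        from DERIV_cmult[OF this, of C0] show ?thesis
          unfolding F_def[abs_def] Ft_def by (simp add: X_def mult_ac)
      qed
      define \<rho> where "\<rho> = x \<bullet> x"
      define y where "y = \<rho> + A"
      define L where "L = ln y"
      obtain g h where jet: "has_jet (\<lambda>x t. F (ln (x \<bullet> x + A)) t) x s (Ft L) g h"
        and po: "pressure_operator D x (F L s) g h =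
          (4 * \<rho> * (\<rho> + D + F L s) * F2 L
           + (4 * A * \<rho> + 4 * p * (D + F L s) * y + 4 * A * (D + F L s)) * F1 L
           - 4 * p * \<rho> * (F1 L)\<^sup>2) / y\<^sup>2"
        and lap: "(\<Sum>i\<in>UNIV. h $ i) = 4 * \<rho> / y\<^sup>2 * F2 L + (4 * p * y + 4 * A) / y\<^sup>2 * F1 L"
        and xg: "x \<bullet> g = 2 * \<rho> / y * F1 L"
        using log_radial_jet[where F = F and D = D and t = s and x = x, OF _ p_def dF1 dF2 dFt, of A] A1
        unfolding L_def y_def \<rho>_def by auto
      define S where "S = L + M"
      have \<rho>: "\<rho> \<ge> 0" "\<rho> \<le> y" and y: "y \<ge> 1" "y \<ge> A"
        using A1 inner_ge_zero[of x] unfolding y_def \<rho>_def by linarith+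
      have "L \<ge> 0" unfolding L_def using y by simp
      then have S: "S \<ge> 1" "S \<ge> M" using M by (auto simp: S_def)
      have XL: "X L = S\<^sup>2 / \<tau> s" by (simp add: X_def S_def)
      define z where "z = C0 * \<tau> s powr (- \<beta> - 1)"
      have z: "z > 0" using C0 \<tau>s by (simp add: z_def)
      have \<tau>z: "C0 * \<tau> s powr (- \<beta>) = z * \<tau> s"
        using \<tau>s powr_add[of "\<tau> s" "- \<beta> - 1" 1] by (simp add: z_def)
      have F1z: "F1 L = 2 * z * S * H1 (X L)"
        using \<tau>s unfolding F1_def mult.assoc[symmetric] \<tau>z S_def[symmetric] by simp
      have F2z: "F2 L = z * (2 * H1 (X L) + 4 * X L * H2 (X L))"
      proof -
        have "F2 L = (z * \<tau> s) * (H2 (X L) * (2 * S / \<tau> s) * (2 * S / \<tau> s) + H1 (X L) * (2 / \<tau> s))"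
          unfolding F2_def \<tau>z[symmetric] S_def by simp
        also have "\<dots> = z * (2 * H1 (X L) + 4 * X L * H2 (X L))"
          using \<tau>s unfolding XL by (simp add: field_simps power2_eq_square)
        finally show ?thesis .
      qed
      have Ftz: "Ft L = z * (- \<beta> * H (X L) - X L * H1 (X L))"
      proof -
        have "Ft L = z * (- \<beta> * H (X L)) + (z * \<tau> s) * (H1 (X L) * (- (S\<^sup>2 / (\<tau> s)\<^sup>2)))"
          unfolding Ft_def \<tau>z[symmetric] S_def by (simp add: z_def algebra_simps)
        also have "\<dots> = z * (- \<beta> * H (X L) - X L * H1 (X L))"
          using \<tau>s unfolding XL by (simp add: field_simps power2_eq_square)
        finally show ?thesis .
      qed
      have f: "F L s \<ge> 0" "F L s \<le> Fm" using F_bounds s by auto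
      have H1n: "H1 (X L) \<le> 0" using H1_bounds X0 by simp
      \<comment> \<open>\<open>4 * \<theta>\<close> and \<open>b\<close> are the exact coefficients
        of \<open>F2\<close> and \<open>F1\<close> in the pressure operator. In terms of the profile
        the drift coefficient becomes \<open>2 * b * S\<close>.\<close>
      define \<theta> where "\<theta> = \<rho> * (\<rho> + D + F L s) / y\<^sup>2"
      define b where "b = (4 * A * \<rho> + 4 * p * (D + F L s) * y + 4 * A * (D + F L s)) / y\<^sup>2"
      have y2: "y\<^sup>2 > 0" using y by simp
      have \<theta>: "0 \<le> \<theta>" "\<theta> \<le> 1"
      proof -
        show "0 \<le> \<theta>" unfolding \<theta>_def using \<rho> D f by simp
        have "\<rho> * (\<rho> + D + F L s) \<le> y * y"
          using \<rho> f A(2) y D by (intro mult_mono) (auto simp: y_def)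
        then show "\<theta> \<le> 1" unfolding \<theta>_def using y2 by (simp add: power2_eq_square)
      qed
      have b: "b \<ge> 2 * D / y"
      proof -
        have "2 * D * y \<le> 4 * p * D * y" using p D y by (intro mult_right_mono) auto
        also have "\<dots> \<le> 4 * p * (D + F L s) * y" using p f y by (intro mult_right_mono mult_left_mono) auto
        also have "\<dots> \<le> 4 * A * \<rho> + 4 * p * (D + F L s) * y + 4 * A * (D + F L s)"
          using A1 \<rho> D f by simp
        finally have "2 * D * y / y\<^sup>2 \<le> b" unfolding b_def using y2 by (intro divide_right_mono) auto
        then show ?thesis using y by (simp add: power2_eq_square)
      qed
      \<comment> \<open>Far from the origin diffusion suffices, because
        \<open>\<theta> \<ge> (1 - A / y)\<^sup>2\<close>. Otherwise
        \<open>y < 4 * A / (1 - \<gamma>)\<close>, so \<open>b \<ge> 2 * D / y\<close> is bounded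
        below and \<open>S \<ge> M\<close> makes the drift term at least
        \<open>1 / 2\<close>.\<close>
      have large: "\<theta> / 2 + (2 * b * S) / 16 \<ge> (1 + \<gamma>) / 4"
      proof (cases "A / y \<le> (1 - \<gamma>) / 4")
        case True
        have "\<rho> * \<rho> / y\<^sup>2 \<le> \<theta>"
          unfolding \<theta>_def using \<rho> D f y2 by (intro divide_right_mono mult_left_mono) auto
        moreover have "\<rho> * \<rho> / y\<^sup>2 = (1 - A / y)\<^sup>2"
          using y by (simp add: y_def power2_eq_square field_simps)
        moreover have "(1 - A / y)\<^sup>2 \<ge> 1 - 2 * (A / y)" using zero_le_power2[of "A / y"] by (simp add: power2_diff)
        moreover have "(1 + \<gamma>) / 2 \<le> 1 - 2 * (A / y)" using True by simp
        ultimately have "\<theta> \<ge> (1 + \<gamma>) / 2" by simp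
        moreover have "2 * b * S \<ge> 0" using b D y S by (intro mult_nonneg_nonneg) (auto intro: order_trans[rotated])
        ultimately show ?thesis by linarith
      next
        case False
        then have "(1 - \<gamma>) * y < 4 * A" using y by (simp add: field_simps)
        have "8 * A \<le> M * ((1 - \<gamma>) * D)" using M(2) D \<gamma> by (simp add: divide_le_eq)
        then have "2 * ((1 - \<gamma>) * y) \<le> M * ((1 - \<gamma>) * D)" using \<open>(1 - \<gamma>) * y < 4 * A\<close> by linarith
        then have "(1 - \<gamma>) * (2 * y) \<le> (1 - \<gamma>) * (M * D)" by (simp add: mult_ac)
        then have "2 * y \<le> M * D" using \<gamma> by simp
        also have "\<dots> \<le> S * D" using S D by (intro mult_right_mono) auto
        finally have "2 \<le> S * (D / y)" using y by (simp add: field_simps)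
        moreover have "2 * b * S \<ge> 2 * (2 * D / y) * S" using b S by (intro mult_right_mono) auto
        moreover have "2 * (2 * D / y) * S = 4 * (S * (D / y))" by simp
        ultimately have "2 * b * S / 16 \<ge> 1 / 2" by linarith
        moreover have "(1 + \<gamma>) / 4 \<le> \<theta> / 2 + k" if "1 / 2 \<le> k" for k using that \<theta> \<gamma> by (simp add: field_simps)
        ultimately show ?thesis by blast
      qed
      have b0: "b \<ge> 0" using b D y by (auto intro: order_trans[rotated])
      have ineq: "pressure_operator D x (F L s) g h \<le> Ft L"
      proof -
        have bs: "2 * b * S \<ge> 0" using b0 S by simp
        have "0 \<le> - \<beta> * H (X L) - X L * H1 (X L) - 4 * \<theta> * (2 * H1 (X L) + 4 * X L * H2 (X L)) - (2 * b * S) * H1 (X L)"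
          by (rule profile_supersolution[OF \<gamma> X0 \<theta> bs large \<beta>_def K_def]) (simp_all add: H_def H1_def H2_def)
        then have "0 \<le> z * (- \<beta> * H (X L) - X L * H1 (X L) - 4 * \<theta> * (2 * H1 (X L) + 4 * X L * H2 (X L)) - (2 * b * S) * H1 (X L))"
          using z by simp
        also have "\<dots> = Ft L - 4 * \<theta> * F2 L - b * F1 L"
          unfolding Ftz F1z F2z by (simp add: algebra_simps)
        finally have "4 * \<theta> * F2 L + b * F1 L \<le> Ft L" by simp
        \<comment> \<open>The squared gradient enters the pressure operator with a minus sign, so it
          only helps a supersolution.\<close>
        moreover have "4 * p * \<rho> * (F1 L)\<^sup>2 / y\<^sup>2 \<ge> 0" using p \<rho> by simp
        moreover have "pressure_operator D x (F L s) g h = 4 * \<theta> * F2 L + b * F1 L - 4 * p * \<rho> * (F1 L)\<^sup>2 / y\<^sup>2"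
        proof -
          have "(4 * r * w * X + B * Z - Q) / Y = 4 * (r * w / Y) * X + B / Y * Z - Q / Y"
            for r w X B Z Q Y :: real by (simp add: add_divide_distrib diff_divide_distrib)
          then show ?thesis unfolding po \<theta>_def b_def by blast
        qed
        ultimately show ?thesis by linarith
      qed
      have zC0: "z \<le> C0"
      proof -
        have "\<tau> s powr (- \<beta> - 1) \<le> 1 powr (- \<beta> - 1)" using \<tau>s \<beta> by (intro powr_mono2') auto
        then show ?thesis using C0 by (simp add: z_def)
      qed
      have F1n: "F1 L \<le> 0" unfolding F1z using z S H1n by (intro mult_nonneg_nonpos) auto
      have yfrac: "0 \<le> \<rho> / y" "\<rho> / y \<le> 1" "0 \<le> \<rho> / y\<^sup>2" "\<rho> / y\<^sup>2 \<le> 1"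
      proof -
        have "\<rho> \<le> y\<^sup>2" using \<rho> y self_le_power[of y 2] by simp
        then show "0 \<le> \<rho> / y" "\<rho> / y \<le> 1" "0 \<le> \<rho> / y\<^sup>2" "\<rho> / y\<^sup>2 \<le> 1" using \<rho> y by auto
      qed
      have lapC: "(\<Sum>i\<in>UNIV. h $ i) \<le> C"
      proof -
        let ?c = "K + \<beta> * (\<beta> + 1) + 14 * (\<beta> + 1) * (\<beta> + 2)"
        have c: "?c \<ge> 0" using K \<beta> by simp
        have "F2 L \<le> z * (4 * (X L * H2 (X L)))"
          unfolding F2z using z H1n by (intro mult_left_mono) auto
        also have "\<dots> \<le> z * (4 * ?c)" using H2_bound[OF X0[of L]] z by (intro mult_left_mono) auto
        also have "\<dots> \<le> C0 * (4 * ?c)" using zC0 c by (intro mult_right_mono) auto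
        finally have "4 * (\<rho> / y\<^sup>2) * F2 L \<le> 4 * (\<rho> / y\<^sup>2) * (C0 * (4 * ?c))"
          using yfrac by (intro mult_left_mono) auto
        also have "\<dots> \<le> 4 * 1 * (C0 * (4 * ?c))"
          using yfrac c C0 by (intro mult_right_mono mult_left_mono) auto
        also have "4 * 1 * (C0 * (4 * k)) = 16 * C0 * k" for k by simp
        also note C(3)
        finally have "4 * \<rho> / y\<^sup>2 * F2 L \<le> C" by simp
        moreover have "(4 * p * y + 4 * A) / y\<^sup>2 * F1 L \<le> 0"
          using F1n p y A1 by (intro mult_nonneg_nonpos) auto
        ultimately show ?thesis unfolding lap by linarith
      qed
      have grC: "- (x \<bullet> g) \<le> C * (1 + x \<bullet> x)"
      proof -
        let ?c = "K + \<beta> + 14 * (\<beta> + 1)"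
        have c: "?c \<ge> 0" using K \<beta> by simp
        have "S \<le> S\<^sup>2" using S by (simp add: power2_eq_square)
        then have "S * (- H1 (X L)) \<le> S\<^sup>2 * (- H1 (X L))" using H1n by (intro mult_right_mono) auto
        then have "- F1 L \<le> 2 * z * (S\<^sup>2 * (- H1 (X L)))"
          unfolding F1z using z mult_left_mono[of "S * (- H1 (X L))" "S\<^sup>2 * (- H1 (X L))" "2 * z"] by (simp add: mult_ac)
        also have "\<dots> = 2 * (z * \<tau> s) * (X L * (- H1 (X L)))" unfolding XL using \<tau>s by simp
        also have "\<dots> \<le> 2 * (z * \<tau> s) * ?c"
          using H1_bounds(2)[OF X0[of L]] z \<tau>s by (intro mult_left_mono) auto
        also have "\<dots> \<le> 2 * C0 * ?c"
        proof -
          have "\<tau> s powr (- \<beta>) \<le> 1 powr (- \<beta>)" using \<tau>s \<beta> by (intro powr_mono2') auto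
          then have "z * \<tau> s \<le> C0" unfolding \<tau>z[symmetric] using C0 by simp
          then show ?thesis using c by (intro mult_right_mono) auto
        qed
        finally have "\<rho> / y * (- F1 L) \<le> 1 * (2 * C0 * ?c)"
          using yfrac F1n by (intro mult_mono) auto
        then have "- (x \<bullet> g) \<le> C * 1" unfolding xg using C(4) by simp
        also have "\<dots> \<le> C * (1 + x \<bullet> x)" using C by (intro mult_left_mono) auto
        finally show ?thesis .
      qed
      show "\<exists>a g h. has_jet (\<lambda>x t. F (ln (x \<bullet> x + A)) t) x s a g h \<and>
          1 * (a - pressure_operator D x (F (ln (x \<bullet> x + A)) s) g h) \<ge> 0 \<and>
          (\<Sum>i\<in>UNIV. h $ i) \<le> C \<and> - (x \<bullet> g) \<le> C * (1 + x \<bullet> x)"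
        using jet ineq lapC grC unfolding L_def y_def \<rho>_def by (intro exI conjI) auto
    qed (use t C in auto)
  qed
  show ?thesis
  proof (intro exI[of _ "C0 * (K + 15)"] conjI allI impI)
    show "C0 * (K + 15) > 0" using C0 K by simp
    fix x :: "real ^ 'n" and t :: real assume "0 \<le> t"
    then show "u x t \<le> C0 * (K + 15) * (t + 1) powr (- (\<gamma> / 2))"
      using main[of t x] F_bounds(3)[of t "ln (x \<bullet> x + A)"] by (simp add: \<beta>_def)
  qed
qed

section \<open>Spreading of positivity\<close>

text \<open>The barrier is \<open>E * U ^ 3\<close>. Near the edge of the ball, where
  \<open>U\<close> is small, transport is of order \<open>U\<^sup>2\<close> and loses against
  diffusion, which is of order \<open>U\<close> with a positive factor. In the interior the decay
  rate \<open>l\<close> in time compensates. After division by \<open>3 * E * U\<close> both regimes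
  are covered by one quadratic in \<open>U\<close>, which \<open>l\<close> turns into a perfect
  square.\<close>

lemma moving_ball_inequality:
  fixes U V r w \<sigma> E xz c0 C2 n p D l :: real
  assumes U: "0 < U" and r: "r = 1 / 16 - U" "r \<ge> 0" and E: "0 < E" "E \<le> 1" and \<sigma>: "\<sigma> \<ge> 1"
    and V: "V \<le> v" and w: "c0 * \<sigma>\<^sup>2 \<le> w" "w \<le> W * \<sigma>\<^sup>2" and c0: "c0 > 0"
    and xz: "xz \<ge> - (7 / 4) * \<sigma>\<^sup>2" and n: "n \<ge> 0" and p: "p \<ge> 0"
    and C2: "C2 = 8 * c0 + 2 * n * W + 19 * p + v" and l: "l = 3 * C2\<^sup>2 / (2 * c0)"
  shows "E * (- l * U ^ 3 + 3 * U\<^sup>2 * V) \<le>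
    w * (6 * E * U / \<sigma>\<^sup>2 * (4 * r - n * U)) - 2 * p * (- (6 * E * U\<^sup>2 / \<sigma>\<^sup>2 * xz))
    - p * (36 * E\<^sup>2 * U ^ 4 * r / \<sigma>\<^sup>2)"
proof -
  have U1: "U \<le> 1" using r by linarith
  have \<sigma>2: "\<sigma>\<^sup>2 \<ge> 1" using \<sigma> by simp
  define k where "k = w / \<sigma>\<^sup>2"
  have k: "c0 \<le> k" "k \<le> W" using w \<sigma> by (simp_all add: k_def pos_le_divide_eq pos_divide_le_eq)
  define j where "j = xz / \<sigma>\<^sup>2"
  have j: "j \<ge> - (7 / 4)" using xz \<sigma> by (simp add: j_def pos_le_divide_eq)
  define i where "i = E * U ^ 3 * r / \<sigma>\<^sup>2"
  have i: "i \<le> U"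
  proof -
    have le: "U ^ 3 * r \<le> U * 1"
    proof (rule mult_mono)
      show "U ^ 3 \<le> U" using power_decreasing[of 1 3 U] U U1 by simp
    qed (use r U in auto)
    have "E * (U ^ 3 * r) \<le> 1 * (U * 1)" by (rule mult_mono[OF E(2) le]) (use E U r(2) in simp_all)
    moreover have "U \<le> U * \<sigma>\<^sup>2" using U \<sigma>2 by simp
    ultimately have "E * U ^ 3 * r \<le> U * \<sigma>\<^sup>2" by (simp add: mult.assoc)
    then show ?thesis unfolding i_def using \<sigma> by (simp add: pos_divide_le_eq)
  qed
  \<comment> \<open>The constant \<open>c0 / 2\<close> is the diffusion at the edge, where
    \<open>r = 1 / 16\<close>. \<open>C2\<close> collects what is linear in \<open>U\<close>:
    \<open>8 * c0\<close> from rewriting \<open>r\<close>, \<open>2 * n * W\<close> from the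
    Laplacian, \<open>19 * p = 7 * p + 12 * p\<close> from drift and squared gradient, and the bound
    \<open>v\<close> on the transport term.\<close>
  have "C2\<^sup>2 * U\<^sup>2 / (2 * c0) - C2 * U + c0 / 2 = (C2 * U - c0)\<^sup>2 / (2 * c0)"
    using c0 by (simp add: field_simps power2_eq_square)
  also have "\<dots> \<ge> 0" using c0 by simp
  finally have quad: "0 \<le> l * U\<^sup>2 / 3 - C2 * U + c0 / 2" by (simp add: l)
  have "U * V \<le> U * v" using U V by simp
  moreover have "8 * k * r \<ge> 8 * c0 * r" using k r by (simp add: mult_right_mono)
  moreover have "2 * k * n * U \<le> 2 * W * n * U" using k n U by (simp add: mult_right_mono)
  moreover have "4 * p * U * j \<ge> 4 * p * U * (- (7 / 4))" using j p U by (intro mult_left_mono) auto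
  moreover have "12 * p * i \<le> 12 * p * U" using i p by (simp add: mult_left_mono)
  moreover have "8 * c0 * r = c0 / 2 - 8 * c0 * U" by (simp add: r algebra_simps)
  ultimately have "- l * U\<^sup>2 / 3 + U * V \<le> 2 * k * (4 * r - n * U) + 4 * p * U * j - 12 * p * i"
    using quad unfolding C2 by (simp add: algebra_simps)
  then have "3 * E * U * (- l * U\<^sup>2 / 3 + U * V) \<le> 3 * E * U * (2 * k * (4 * r - n * U) + 4 * p * U * j - 12 * p * i)"
    using E U by (intro mult_left_mono) auto
  also have "\<dots> = w * (6 * E * U / \<sigma>\<^sup>2 * (4 * r - n * U)) - 2 * p * (- (6 * E * U\<^sup>2 / \<sigma>\<^sup>2 * xz))
    - p * (36 * E\<^sup>2 * U ^ 4 * r / \<sigma>\<^sup>2)"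
    unfolding k_def j_def i_def using \<sigma>2
    by (simp add: algebra_simps diff_divide_distrib power2_eq_square power3_eq_cube power4_eq_xxxx)
  also have "3 * E * U * (- l * U\<^sup>2 / 3 + U * V) = E * (- l * U ^ 3 + 3 * U\<^sup>2 * V)"
    by (simp add: algebra_simps power2_eq_square power3_eq_cube)
  finally show ?thesis .
qed

text \<open>At large \<open>|x|\<close>, diffusion of strength \<open>|x|^2\<close> and a drift
  proportional to \<open>x\<close> are invariant under scaling. A ball of size comparable to
  \<open>|y|\<close> can thus travel a comparable distance in a fixed time with a loss independent
  of \<open>y\<close>, and the logarithm of the distance changes only by a bounded factor.\<close>

lemma log_decay_lower_bound_spreads:
  fixes u :: "real ^ 'n \<Rightarrow> real \<Rightarrow> real"
  assumes n: "CARD('n) \<ge> 2" and D: "D > 0" and sol: "pressure_solution D u"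
    and nonneg: "\<And>x t. t \<ge> 0 \<Longrightarrow> u x t \<ge> 0"
    and b: "b > 0" and \<gamma>: "\<gamma> > 0" and t1: "t1 > 0"
    and init: "\<And>x. norm x > 2 \<Longrightarrow> b * ln (norm x) powr (- \<gamma>) \<le> u x 0"
  shows "\<exists>\<kappa>>0. \<forall>x. \<kappa> * ln (x \<bullet> x + exp 1) powr (- \<gamma>) \<le> u x t1"
proof -
  define p where "p = (real CARD('n) - 2) / 2"
  have p: "p \<ge> 0" "real CARD('n) - 2 = 2 * p" using n by (simp_all add: p_def)
  \<comment> \<open>A lower bound for the pressure in units of \<open>\<sigma>\<^sup>2\<close>: if
    \<open>|y| \<ge> 1\<close> then \<open>|x| \<ge> \<sigma> / 4\<close> on the ball, and otherwise
    \<open>\<sigma> \<le> 2\<close> and the term \<open>D\<close> suffices.\<close>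
  define c0 where "c0 = min (1 / 16) (D / 4)"
  have c0: "c0 > 0" "c0 \<le> 1 / 16" "c0 \<le> D / 4" using D by (simp_all add: c0_def)
  define C2 where "C2 = 8 * c0 + 2 * real CARD('n) * (50 + D) + 19 * p + 5 / (2 * t1)"
  define l where "l = 3 * C2\<^sup>2 / (2 * c0)"
  have l: "l \<ge> 0" unfolding l_def using c0 by simp
  define b' where "b' = min 1 b"
  have b': "b' > 0" "b' \<le> 1" "b' \<le> b" using b by (simp_all add: b'_def)
  \<comment> \<open>\<open>4096 = 16 ^ 3\<close> comes from \<open>U = 1 / 16\<close> at the centre
    of the final ball, \<open>4 powr (- \<gamma>)\<close> from
    \<open>ln (7 * \<sigma>) \<le> 4 * ln (y \<bullet> y + exp 1)\<close>.\<close>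
  define \<kappa> where "\<kappa> = b' * 4 powr (- \<gamma>) * exp (- l * t1) / 4096"
  have "\<kappa> * ln (y \<bullet> y + exp 1) powr (- \<gamma>) \<le> u y t1" for y :: "real ^ 'n"
  proof -
    define \<sigma> where "\<sigma> = 1 + norm y"
    have \<sigma>: "\<sigma> \<ge> 1" by (simp add: \<sigma>_def)
    have \<sigma>2: "\<sigma>\<^sup>2 \<ge> 1" using \<sigma> by simp
    obtain e :: "real ^ 'n" where e: "norm e = 1" "y = norm y *\<^sub>R e"
    proof (cases "y = 0")
      case True
      then show ?thesis using that[of "axis undefined 1"] by simp
    next
      case False
      then show ?thesis using that[of "y /\<^sub>R norm y"] by simp
    qed
    \<comment> \<open>A ball of radius \<open>\<sigma>/4\<close> moves from far outside to the point \<open>y\<close>, on the length scale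
      \<open>\<sigma>\<close> on which the equation at \<open>y\<close> has constants independent of \<open>y\<close>.\<close>
    define c where "c t = y + (5 * \<sigma> * (1 - t / t1)) *\<^sub>R e" for t
    have c_eq: "c t = (norm y + 5 * \<sigma> * (1 - t / t1)) *\<^sub>R e" for t
      unfolding c_def by (subst e(2)) (simp add: algebra_simps e(1))
    have c_norm: "norm (c t) = norm y + 5 * \<sigma> * (1 - t / t1)" if "t \<le> t1" for t
      unfolding c_eq using e(1) \<sigma> that t1 by simp
    \<comment> \<open>The starting ball lies within \<open>2 < |x| \<le> 7 * \<sigma>\<close>, so
      \<open>\<delta>\<close> is below the initial datum there; \<open>b' \<le> 1\<close> keeps the
      amplitude at most 1.\<close>
    define \<delta> where "\<delta> = b' * ln (7 * \<sigma>) powr (- \<gamma>)"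
    have "7 * \<sigma> \<ge> exp 1" using exp_le \<sigma> by linarith
    then have "ln (7 * \<sigma>) \<ge> ln (exp 1)" by (intro ln_mono) auto
    then have ln7: "ln (7 * \<sigma>) \<ge> 1" by simp
    have \<delta>: "\<delta> > 0" "\<delta> \<le> 1"
    proof -
      show "\<delta> > 0" unfolding \<delta>_def using b' ln7 by simp
      have "ln (7 * \<sigma>) powr (- \<gamma>) \<le> 1 powr (- \<gamma>)" using ln7 \<gamma> by (intro powr_mono2') auto
      then have "b' * ln (7 * \<sigma>) powr (- \<gamma>) \<le> 1 * 1" using b' by (intro mult_mono) auto
      then show "\<delta> \<le> 1" by (simp add: \<delta>_def)
    qed
    define U where "U x t = 1 / 16 - (x - c t) \<bullet> (x - c t) / \<sigma>\<^sup>2" for x t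
    \<comment> \<open>The odd power makes \<open>f\<close> smooth on the whole space without
      truncation: outside the ball it is nonpositive and hence below \<open>u\<close>.\<close>
    define f where "f x t = \<delta> * exp (- l * t) * U x t ^ 3" for x t
    have Ef: "0 < \<delta> * exp (- l * t)" "\<delta> * exp (- l * t) \<le> 1" if "t \<ge> 0" for t
    proof -
      show "0 < \<delta> * exp (- l * t)" using \<delta> by simp
      have "\<delta> * exp (- l * t) \<le> 1 * 1" using \<delta> l that by (intro mult_mono) auto
      then show "\<delta> * exp (- l * t) \<le> 1" by simp
    qed
    have U_up: "U x t \<le> 1 / 16" for x t using \<sigma>2 by (simp add: U_def)
    have ball: "norm (x - c t) \<le> \<sigma> / 4" if "U x t > 0" for x t
    proof -
      have "(norm (x - c t))\<^sup>2 \<le> (\<sigma> / 4)\<^sup>2"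
        using that \<sigma> unfolding U_def
        by (simp add: power2_norm_eq_inner power_divide pos_divide_less_eq)
      then show ?thesis by (rule power2_le_imp_le) (use \<sigma> in simp)
    qed
    have norm_up: "norm x \<le> 7 * \<sigma>" and norm_low: "norm x \<ge> norm y + 5 * \<sigma> * (1 - t / t1) - \<sigma> / 4"
      if "U x t > 0" "0 \<le> t" "t \<le> t1" for x t
    proof -
      have 1: "norm x \<le> norm (c t) + norm (x - c t)" using norm_triangle_sub[of x "c t"] by simp
      have 2: "norm (c t) \<le> norm x + norm (x - c t)" using norm_triangle_sub[of "c t" x] by (simp add: norm_minus_commute)
      have "5 * \<sigma> * (1 - t / t1) \<le> 5 * \<sigma> * 1" using that t1 \<sigma> by (intro mult_left_mono) auto
      then have "norm (c t) \<le> norm y + 5 * \<sigma>" using c_norm that by simp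
      moreover have "norm y \<le> \<sigma>" by (simp add: \<sigma>_def)
      ultimately show "norm x \<le> 7 * \<sigma>" using 1 ball[OF that(1)] \<sigma> by linarith
      show "norm x \<ge> norm y + 5 * \<sigma> * (1 - t / t1) - \<sigma> / 4"
        using 2 ball[OF that(1)] c_norm[OF that(3)] by linarith
    qed
    have f_up: "f x t \<le> \<delta> * exp (- l * t)" if "U x t > 0" "t \<ge> 0" for x t
    proof -
      have "U x t ^ 3 \<le> 1" using that U_up[of x t] by (intro power_le_one) auto
      then show ?thesis unfolding f_def using mult_left_mono[of "U x t ^ 3" 1] Ef[OF that(2)] by simp
    qed
    define C where "C = D + 24"
    have C: "C \<ge> 24" "C \<ge> D + 1" "C \<ge> 0" using D by (simp_all add: C_def)
    have U_pos: "U x t > 0" if "0 < - 1 * (u x t - f x t)" "t \<ge> 0" for x t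
    proof (rule ccontr)
      assume "\<not> U x t > 0"
      then have "U x t ^ 3 \<le> 0" by (simp add: power3_eq_cube mult_nonneg_nonpos mult_nonpos_nonpos)
      then have "f x t \<le> 0" unfolding f_def using Ef[OF that(2)] by (intro mult_nonneg_nonpos) auto
      then show False using that nonneg[of t x] by simp
    qed
    have "- 1 * (u y t1 - f y t1) \<le> 0"
    proof (rule comparison[where T = t1 and C = C and ?t1.0 = 0, OF _ n sol order_refl])
      show "continuous_on (UNIV \<times> {0..t1}) (\<lambda>(x, t). f x t)"
        unfolding f_def U_def c_def case_prod_beta using \<sigma>2 t1 by (intro continuous_intros) auto
      show "- 1 * (u x 0 - f x 0) \<le> 0" for x
      proof (rule ccontr)
        assume "\<not> ?thesis"
        then have d: "0 < - 1 * (u x 0 - f x 0)" by simp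
        have U: "U x 0 > 0" using U_pos[OF d] by simp
        have x: "norm x \<le> 7 * \<sigma>" "norm x > 2"
        proof -
          show "norm x \<le> 7 * \<sigma>" using norm_up[OF U] t1 by simp
          have "norm x \<ge> norm y + 5 * \<sigma> - \<sigma> / 4" using norm_low[OF U] t1 by simp
          then show "norm x > 2" using \<sigma> norm_ge_zero[of y] by linarith
        qed
        have "ln (7 * \<sigma>) powr (- \<gamma>) \<le> ln (norm x) powr (- \<gamma>)"
          using x \<gamma> by (intro powr_mono2') (auto intro!: ln_mono ln_gt_zero)
        then have "\<delta> \<le> b * ln (norm x) powr (- \<gamma>)"
          unfolding \<delta>_def using b' b by (intro mult_mono) auto
        also have "\<dots> \<le> u x 0" using init x by simp
        finally show False using f_up[OF U] d by simp
      qed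
      fix x :: "real ^ 'n" and s
      assume s: "0 \<le> s" "s \<le> t1" and d: "0 < - 1 * (u x s - f x s)"
      have "f x s \<le> 1" using f_up[OF U_pos[OF d s(1)] s(1)] Ef[OF s(1)] by simp
      moreover have "u x s \<ge> 0" using nonneg s by simp
      moreover have "x \<bullet> x + D + 1 \<le> C * (1 + x \<bullet> x)"
      proof -
        have "x \<bullet> x + D + 1 \<le> (D + 1) * (1 + x \<bullet> x)" using D by (simp add: algebra_simps)
        also have "\<dots> \<le> C * (1 + x \<bullet> x)" using C by (intro mult_right_mono) auto
        finally show ?thesis .
      qed
      moreover have "u x s < f x s" using d by simp
      ultimately have "x \<bullet> x + D + u x s \<le> C * (1 + x \<bullet> x)" "f x s - u x s \<le> C * (1 + x \<bullet> x)"
        using D inner_ge_zero[of x] by linarith+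
      then show "x \<bullet> x + D + u x s \<le> C * (1 + x \<bullet> x) \<and> - 1 * (u x s - f x s) \<le> C * (1 + x \<bullet> x)"
        by simp
    next
      fix x :: "real ^ 'n" and s
      assume s: "0 < s" "s \<le> t1" and d: "0 < - 1 * (u x s - f x s)"
      have s0: "0 \<le> s" using s by simp
      define E where "E = \<delta> * exp (- l * s)"
      \<comment> \<open>The time derivative of \<open>U x\<close>, due to the centre moving with
        speed \<open>5 * \<sigma> / t1\<close>. Inside the ball it is at most
        \<open>5 / (2 * t1)\<close>, whatever \<open>\<sigma>\<close> is.\<close>
      define V where "V = - 10 / (\<sigma> * t1) * (e \<bullet> (x - c s))"
      define z where "z = x - c s"
      define r where "r = z \<bullet> z / \<sigma>\<^sup>2"
      have U: "U x s > 0" using U_pos[OF d s0] .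
      have E: "E > 0" "E \<le> 1" using Ef[OF s0] by (simp_all add: E_def)
      have zball: "norm z \<le> \<sigma> / 4" using ball[OF U] by (simp add: z_def)
      have rU: "r = 1 / 16 - U x s" "r \<ge> 0" using \<sigma>2 by (simp_all add: r_def U_def z_def)
      have xz: "\<bar>x \<bullet> z\<bar> \<le> 7 / 4 * \<sigma>\<^sup>2"
      proof -
        have "\<bar>x \<bullet> z\<bar> \<le> norm x * norm z" by (rule Cauchy_Schwarz_ineq2)
        also have "\<dots> \<le> (7 * \<sigma>) * (\<sigma> / 4)"
          using norm_up[OF U s0 s(2)] zball \<sigma> by (intro mult_mono) auto
        finally show ?thesis by (simp add: power2_eq_square)
      qed
      have Vb: "V \<le> 5 / (2 * t1)"
      proof -
        have "\<bar>e \<bullet> z\<bar> \<le> 1 * (\<sigma> / 4)" using Cauchy_Schwarz_ineq2[of e z] e(1) zball by simp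
        then have "10 / (\<sigma> * t1) * (- (e \<bullet> z)) \<le> 10 / (\<sigma> * t1) * (\<sigma> / 4)"
          using \<sigma> t1 by (intro mult_left_mono) auto
        also have "\<dots> = 5 / (2 * t1)" using \<sigma> t1 by (simp add: field_simps)
        finally show ?thesis by (simp add: V_def z_def)
      qed
      have Ut: "(U x has_real_derivative V) (at s)"
      proof -
        have Ueq: "U x = (\<lambda>t. 1 / 16 - ((x - y) \<bullet> (x - y) - 2 * (5 * \<sigma> * (1 - t / t1)) * (e \<bullet> (x - y))
            + (5 * \<sigma> * (1 - t / t1))\<^sup>2) / \<sigma>\<^sup>2)"
        proof -
          have "e \<bullet> e = 1" using e(1) by (simp add: norm_eq_1)
          then have "(z - k *\<^sub>R e) \<bullet> (z - k *\<^sub>R e) = z \<bullet> z - 2 * k * (e \<bullet> z) + k\<^sup>2" for z k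
            by (simp add: inner_diff_left inner_diff_right inner_commute[of z e] power2_eq_square algebra_simps)
          then show ?thesis unfolding U_def[abs_def] c_def diff_diff_eq[symmetric] by simp
        qed
        have der: "((\<lambda>t. 1 / 16 - ((x - y) \<bullet> (x - y) - 2 * (5 * \<sigma> * (1 - t / t1)) * (e \<bullet> (x - y))
            + (5 * \<sigma> * (1 - t / t1))\<^sup>2) / \<sigma>\<^sup>2) has_real_derivative
            - (- 2 * (5 * \<sigma> * (- (1 / t1))) * (e \<bullet> (x - y))
              + 2 * (5 * \<sigma> * (1 - s / t1)) * (5 * \<sigma> * (- (1 / t1)))) / \<sigma>\<^sup>2) (at s)"
        proof -
          have "((\<lambda>t. 5 * \<sigma> * (1 - t / t1)) has_real_derivative 5 * \<sigma> * (- (1 / t1))) (at s)"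
            using t1 by (auto intro!: derivative_eq_intros)
          from DERIV_add[OF DERIV_diff[OF DERIV_const DERIV_cmult_right[OF DERIV_cmult[OF this, of 2], of "e \<bullet> (x - y)"]]
              DERIV_power[OF this, of 2]]
          have "((\<lambda>t. (x - y) \<bullet> (x - y) - 2 * (5 * \<sigma> * (1 - t / t1)) * (e \<bullet> (x - y))
            + (5 * \<sigma> * (1 - t / t1))\<^sup>2) has_real_derivative
            (- 2 * (5 * \<sigma> * (- (1 / t1))) * (e \<bullet> (x - y))
              + 2 * (5 * \<sigma> * (1 - s / t1)) * (5 * \<sigma> * (- (1 / t1))))) (at s)"
            by (simp add: mult_ac)
          from DERIV_diff[OF DERIV_const DERIV_cdivide[OF this, of "\<sigma>\<^sup>2"], of "1 / 16"]
          show ?thesis by (simp only: diff_0 minus_divide_left)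
        qed
        have Veq: "- (- 2 * (5 * \<sigma> * (- (1 / t1))) * (e \<bullet> (x - y))
              + 2 * (5 * \<sigma> * (1 - s / t1)) * (5 * \<sigma> * (- (1 / t1)))) / \<sigma>\<^sup>2 = V"
        proof -
          have ec: "e \<bullet> (x - c s) = e \<bullet> (x - y) - 5 * \<sigma> * (1 - s / t1)"
            using e(1) by (simp add: c_def inner_diff_right inner_add_right norm_eq_1)
          show ?thesis unfolding V_def ec using \<sigma> t1 by (simp add: field_simps power2_eq_square)
        qed
        show ?thesis unfolding Ueq by (rule DERIV_cong[OF der Veq])
      qed
      define a where "a = E * (- l * U x s ^ 3 + 3 * (U x s)\<^sup>2 * V)"
      have ft: "(f x has_real_derivative a) (at s)"
        unfolding f_def[abs_def]
        by (rule derivative_eq_intros Ut refl)+ (simp add: a_def E_def algebra_simps)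
      define G where "G r = E * (1 / 16 - r / \<sigma>\<^sup>2) ^ 3" for r
      define G1 where "G1 r = - (3 * E / \<sigma>\<^sup>2) * (1 / 16 - r / \<sigma>\<^sup>2)\<^sup>2" for r
      define G2 where "G2 = 6 * E / \<sigma> ^ 4 * U x s"
      have dG: "(G has_real_derivative G1 r) (at r)" for r
        unfolding G_def[abs_def] G1_def using \<sigma>2
        by (auto intro!: derivative_eq_intros simp: power2_eq_square)
      have dG1: "(G1 has_real_derivative G2) (at (z \<bullet> z))"
        unfolding G1_def[abs_def] G2_def using \<sigma>2
        by (auto intro!: derivative_eq_intros simp: U_def z_def power2_eq_square power4_eq_xxxx mult_ac)
      have jet: "has_jet f x s a ((2 * G1 (z \<bullet> z)) *\<^sub>R z) (\<chi> i. 4 * G2 * (z $ i)\<^sup>2 + 2 * G1 (z \<bullet> z))"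
        unfolding z_def
        by (rule has_jet_radial[where f = f and x = x and c = "c s" and G = G, OF ft _ dG dG1[unfolded z_def]])
           (simp add: f_def G_def U_def E_def)
      define h :: "real ^ 'n" where "h = (\<chi> i. 4 * G2 * (z $ i)\<^sup>2 + 2 * G1 (z \<bullet> z))"
      define g where "g = (2 * G1 (z \<bullet> z)) *\<^sub>R z"
      have G1z: "G1 (z \<bullet> z) = - (3 * E / \<sigma>\<^sup>2) * (U x s)\<^sup>2"
        by (simp add: G1_def U_def z_def)
      have \<sigma>n: "\<sigma> \<noteq> 0" using \<sigma> by simp
      have zz: "z \<bullet> z = r * \<sigma>\<^sup>2" using \<sigma> by (simp add: r_def)
      have hs: "(\<Sum>i\<in>UNIV. h $ i) = 6 * E * U x s / \<sigma>\<^sup>2 * (4 * r - real CARD('n) * U x s)"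
      proof -
        have "(\<Sum>i\<in>UNIV. h $ i) = 4 * G2 * (r * \<sigma>\<^sup>2) + 2 * real CARD('n) * G1 (z \<bullet> z)"
          unfolding h_def sum_radial_hessian zz[symmetric] ..
        then show ?thesis unfolding G1z G2_def using \<sigma>n
          by (simp add: field_simps power2_eq_square power4_eq_xxxx)
      qed
      have xg: "x \<bullet> g = - (6 * E * (U x s)\<^sup>2 / \<sigma>\<^sup>2 * (x \<bullet> z))"
        unfolding g_def G1z by simp
      have gg: "g \<bullet> g = 36 * E\<^sup>2 * U x s ^ 4 * r / \<sigma>\<^sup>2"
      proof -
        have "g \<bullet> g = (2 * (- (3 * E / \<sigma>\<^sup>2) * (U x s)\<^sup>2))\<^sup>2 * (r * \<sigma>\<^sup>2)"
          unfolding g_def G1z zz[symmetric] by (simp add: power2_eq_square)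
        then show ?thesis using \<sigma>n by (simp add: field_simps power2_eq_square power4_eq_xxxx)
      qed
      have f1: "f x s \<ge> 0" "f x s \<le> 1"
              proof -
        show "f x s \<ge> 0" unfolding f_def using U \<delta> by simp
        show "f x s \<le> 1" using f_up[OF U s0] Ef[OF s0] by linarith
      qed
      have w_low: "c0 * \<sigma>\<^sup>2 \<le> x \<bullet> x + D + f x s"
      proof (cases "norm y \<ge> 1")
        case True
        have "0 \<le> 5 * \<sigma> * (1 - s / t1)" using \<sigma> s t1 by simp
        then have "norm x \<ge> norm y - \<sigma> / 4" using norm_low[OF U s0 s(2)] by linarith
        moreover have "2 * norm y \<ge> \<sigma>" using True by (simp add: \<sigma>_def)
        ultimately have "norm x \<ge> \<sigma> / 4" by linarith
        then have "(\<sigma> / 4)\<^sup>2 \<le> (norm x)\<^sup>2" using \<sigma> by (intro power_mono) auto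
        then have "1 / 16 * \<sigma>\<^sup>2 \<le> x \<bullet> x" by (simp add: power2_norm_eq_inner power_divide)
        moreover have "c0 * \<sigma>\<^sup>2 \<le> 1 / 16 * \<sigma>\<^sup>2" using c0 by (intro mult_right_mono) auto
        ultimately show ?thesis using D f1 by linarith
      next
        case False
        then have "\<sigma>\<^sup>2 \<le> 2\<^sup>2" using \<sigma> by (intro power_mono) (auto simp: \<sigma>_def)
        then have "c0 * \<sigma>\<^sup>2 \<le> D / 4 * 4" using c0 D by (intro mult_mono) auto
        then show ?thesis using f1 inner_ge_zero[of x] by linarith
      qed
      have w_up: "x \<bullet> x + D + f x s \<le> (50 + D) * \<sigma>\<^sup>2"
      proof -
        have "(norm x)\<^sup>2 \<le> (7 * \<sigma>)\<^sup>2" using norm_up[OF U s0 s(2)] by (intro power_mono) auto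
        then have "x \<bullet> x \<le> 49 * \<sigma>\<^sup>2" by (simp add: power2_norm_eq_inner power_mult_distrib)
        moreover have "(D + 1) * 1 \<le> (D + 1) * \<sigma>\<^sup>2" using D \<sigma>2 by (intro mult_left_mono) auto
        ultimately show ?thesis using f1 by (simp add: algebra_simps)
      qed
      have ineq: "a \<le> pressure_operator D x (f x s) g h"
        unfolding pressure_operator_def hs xg gg a_def p(2)
        using moving_ball_inequality[OF U rU E \<sigma> Vb w_low w_up c0(1), of "x \<bullet> z" "real CARD('n)" p C2 l]
          xz p(1) by (simp add: C2_def l_def)
      have small: "E * U x s * r \<le> 1 \<and> E * (U x s)\<^sup>2 \<le> 1"
      proof -
        have "E * U x s \<le> 1 * 1" using E U U_up[of x s] by (intro mult_mono) auto
        then have 1: "E * U x s \<le> 1" by simp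
        have "E * U x s * r \<le> 1 * 1" using 1 rU U E by (intro mult_mono) auto
        moreover have "E * U x s * U x s \<le> 1 * 1" using 1 U E U_up[of x s] by (intro mult_mono) auto
        ultimately show ?thesis by (simp add: power2_eq_square mult_ac)
      qed
      have lapC: "(\<Sum>i\<in>UNIV. h $ i) \<le> C"
      proof -
        have "(\<Sum>i\<in>UNIV. h $ i) \<le> 24 * (E * U x s * r) / \<sigma>\<^sup>2"
        proof -
          have "6 * E * U x s / \<sigma>\<^sup>2 * (4 * r - real CARD('n) * U x s) \<le> 6 * E * U x s / \<sigma>\<^sup>2 * (4 * r)"
            using E U by (intro mult_left_mono) auto
          then show ?thesis unfolding hs by (simp add: mult_ac)
        qed
        also have "\<dots> \<le> 24 * 1 / 1" using small E U rU \<sigma>2 by (intro frac_le) auto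
        finally show ?thesis using C by simp
      qed
      have grC: "- (x \<bullet> g) \<le> C * (1 + x \<bullet> x)"
      proof -
        have "E * (U x s)\<^sup>2 * ((x \<bullet> z) / \<sigma>\<^sup>2) \<le> 1 * (7 / 4)"
        proof -
          have "x \<bullet> z / \<sigma>\<^sup>2 \<le> 7 / 4" using xz \<sigma> by (simp add: pos_divide_le_eq)
          then have "E * (U x s)\<^sup>2 * ((x \<bullet> z) / \<sigma>\<^sup>2) \<le> E * (U x s)\<^sup>2 * (7 / 4)"
            using E by (intro mult_left_mono) auto
          then show ?thesis using small by linarith
        qed
        then have "- (x \<bullet> g) \<le> 24 * 1" unfolding xg by simp
        also have "\<dots> \<le> C * (1 + x \<bullet> x)" using C by (intro mult_mono) auto
        finally show ?thesis .
      qed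
      show "\<exists>a g h. has_jet f x s a g h \<and> - 1 * (a - pressure_operator D x (f x s) g h) \<ge> 0 \<and>
          (\<Sum>i\<in>UNIV. h $ i) \<le> C \<and> - (x \<bullet> g) \<le> C * (1 + x \<bullet> x)"
        using jet[folded g_def h_def] ineq lapC grC by (intro exI conjI) auto
    qed (use t1 C in auto)
    then have "\<delta> * exp (- l * t1) / 4096 \<le> u y t1"
      using t1 by (simp add: f_def U_def c_def power3_eq_cube)
    moreover have "b' * (4 powr (- \<gamma>) * ln (y \<bullet> y + exp 1) powr (- \<gamma>)) \<le> \<delta>"
    proof -
      define L where "L = ln (y \<bullet> y + exp 1)"
      have "L \<ge> ln (exp 1)" unfolding L_def by (intro ln_mono) (auto simp: add_nonneg_pos)
      then have L: "L \<ge> 1" by simp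
      have "norm y \<le> y \<bullet> y + 1"
      proof -
        have "0 \<le> (norm y - 1)\<^sup>2" by simp
        then have "2 * norm y \<le> y \<bullet> y + 1" by (simp add: power2_diff power2_norm_eq_inner)
        then show ?thesis using norm_ge_zero[of y] by linarith
      qed
      moreover have "(2::real) \<le> exp 1" using exp_ge_add_one_self[of "1::real"] by simp
      ultimately have "\<sigma> \<le> y \<bullet> y + exp 1" unfolding \<sigma>_def by linarith
      then have "7 * \<sigma> \<le> 7 * (y \<bullet> y + exp 1)" by (intro mult_left_mono) auto
      also have "\<dots> \<le> exp 3 * (y \<bullet> y + exp 1)"
      proof (rule mult_right_mono)
        have "(exp 1 :: real) ^ 3 \<ge> 2 ^ 3" using \<open>(2::real) \<le> exp 1\<close> by (intro power_mono) auto
        moreover have "(exp 1 :: real) ^ 3 = exp 3" by (simp flip: exp_of_nat_mult)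
        ultimately show "(7::real) \<le> exp 3" by simp
      qed (simp add: add_nonneg_nonneg)
      finally have "ln (7 * \<sigma>) \<le> ln (exp 3 * (y \<bullet> y + exp 1))" using \<sigma> by (intro ln_mono) auto
      also have "\<dots> = 3 + L" unfolding L_def by (subst ln_mult_pos) (auto simp: add_nonneg_pos)
      also have "\<dots> \<le> 4 * L" using L by simp
      finally have "(4 * L) powr (- \<gamma>) \<le> ln (7 * \<sigma>) powr (- \<gamma>)"
        using ln7 \<gamma> by (intro powr_mono2') auto
      then show ?thesis unfolding \<delta>_def L_def[symmetric] using b' L by (simp add: powr_mult)
    qed
    then have "b' * (4 powr (- \<gamma>) * ln (y \<bullet> y + exp 1) powr (- \<gamma>)) * (exp (- l * t1) / 4096) \<le> \<delta> * (exp (- l * t1) / 4096)"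
      by (intro mult_right_mono) auto
    moreover have "\<kappa> * ln (y \<bullet> y + exp 1) powr (- \<gamma>)
        = b' * (4 powr (- \<gamma>) * ln (y \<bullet> y + exp 1) powr (- \<gamma>)) * (exp (- l * t1) / 4096)"
      by (simp add: \<kappa>_def)
    moreover have "\<delta> * exp (- l * t1) / 4096 = \<delta> * (exp (- l * t1) / 4096)" by simp
    ultimately show ?thesis by (simp only:)
  qed
  moreover have "\<kappa> > 0" unfolding \<kappa>_def using b' by simp
  ultimately show ?thesis by blast
qed

section \<open>Convergence rates\<close>

lemma powr_neg_add_lower:
  fixes y s p :: real
  assumes "y > 0" "s \<ge> 0" "p \<ge> 0"
  shows "y powr (- p) * (1 - p * s / y) \<le> (y + s) powr (- p)"
proof -
  have "ln (1 + s / y) \<le> s / y" using assms ln_add_one_self_le_self[of "s / y"] by simp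
  then have "p * ln (1 + s / y) \<le> p * (s / y)" using assms by (intro mult_left_mono)
  then have "1 - p * s / y \<le> 1 + (- p * ln (1 + s / y))" by simp
  also have "\<dots> \<le> exp (- p * ln (1 + s / y))" by (rule exp_ge_add_one_self)
  also have "\<dots> = (1 + s / y) powr (- p)"
  proof -
    have "1 + s / y \<noteq> 0" using assms by (simp add: add_nonneg_eq_0_iff)
    then show ?thesis by (simp add: powr_def)
  qed
  finally have "y powr (- p) * (1 - p * s / y) \<le> y powr (- p) * (1 + s / y) powr (- p)"
    by (intro mult_left_mono) auto
  also have "\<dots> = (y + s) powr (- p)"
  proof -
    have "y * (1 + s / y) = y + s" using assms by (simp add: field_simps)
    then show ?thesis using powr_mult[of y "1 + s / y" "- p"] by simp
  qed
  finally show ?thesis .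
qed

text \<open>Mean value theorem: the slope at the far end \<open>D + S\<close> is the least steep, so
  one coefficient serves all \<open>s \<le> S\<close>.\<close>

lemma powr_neg_add_upper:
  fixes D s S p :: real
  assumes "D > 0" "0 \<le> s" "s \<le> S" "p > 0"
  shows "(D + s) powr (- p) \<le> D powr (- p) - p * (D + S) powr (- p - 1) * s"
proof (cases "s = 0")
  case False
  have "((\<lambda>r. r powr (- p)) has_real_derivative (- p) * r powr (- p - 1)) (at r)" if "D \<le> r" for r
    using that assms by (intro has_real_derivative_powr) simp
  then obtain r where r: "D < r" "r < D + s"
      "(D + s) powr (- p) - D powr (- p) = (D + s - D) * ((- p) * r powr (- p - 1))"
    using MVT2[of D "D + s" "\<lambda>r. r powr (- p)" "\<lambda>r. (- p) * r powr (- p - 1)"] assms False by force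
  have "(D + S) powr (- p - 1) \<le> r powr (- p - 1)" using r assms by (intro powr_mono2') auto
  then have "s * p * (D + S) powr (- p - 1) \<le> s * p * r powr (- p - 1)"
    using assms by (intro mult_left_mono) auto
  then show ?thesis using r(3) by (simp add: algebra_simps)
qed (use assms in simp)

text \<open>For \<open>|x| > 2\<close> one has \<open>|x|^2 + exp 1 \<le> |x|^4\<close>; the
  resulting factor 4 between the logarithms enters as
  \<open>4 powr \<gamma> \<le> 4\<close>.\<close>

lemma ln_norm_powr_le:
  fixes x :: "'a::real_inner"
  assumes x: "norm x > 2" and \<gamma>: "0 < \<gamma>" "\<gamma> < 1"
  shows "ln (norm x) powr (- \<gamma>) \<le> 4 * ln (x \<bullet> x + exp 1) powr (- \<gamma>)"
proof -
  have n2: "(norm x)\<^sup>2 \<ge> 4" using power_mono[of 2 "norm x" 2] x by simp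
  have "x \<bullet> x + exp 1 \<le> (norm x)\<^sup>2 + 3 * (norm x)\<^sup>2"
    using exp_le n2 by (simp add: power2_norm_eq_inner)
  also have "\<dots> \<le> (norm x)\<^sup>2 * (norm x)\<^sup>2"
    using mult_right_mono[OF n2 zero_le_power2[of "norm x"]] by linarith
  also have "\<dots> = norm x ^ 4" by (simp add: power2_eq_square power4_eq_xxxx)
  finally have "ln (x \<bullet> x + exp 1) \<le> ln (norm x ^ 4)" by (intro ln_mono) (auto simp: add_nonneg_pos)
  also have "\<dots> = 4 * ln (norm x)" using x by (simp add: ln_realpow)
  finally have le: "ln (x \<bullet> x + exp 1) \<le> 4 * ln (norm x)" .
  have "ln (x \<bullet> x + exp 1) \<ge> ln (exp 1)" by (intro ln_mono) (auto simp: add_nonneg_pos)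
  then have "(4 * ln (norm x)) powr (- \<gamma>) \<le> ln (x \<bullet> x + exp 1) powr (- \<gamma>)"
    using le \<gamma> by (intro powr_mono2') auto
  moreover have "ln (norm x) powr (- \<gamma>) = 4 powr \<gamma> * (4 * ln (norm x)) powr (- \<gamma>)"
    using x by (simp add: powr_mult powr_minus field_simps)
  moreover have "4 powr \<gamma> * (4 * ln (norm x)) powr (- \<gamma>) \<le> 4 powr 1 * (4 * ln (norm x)) powr (- \<gamma>)"
    using \<gamma> by (intro mult_right_mono powr_mono) auto
  ultimately show ?thesis by simp
qed

text \<open>The estimate at the origin distinguishes two cases. If \<open>\<psi>0 0 = 0\<close>,
  then \<open>v 0 0\<close> equals the Barenblatt value, and by continuity at \<open>t = 0\<close>
  no \<open>c > 0\<close> can serve all \<open>t > 0\<close>. The bound is then stated on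
  \<open>t \<ge> t0\<close> for every \<open>t0 > 0\<close>.\<close>

theorem theorem1p1:
  fixes n :: nat and m \<mu> D :: real
    and \<psi>0 :: "real ^ 'n \<Rightarrow> real"
    and v :: "real ^ 'n \<Rightarrow> real \<Rightarrow> real"
  assumes dim: "n = CARD('n)" and n: "n > 2"
    and m: "m = (real n - 4) / (real n - 2)"
    and mu: "\<mu> = 2 / (1 - m)"
    and D: "D > 0"
    and psi_cont: "continuous_on UNIV \<psi>0"
    and psi_nonneg: "\<forall>x. \<psi>0 x \<ge> 0"
    and psi_nonzero: "\<exists>x. \<psi>0 x \<noteq> 0"
    and sol: "cauchy_solution m \<mu>
                (\<lambda>x. ((norm x)\<^sup>2 + D + \<psi>0 x) powr (- ((real n - 2) / 2))) v"
  shows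
    "(\<forall>B \<gamma>. B > 0 \<and> 0 < \<gamma> \<and> \<gamma> < 1 \<and>
        (\<forall>x. norm x > 2 \<longrightarrow> \<psi>0 x \<le> B * ln (norm x) powr (- \<gamma>)) \<longrightarrow>
        (\<exists>C>0. \<forall>x. \<forall>t\<ge>0.
           barenblatt m D x *
             (1 - C * barenblatt m D x powr (2 / (real n - 2)) * (t + 1) powr (- (\<gamma> / 2)))
             \<le> v x t
           \<and> v x t \<le> barenblatt m D x)) \<and>
     (\<forall>b \<gamma>. b > 0 \<and> 0 < \<gamma> \<and> \<gamma> < 1 \<and>
        (\<forall>x. norm x > 2 \<longrightarrow> \<psi>0 x \<ge> b * ln (norm x) powr (- \<gamma>)) \<longrightarrow>
        (\<psi>0 0 > 0 \<longrightarrow>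
           (\<exists>c>0. \<forall>t>0. v 0 t \<le> barenblatt m D 0 - c * (t + 1) powr (- (\<gamma> / 2)))) \<and>
        (\<forall>t0>0. \<exists>c>0. \<forall>t\<ge>t0.
           v 0 t \<le> barenblatt m D 0 - c * (t + 1) powr (- (\<gamma> / 2))))"
proof -
  define p where "p = (real CARD('n) - 2) / 2"
  have p: "p > 0" and np: "(real n - 2) / 2 = p" "2 / (real n - 2) = 1 / p"
    using n dim by (simp_all add: p_def)
  have mp: "m = 1 - 1 / p" and mup: "\<mu> = 2 * p"
  proof -
    show "m = 1 - 1 / p" using n unfolding m p_def dim by (simp add: field_simps)
    then show "\<mu> = 2 * p" unfolding mu by simp
  qed
  have bar: "barenblatt m d x = (x \<bullet> x + d) powr (- p)" for d and x :: "real ^ 'n"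
    by (simp add: barenblatt_def mp power2_norm_eq_inner add.commute)
  define v0 where "v0 x = (x \<bullet> x + D + \<psi>0 x) powr (- p)" for x
  have sol': "cauchy_solution (1 - 1 / p) (2 * p) v0 v"
    using sol unfolding np mp[symmetric] mup[symmetric] v0_def[abs_def] power2_norm_eq_inner .
  then have classical: "positive_classical_solution (1 - 1 / p) (2 * p) v0 v"
    by (simp add: cauchy_solution_def)
  define u where "u x t = v x t powr (- (1 / p)) - x \<bullet> x - D" for x t
  have psol: "pressure_solution D u"
    unfolding u_def[abs_def] by (rule pressure_solution_of_classical[OF _ p_def classical]) (use n dim in simp)
  have vpos: "v x t > 0" if "t \<ge> 0" for x t
    using classical that by (simp add: positive_classical_solution_def)
  have v_eq: "v x t = (x \<bullet> x + D + u x t) powr (- p)" if "t \<ge> 0" for x t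
    using vpos[OF that, of x] p by (simp add: u_def powr_powr)
  have y0: "x \<bullet> x + D > 0" for x :: "real ^ 'n" using D by (simp add: add_nonneg_pos)
  have u0: "u x 0 = \<psi>0 x" for x
  proof -
    have "v x 0 = v0 x" using classical by (simp add: positive_classical_solution_def)
    moreover have "x \<bullet> x + D + \<psi>0 x > 0" using y0[of x] psi_nonneg by (simp add: add_pos_nonneg)
    ultimately show ?thesis using p by (simp add: u_def v0_def powr_powr)
  qed
  have card: "CARD('n) \<ge> 2" "CARD('n) \<ge> 3" using n dim by simp_all
  have nonneg: "u x t \<ge> 0" if "t \<ge> 0" for x t
    by (rule pressure_nonneg[OF card(1) psol _ that D]) (simp add: u0 psi_nonneg)
  have upper: "v x t \<le> (x \<bullet> x + D + s) powr (- p)" if "t \<ge> 0" "0 \<le> s" "s \<le> u x t" for x t s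
    unfolding v_eq[OF that(1)] using y0[of x] that p by (intro powr_mono2') auto
  have part1: "\<exists>C>0. \<forall>x. \<forall>t\<ge>0.
           barenblatt m D x *
             (1 - C * barenblatt m D x powr (2 / (real n - 2)) * (t + 1) powr (- (\<gamma> / 2)))
             \<le> v x t
           \<and> v x t \<le> barenblatt m D x"
    if B: "B > 0" and \<gamma>: "0 < \<gamma>" "\<gamma> < 1"
      and le: "\<And>x. norm x > 2 \<Longrightarrow> \<psi>0 x \<le> B * ln (norm x) powr (- \<gamma>)" for B \<gamma>
  proof -
    have "compact (\<psi>0 ` cball 0 2)"
      using psi_cont by (intro compact_continuous_image compact_cball) (rule continuous_on_subset, auto)
    then obtain S where S: "\<And>x. norm x \<le> 2 \<Longrightarrow> \<psi>0 x \<le> S"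
      by (metis bounded_has_Sup(1) compact_imp_bounded empty_iff image_eqI mem_cball_0)
    \<comment> \<open>\<open>4 * B\<close> comes from \<open>ln_norm_powr_le\<close>;
      \<open>8 * \<bar>S\<bar>\<close> covers \<open>|x| \<le> 2\<close>, where the shifted
      logarithm is at most 8.\<close>
    define B' where "B' = 4 * B + 8 * \<bar>S\<bar>"
    have B': "B' > 0" "B' \<ge> 4 * B" "B' \<ge> 8 * \<bar>S\<bar>" using B by (simp_all add: B'_def)
    have l1: "ln (x \<bullet> x + exp 1) \<ge> 1" for x :: "real ^ 'n"
    proof -
      have "ln (x \<bullet> x + exp 1) \<ge> ln (exp 1)" by (intro ln_mono) (auto simp: add_nonneg_pos)
      then show ?thesis by simp
    qed
    have init: "u x 0 \<le> B' * ln (x \<bullet> x + exp 1) powr (- \<gamma>)" for x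
    proof (cases "norm x > 2")
      case True
      have "\<psi>0 x \<le> B * (4 * ln (x \<bullet> x + exp 1) powr (- \<gamma>))"
        using le[OF True] ln_norm_powr_le[OF True \<gamma>] B by (meson mult_left_mono less_imp_le order_trans)
      also have "\<dots> \<le> B' * ln (x \<bullet> x + exp 1) powr (- \<gamma>)"
        using mult_right_mono[OF B'(2), of "ln (x \<bullet> x + exp 1) powr (- \<gamma>)"] by simp
      finally show ?thesis by (simp add: u0)
    next
      case False
      have "x \<bullet> x \<le> 4" using power_mono[of "norm x" 2 2] False by (simp add: power2_norm_eq_inner)
      then have "ln (x \<bullet> x + exp 1) \<le> x \<bullet> x + exp 1 - 1"
        by (intro ln_le_minus_one) (simp add: add_nonneg_pos)
      also have "\<dots> \<le> 8" using \<open>x \<bullet> x \<le> 4\<close> exp_le by simp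
      finally have "8 powr (- \<gamma>) \<le> ln (x \<bullet> x + exp 1) powr (- \<gamma>)"
        using l1[of x] \<gamma> by (intro powr_mono2') auto
      moreover have "(8::real) powr (- 1) \<le> 8 powr (- \<gamma>)" using \<gamma> by (intro powr_mono) auto
      ultimately have l8: "1 / 8 \<le> ln (x \<bullet> x + exp 1) powr (- \<gamma>)" by (simp add: powr_minus)
      have "\<psi>0 x \<le> \<bar>S\<bar>" using S[of x] False by simp
      also have "\<dots> \<le> B' * (1 / 8)" using B' by simp
      also have "\<dots> \<le> B' * ln (x \<bullet> x + exp 1) powr (- \<gamma>)" using l8 B' by (intro mult_left_mono) auto
      finally show ?thesis by (simp add: u0)
    qed
    \<comment> \<open>The data lie above \<open>W powr (- p)\<close> times the profile with
      parameter 1. This activates the second clause of \<open>cauchy_solution\<close>, and the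
      resulting lower bound on \<open>v\<close> is the upper bound on the pressure needed for
      \<open>growth\<close>.\<close>
    define W where "W = 1 + D + B'"
    have W: "W > 0" using D B' by (simp add: W_def)
    have "W powr (- p) * barenblatt (1 - 1 / p) 1 x \<le> v0 x" for x
    proof -
      have "ln (x \<bullet> x + exp 1) powr (- \<gamma>) \<le> 1 powr (- \<gamma>)" using l1[of x] \<gamma> by (intro powr_mono2') auto
      then have "B' * ln (x \<bullet> x + exp 1) powr (- \<gamma>) \<le> B' * 1" using B' by (intro mult_left_mono) auto
      then have "\<psi>0 x \<le> B'" using init[of x] u0[of x] by simp
      moreover have "0 \<le> (D + B') * (x \<bullet> x)" using D B' by simp
      ultimately have "x \<bullet> x + D + \<psi>0 x \<le> W * (x \<bullet> x + 1)" unfolding W_def by (simp add: algebra_simps)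
      moreover have "x \<bullet> x + D + \<psi>0 x > 0" using y0[of x] psi_nonneg by (simp add: add_pos_nonneg)
      ultimately have "(W * (x \<bullet> x + 1)) powr (- p) \<le> v0 x"
        unfolding v0_def using p by (intro powr_mono2') auto
      then show ?thesis using W bar[of 1 x] mp by (simp add: powr_mult)
    qed
    moreover have "W powr (- p) > 0" using W by simp
    ultimately have low: "\<exists>c>0. \<forall>x. \<forall>t\<in>{0..T}. c * barenblatt (1 - 1 / p) 1 x \<le> v x t" if "T \<ge> 0" for T
      using sol' that unfolding cauchy_solution_def by blast
    have growth: "\<exists>C. \<forall>x. \<forall>t\<in>{0..T}. x \<bullet> x + D + u x t \<le> C * (1 + x \<bullet> x)" if T: "T \<ge> 0" for T
    proof -
      obtain c where c: "c > 0" "\<And>x t. t \<in> {0..T} \<Longrightarrow> c * (x \<bullet> x + 1) powr (- p) \<le> v x t"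
        using low[OF T] bar[of 1] mp by metis
      have "x \<bullet> x + D + u x t \<le> c powr (- (1 / p)) * (1 + x \<bullet> x)" if "t \<in> {0..T}" for x t
      proof -
        have x1: "x \<bullet> x + 1 > 0" by (simp add: add_nonneg_pos)
        have "x \<bullet> x + D + u x t = v x t powr (- (1 / p))" by (simp add: u_def)
        also have "\<dots> \<le> (c * (x \<bullet> x + 1) powr (- p)) powr (- (1 / p))"
          using c(1) c(2)[OF that, of x] p x1 by (intro powr_mono2') auto
        also have "\<dots> = c powr (- (1 / p)) * (1 + x \<bullet> x)"
          using c(1) x1 p by (simp add: powr_mult powr_powr add.commute)
        finally show ?thesis .
      qed
      then show ?thesis by blast
    qed
    obtain C0 where C0: "C0 > 0" "\<And>x t. t \<ge> 0 \<Longrightarrow> u x t \<le> C0 * (t + 1) powr (- (\<gamma> / 2))"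
      using log_decay_upper_bound[OF card(2) D psol nonneg B'(1) \<gamma> init growth] by blast
    show ?thesis
    \<comment> \<open>To first order the relative error of the density is
      \<open>p * u x t / y\<close>, and \<open>1 / y\<close> is exactly the power
      \<open>2 / (n - 2)\<close> of the profile.\<close>
    proof (intro exI[of _ "p * C0"] conjI allI impI)
      show "p * C0 > 0" using p C0 by simp
      fix x :: "real ^ 'n" and t :: real assume t: "0 \<le> t"
      define y where "y = x \<bullet> x + D"
      have y: "y > 0" using y0 by (simp add: y_def)
      have barx: "barenblatt m D x = y powr (- p)" by (simp add: bar y_def)
      have "y powr (- p) * (1 - p * C0 * (1 / y) * (t + 1) powr (- (\<gamma> / 2))) \<le> y powr (- p) * (1 - p * u x t / y)"
      proof (rule mult_left_mono)
        have "p * u x t / y \<le> p * (C0 * (t + 1) powr (- (\<gamma> / 2))) / y"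
          using C0(2)[OF t, of x] p y by (intro divide_right_mono mult_left_mono) auto
        then show "1 - p * C0 * (1 / y) * (t + 1) powr (- (\<gamma> / 2)) \<le> 1 - p * u x t / y" by simp
      qed simp
      also have "\<dots> \<le> v x t"
        unfolding v_eq[OF t] y_def[symmetric] using y nonneg[OF t, of x] p by (intro powr_neg_add_lower) auto
      finally have low_y: "y powr (- p) * (1 - p * C0 * (1 / y) * (t + 1) powr (- (\<gamma> / 2))) \<le> v x t" .
      show "barenblatt m D x *
          (1 - p * C0 * barenblatt m D x powr (2 / (real n - 2)) * (t + 1) powr (- (\<gamma> / 2))) \<le> v x t"
      proof -
        have "(y powr (- p)) powr (1 / p) = y powr (- p * (1 / p))" by (rule powr_powr)
        also have "\<dots> = 1 / y" using y p by (simp add: powr_minus_divide)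
        finally have "(y powr (- p)) powr (1 / p) = 1 / y" .
        then show ?thesis using low_y by (simp only: barx np)
      qed
      show "v x t \<le> barenblatt m D x"
        using upper[OF t order_refl nonneg[OF t]] by (simp add: bar)
    qed
  qed
  have part2: "\<exists>c>0. \<forall>t\<ge>t0. v 0 t \<le> D powr (- p) - c * (t + 1) powr (- (\<gamma> / 2))"
    if b: "b > 0" and \<gamma>: "0 < \<gamma>" and t0: "t0 > 0"
      and ge: "\<And>x. norm x > 2 \<Longrightarrow> \<psi>0 x \<ge> b * ln (norm x) powr (- \<gamma>)" for b \<gamma> t0
  proof -
    \<comment> \<open>Positivity has spread by time \<open>t0\<close>, which then serves as the
      initial time of the logarithmic barrier.\<close>
    obtain \<kappa> where \<kappa>: "\<kappa> > 0" "\<And>x. \<kappa> * ln (x \<bullet> x + exp 1) powr (- \<gamma>) \<le> u x t0"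
      using log_decay_lower_bound_spreads[OF card(1) D psol nonneg b \<gamma> t0] ge u0 by metis
    obtain k where k: "k > 0" "\<And>x t. t \<ge> t0 \<Longrightarrow>
        \<kappa> * ((ln (x \<bullet> x + exp 1))\<^sup>2 + k * (t - t0 + 1)) powr (- (\<gamma> / 2)) \<le> u x t"
      using lower_log_barrier[OF card(1) D psol _ nonneg \<kappa>(1) \<gamma> \<kappa>(2)] t0 by (metis less_imp_le)
    define S where "S = \<kappa> * (1 + k) powr (- (\<gamma> / 2))"
    have S: "S > 0" using \<kappa> k by (simp add: S_def)
    show ?thesis
    proof (intro exI[of _ "p * (D + S) powr (- p - 1) * S"] conjI allI impI)
      show "p * (D + S) powr (- p - 1) * S > 0" using p S D by simp
      fix t assume t: "t0 \<le> t"
      define s where "s = S * (t + 1) powr (- (\<gamma> / 2))"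
      have t1: "(t + 1) powr (- (\<gamma> / 2)) \<le> 1 powr (- (\<gamma> / 2))" using t t0 \<gamma> by (intro powr_mono2') auto
      have s: "0 \<le> s" "s \<le> S" unfolding s_def using S t1 by simp_all
      \<comment> \<open>At the origin the logarithm in the barrier equals 1, leaving a power of
        \<open>1 + k * (t - t0 + 1)\<close>, which is comparable with \<open>t + 1\<close>.\<close>
      have "1 + k * (t - t0 + 1) \<le> (1 + k) * (t + 1)" using k t t0 by (simp add: algebra_simps)
      then have "((1 + k) * (t + 1)) powr (- (\<gamma> / 2)) \<le> (1 + k * (t - t0 + 1)) powr (- (\<gamma> / 2))"
        using k t \<gamma> by (intro powr_mono2') (auto simp: add_pos_nonneg)
      then have "s \<le> \<kappa> * (1 + k * (t - t0 + 1)) powr (- (\<gamma> / 2))"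
        unfolding s_def S_def using \<kappa> k t t0 by (simp add: powr_mult)
      also have "\<dots> \<le> u 0 t" using k(2)[OF t, of 0] by simp
      finally have "v 0 t \<le> (D + s) powr (- p)" using upper[of t s 0] s t t0 by simp
      also have "\<dots> \<le> D powr (- p) - p * (D + S) powr (- p - 1) * s"
        using D s p by (intro powr_neg_add_upper)
      finally show "v 0 t \<le> D powr (- p) - p * (D + S) powr (- p - 1) * S * (t + 1) powr (- (\<gamma> / 2))"
        by (simp add: s_def)
    qed
  qed
  have part2': "\<exists>c>0. \<forall>t>0. v 0 t \<le> D powr (- p) - c * (t + 1) powr (- (\<gamma> / 2))"
    if b: "b > 0" and \<gamma>: "0 < \<gamma>" and pos: "\<psi>0 0 > 0"
      and ge: "\<And>x. norm x > 2 \<Longrightarrow> \<psi>0 x \<ge> b * ln (norm x) powr (- \<gamma>)" for b \<gamma>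
  proof -
    \<comment> \<open>The constant of \<open>part2\<close> degenerates as its starting time tends to
      0, because the balls have to move ever faster. Continuity of \<open>u 0\<close> covers a short
      initial interval instead, and \<open>part2\<close> takes over from
      \<open>\<tau> / 2\<close>.\<close>
    define S where "S = \<psi>0 0 / 2"
    have S: "S > 0" using pos by (simp add: S_def)
    have "continuous_on (UNIV \<times> {0..}) (\<lambda>(x, t). u x t)"
      using psol by (simp add: pressure_solution_def)
    then have "continuous_on {0..} (\<lambda>t. (\<lambda>(x, t). u x t) (0, t))"
      by (rule continuous_on_compose2) (auto intro!: continuous_intros)
    then have "continuous_on {0..} (u 0)" by simp
    then obtain \<tau> where \<tau>: "\<tau> > 0" "\<And>t. t \<ge> 0 \<Longrightarrow> dist t 0 < \<tau> \<Longrightarrow> dist (u 0 t) (u 0 0) < S"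
      unfolding continuous_on_iff using S by (metis atLeast_iff order_refl)
    have near: "u 0 t \<ge> S" if "t \<ge> 0" "t < \<tau>" for t
      using \<tau>(2)[of t] that by (simp add: dist_real_def u0 S_def abs_if split: if_splits)
    obtain c1 where c1: "c1 > 0" "\<And>t. t \<ge> \<tau> / 2 \<Longrightarrow> v 0 t \<le> D powr (- p) - c1 * (t + 1) powr (- (\<gamma> / 2))"
      using part2[OF b \<gamma> _ ge, of "\<tau> / 2"] \<tau>(1) by auto
    define c2 where "c2 = p * (D + S) powr (- p - 1) * S"
    have c2: "c2 > 0" using p S D by (simp add: c2_def)
    show ?thesis
    proof (intro exI[of _ "min c1 c2"] conjI allI impI)
      fix t :: real assume t: "t > 0"
      have q: "0 \<le> (t + 1) powr (- (\<gamma> / 2))" "(t + 1) powr (- (\<gamma> / 2)) \<le> 1"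
        using powr_mono2'[of "- (\<gamma> / 2)" 1 "t + 1"] t \<gamma> by simp_all
      show "v 0 t \<le> D powr (- p) - min c1 c2 * (t + 1) powr (- (\<gamma> / 2))"
      proof (cases "t < \<tau>")
        case True
        have "v 0 t \<le> (D + S) powr (- p)" using upper[of t S 0] near[of t] S t True by simp
        also have "\<dots> \<le> D powr (- p) - c2" unfolding c2_def using D S p by (intro powr_neg_add_upper) auto
        also have "\<dots> \<le> D powr (- p) - min c1 c2 * (t + 1) powr (- (\<gamma> / 2))"
          using mult_mono[of "min c1 c2" c2 "(t + 1) powr (- (\<gamma> / 2))" 1] q c2 by simp
        finally show ?thesis .
      next
        case False
        then have "v 0 t \<le> D powr (- p) - c1 * (t + 1) powr (- (\<gamma> / 2))" using c1(2)[of t] \<tau>(1) by simp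
        moreover have "min c1 c2 * (t + 1) powr (- (\<gamma> / 2)) \<le> c1 * (t + 1) powr (- (\<gamma> / 2))"
          using q by (intro mult_right_mono) auto
        ultimately show ?thesis by linarith
      qed
    qed (use c1 c2 in simp)
  qed
  have bar0: "barenblatt m D (0 :: real ^ 'k) = D powr (- p)"
    by (simp add: barenblatt_def mp)
  show ?thesis
    unfolding bar0
  proof (intro conjI allI impI; elim conjE)
  qed (simp_all add: part1 part2 part2')
qed

end
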